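(* Let $A>0$, $\gamma>1$, $\mu>0$, and assume $$\inf_{x\in(0,1)}\tau_0(x)>0,\qquad \tau_0\in L^\infty(0,1),\qquad u_0\in L^2(0,1),\qquad b_0\in L^\infty(0,1),$$ with the normalization $\int_0^1\tau_0(x)\,dx=1$. Let $(\tau,u,b)$ be the unique global weak solution (in the sense defined in the context) with initial data $(\tau_0,u_0,b_0)$, and let $(\tau_s,0,b_s)$ be the stationary solution defined in the context. Then there exist two positive constants $C_1,C_2$, independent of time and depending only on $A,\gamma,\mu$, the initial data and the stationary solution, such that $$\|(\tau-\tau_s)(t)\|_{L^2}+\|u(t)\|_{L^2}+\|(b-b_s)(t)\|_{L^2}\le C_1\exp(-C_2t)\qquad\text{for any }t\ge 0.$$
   Context: Notation: $\Omega=(0,1)$, $\Omega_T=\Omega\times(0,T)$; $L^p=L^p(\Omega)$, $H^1_0=H^1_0(\Omega)$; $W^{1,2}(0,T;L^2)$ is the set of $v\in L^2(0,T;L^2)$ whose weak derivative $v_t$ lies in $L^2(0,T;L^2)$. The initial-boundary value problem. The unknowns are the specific volume $\tau=\tau(x,t)>0$, the velocity $u(x,t)\in\mathbb{R}$ and the magnetic field $b(x,t)\in\mathbb{R}$, with $x\in[0,1]$, $t\ge 0$, satisfying $$\tau_t=u_x,\qquad u_t=\sigma_x,\qquad (b\tau)_t=0,\qquad \sigma:=\mu\frac{u_x}{\tau}-A\tau^{-\gamma}-\frac12 b^2,$$ with initial condition $(\tau,u,b)(x,0)=(\tau_0,u_0,b_0)(x)$ and boundary condition $u(0,t)=u(1,t)=0$.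 Definition of weak solution. Let $\inf_{(0,1)}\tau_0>0$, $\tau_0,b_0\in L^\infty$, $u_0\in L^2$. A triple $(\tau,u,b)$ is a weak solution on $[0,1]\times[0,T]$ with these initial data and the boundary condition $u(0,t)=u(1,t)=0$ if $$\tau\in W^{1,2}(0,T;L^2),\quad u\in L^\infty(0,T;L^2)\cap L^2(0,T;H^1_0),\quad b\in W^{1,2}(0,T;L^2),$$ $$\inf_{\Omega_T}\tau>0,\quad \tau,b\in L^\infty(\Omega_T),$$ $$\tau_t=u_x,\quad b=b_0\tau_0\tau^{-1}\ \text{ a.e. in }\Omega_T,\qquad \tau(x,0)=\tau_0(x)\ \text{ for a.e. }x\in\Omega,$$ and for every test function $\psi\in C_c^\infty(\Omega\times[0,T))$, $$\int_0^T\!\!\int_\Omega \Big[u\psi_t-\Big(\mu\frac{u_x}{\tau}-A\tau^{-\gamma}-\frac12 b^2\Big)\psi_x\Big]\,dx\,dt+\int_\Omega u_0\,\psi(x,0)\,dx=0.$$ (Infima are understood as essential infima.) A global weak solution is a triple on $[0,1]\times[0,\infty)$ whose restriction to $[0,1]\times[0,T]$ is a weak solution for every $T\in(0,\infty)$; for initial data with $\inf_{(0,1)}\tau_0>0$, $\tau_0,b_0\in L^\infty$, $u_0\in L^2$ it exists and is unique. Values at a fixed time $t$ refer to the representative of $(\tau,u,b)$ that is continuous in time with values in $L^2$. Stationary solution. $(\tau_s,u_s,b_s)$ with $u_s=0$ and $\tau_s>0$, $b_s$ functions on $(0,1)$ is the unique solution of $$\int_0^1\tau_s(x)\,dx=\int_0^1\tau_0(x)\,dx=1,\qquad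 A\tau_s^{-\gamma}+\frac12 b_s^2=C_0,\qquad b_s=b_0\tau_0\tau_s^{-1},$$ where $C_0$ is a constant, determined by the condition $\int_0^1\tau_s\,dx=1$. *)

theory Defs
  imports "HOL-Analysis.Analysis"
begin

text \<open>
  Elements of Lebesgue and Sobolev spaces are represented by Lebesgue measurable functions, and
  all statements about them are invariant under modification on null sets. Functions of
  space and time are functions on pairs \<open>(x, t)\<close>.
\<close>

abbreviation \<Omega> :: "real set"
  where "\<Omega> \<equiv> {0<..<1}"

abbreviation \<Omega>\<^sub>T :: "real \<Rightarrow> (real \<times> real) set"
  where "\<Omega>\<^sub>T T \<equiv> \<Omega> \<times> {0<..<T}"


subsection \<open>Smooth functions with compact support\<close>

primrec C_k :: "nat \<Rightarrow> ('a::euclidean_space \<Rightarrow> real) \<Rightarrow> bool" where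
  "C_k 0 f \<longleftrightarrow> continuous_on UNIV f"
| "C_k (Suc k) f \<longleftrightarrow>
     (\<forall>x. f differentiable (at x)) \<and> (\<forall>v. C_k k (\<lambda>x. frechet_derivative f (at x) v))"

definition test_function :: "'a::euclidean_space set \<Rightarrow> ('a \<Rightarrow> real) \<Rightarrow> bool" where
  "test_function U \<phi> \<longleftrightarrow>
     (\<forall>k. C_k k \<phi>) \<and> compact (closure {x. \<phi> x \<noteq> 0}) \<and> closure {x. \<phi> x \<noteq> 0} \<subseteq> U"


subsection \<open>Lebesgue spaces\<close>

definition in_L2 :: "'a::euclidean_space set \<Rightarrow> ('a \<Rightarrow> real) \<Rightarrow> bool" where
  "in_L2 S f \<longleftrightarrow>
     f \<in> borel_measurable (lebesgue_on S) \<and> integrable (lebesgue_on S) (\<lambda>x. (f x)\<^sup>2)"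

definition L2_norm :: "'a::euclidean_space set \<Rightarrow> ('a \<Rightarrow> real) \<Rightarrow> real" where
  "L2_norm S f = sqrt (\<integral>x. (f x)\<^sup>2 \<partial>lebesgue_on S)"

definition in_Linf :: "'a::euclidean_space set \<Rightarrow> ('a \<Rightarrow> real) \<Rightarrow> bool" where
  "in_Linf S f \<longleftrightarrow>
     f \<in> borel_measurable (lebesgue_on S) \<and> (\<exists>C. AE x in lebesgue_on S. \<bar>f x\<bar> \<le> C)"

definition ess_inf_pos :: "'a::euclidean_space set \<Rightarrow> ('a \<Rightarrow> real) \<Rightarrow> bool" where
  "ess_inf_pos S f \<longleftrightarrow> (\<exists>c>0. AE x in lebesgue_on S. c \<le> f x)"


subsection \<open>Sobolev functions on the interval\<close>

definition weak_deriv :: "(real \<Rightarrow> real) \<Rightarrow> (real \<Rightarrow> real) \<Rightarrow> bool" where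
  "weak_deriv f g \<longleftrightarrow> in_L2 \<Omega> f \<and> in_L2 \<Omega> g \<and>
     (\<forall>\<phi>. test_function \<Omega> \<phi> \<longrightarrow>
        (\<integral>x. f x * deriv \<phi> x \<partial>lebesgue_on \<Omega>) = - (\<integral>x. g x * \<phi> x \<partial>lebesgue_on \<Omega>))"

text \<open>\<open>H1_0 f g\<close>: \<open>f\<close> lies in the closure of the test functions in the \<open>H\<^sup>1\<close> norm,
  and \<open>g\<close> is its weak derivative.\<close>

definition H1_0 :: "(real \<Rightarrow> real) \<Rightarrow> (real \<Rightarrow> real) \<Rightarrow> bool" where
  "H1_0 f g \<longleftrightarrow> weak_deriv f g \<and>
     (\<exists>\<phi>. (\<forall>n. test_function \<Omega> (\<phi> n)) \<and>
        (\<lambda>n. L2_norm \<Omega> (\<lambda>x. \<phi> n x - f x)) \<longlonglongrightarrow> 0 \<and>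
        (\<lambda>n. L2_norm \<Omega> (\<lambda>x. deriv (\<phi> n) x - g x)) \<longlonglongrightarrow> 0)"


subsection \<open>Spaces of time dependent functions\<close>

text \<open>
  \<open>L\<^sup>2(0,T;L\<^sup>2)\<close> is identified with \<open>L\<^sup>2(\<Omega>\<^sub>T)\<close>. In the two definitions with a derivative, the
  second function is the (almost everywhere unique) derivative of the first.
\<close>

definition Linf_L2 :: "real \<Rightarrow> (real \<times> real \<Rightarrow> real) \<Rightarrow> bool" where
  "Linf_L2 T v \<longleftrightarrow> v \<in> borel_measurable (lebesgue_on (\<Omega>\<^sub>T T)) \<and>
     (\<exists>C. AE t in lebesgue_on {0<..<T}.
        in_L2 \<Omega> (\<lambda>x. v (x, t)) \<and> L2_norm \<Omega> (\<lambda>x. v (x, t)) \<le> C)"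

definition L2_H1_0 :: "real \<Rightarrow> (real \<times> real \<Rightarrow> real) \<Rightarrow> (real \<times> real \<Rightarrow> real) \<Rightarrow> bool" where
  "L2_H1_0 T v v\<^sub>x \<longleftrightarrow> in_L2 (\<Omega>\<^sub>T T) v \<and> in_L2 (\<Omega>\<^sub>T T) v\<^sub>x \<and>
     (AE t in lebesgue_on {0<..<T}. H1_0 (\<lambda>x. v (x, t)) (\<lambda>x. v\<^sub>x (x, t)))"

text \<open>
  The time derivative is the weak derivative of an \<open>L\<^sup>2\<close>-valued function, tested with scalar
  functions of time. The \<open>L\<^sup>2\<close>-valued integrals that occur are computed at almost every \<open>x\<close>.
\<close>

definition W12_L2 :: "real \<Rightarrow> (real \<times> real \<Rightarrow> real) \<Rightarrow> (real \<times> real \<Rightarrow> real) \<Rightarrow> bool" where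
  "W12_L2 T v v\<^sub>t \<longleftrightarrow> in_L2 (\<Omega>\<^sub>T T) v \<and> in_L2 (\<Omega>\<^sub>T T) v\<^sub>t \<and>
     (\<forall>\<phi>. test_function {0<..<T} \<phi> \<longrightarrow>
        (AE x in lebesgue_on \<Omega>.
           (\<integral>t. v (x, t) * deriv \<phi> t \<partial>lebesgue_on {0<..<T})
             = - (\<integral>t. v\<^sub>t (x, t) * \<phi> t \<partial>lebesgue_on {0<..<T})))"

text \<open>\<open>V\<close> is the representative of \<open>v\<close> that is continuous from the time interval \<open>J\<close> to \<open>L\<^sup>2\<close>.\<close>

definition L2_continuous_rep ::
  "real set \<Rightarrow> (real \<times> real \<Rightarrow> real) \<Rightarrow> (real \<Rightarrow> real \<Rightarrow> real) \<Rightarrow> bool" where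
  "L2_continuous_rep J v V \<longleftrightarrow>
     (\<forall>t\<in>J. in_L2 \<Omega> (V t)) \<and>
     (\<forall>t\<in>J. ((\<lambda>s. L2_norm \<Omega> (\<lambda>x. V s x - V t x)) \<longlongrightarrow> 0) (at t within J)) \<and>
     (AE t in lebesgue_on J. AE x in lebesgue_on \<Omega>. v (x, t) = V t x)"


subsection \<open>Weak solutions and stationary solutions\<close>

text \<open>
  The test functions in \<open>C\<^sub>c\<^sup>\<infinity>(\<Omega> \<times> [0,T))\<close> are the restrictions to \<open>t \<ge> 0\<close> of smooth functions
  on the plane with compact support in \<open>\<Omega> \<times> (-\<infinity>,T)\<close>; they need not vanish at \<open>t = 0\<close>.
\<close>

definition weak_solution ::
  "real \<Rightarrow> real \<Rightarrow> real \<Rightarrow> (real \<Rightarrow> real) \<Rightarrow> (real \<Rightarrow> real) \<Rightarrow> (real \<Rightarrow> real) \<Rightarrow> real \<Rightarrow>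
   (real \<times> real \<Rightarrow> real) \<Rightarrow> (real \<times> real \<Rightarrow> real) \<Rightarrow> (real \<times> real \<Rightarrow> real) \<Rightarrow> bool" where
  "weak_solution A \<gamma> \<mu> \<tau>\<^sub>0 u\<^sub>0 b\<^sub>0 T \<tau> u b \<longleftrightarrow>
     (\<exists>\<tau>\<^sub>t u\<^sub>x b\<^sub>t.
        W12_L2 T \<tau> \<tau>\<^sub>t \<and> Linf_L2 T u \<and> L2_H1_0 T u u\<^sub>x \<and> W12_L2 T b b\<^sub>t \<and>
        ess_inf_pos (\<Omega>\<^sub>T T) \<tau> \<and> in_Linf (\<Omega>\<^sub>T T) \<tau> \<and> in_Linf (\<Omega>\<^sub>T T) b \<and>
        (AE p in lebesgue_on (\<Omega>\<^sub>T T). \<tau>\<^sub>t p = u\<^sub>x p) \<and>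
        (AE p in lebesgue_on (\<Omega>\<^sub>T T). b p = b\<^sub>0 (fst p) * \<tau>\<^sub>0 (fst p) / \<tau> p) \<and>
        (\<exists>V. L2_continuous_rep {0..T} \<tau> V \<and> (AE x in lebesgue_on \<Omega>. V 0 x = \<tau>\<^sub>0 x)) \<and>
        (\<forall>\<psi>. test_function (\<Omega> \<times> {..<T}) \<psi> \<longrightarrow>
           (\<integral>(x, t). u (x, t) * deriv (\<lambda>s. \<psi> (x, s)) t
              - (\<mu> * u\<^sub>x (x, t) / \<tau> (x, t) - A * \<tau> (x, t) powr (- \<gamma>) - (b (x, t))\<^sup>2 / 2)
                * deriv (\<lambda>y. \<psi> (y, t)) x \<partial>lebesgue_on (\<Omega>\<^sub>T T))
           + (\<integral>x. u\<^sub>0 x * \<psi> (x, 0) \<partial>lebesgue_on \<Omega>) = 0))"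

definition global_weak_solution ::
  "real \<Rightarrow> real \<Rightarrow> real \<Rightarrow> (real \<Rightarrow> real) \<Rightarrow> (real \<Rightarrow> real) \<Rightarrow> (real \<Rightarrow> real) \<Rightarrow>
   (real \<times> real \<Rightarrow> real) \<Rightarrow> (real \<times> real \<Rightarrow> real) \<Rightarrow> (real \<times> real \<Rightarrow> real) \<Rightarrow> bool" where
  "global_weak_solution A \<gamma> \<mu> \<tau>\<^sub>0 u\<^sub>0 b\<^sub>0 \<tau> u b \<longleftrightarrow>
     (\<forall>T>0. weak_solution A \<gamma> \<mu> \<tau>\<^sub>0 u\<^sub>0 b\<^sub>0 T \<tau> u b)"

definition stationary_solution ::
  "real \<Rightarrow> real \<Rightarrow> (real \<Rightarrow> real) \<Rightarrow> (real \<Rightarrow> real) \<Rightarrow>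
   (real \<Rightarrow> real) \<Rightarrow> (real \<Rightarrow> real) \<Rightarrow> bool" where
  "stationary_solution A \<gamma> \<tau>\<^sub>0 b\<^sub>0 \<tau>\<^sub>s b\<^sub>s \<longleftrightarrow>
     integrable (lebesgue_on \<Omega>) \<tau>\<^sub>s \<and>
     (\<integral>x. \<tau>\<^sub>s x \<partial>lebesgue_on \<Omega>) = (\<integral>x. \<tau>\<^sub>0 x \<partial>lebesgue_on \<Omega>) \<and>
     (AE x in lebesgue_on \<Omega>. 0 < \<tau>\<^sub>s x) \<and>
     (\<exists>C\<^sub>0. AE x in lebesgue_on \<Omega>. A * \<tau>\<^sub>s x powr (- \<gamma>) + (b\<^sub>s x)\<^sup>2 / 2 = C\<^sub>0) \<and>
     (AE x in lebesgue_on \<Omega>. b\<^sub>s x = b\<^sub>0 x * \<tau>\<^sub>0 x / \<tau>\<^sub>s x)"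

end

theory Submission
  imports Defs "HOL-Real_Asymp.Real_Asymp"
begin

text \<open>
  Integrating the momentum equation in space and time turns it into
  \<open>\<mu> ln \<tau> - \<integral>\<^sub>0\<^sup>x u = (a function of t) + (a function of x) + \<integral>\<^sub>0\<^sup>t P(x, \<tau>)\<close>, where
  \<open>P(x, \<tau>) = A \<tau>\<^sup>-\<^sup>\<gamma> + (b\<^sub>0 \<tau>\<^sub>0)\<^sup>2 / (2 \<tau>\<^sup>2)\<close> decreases in \<open>\<tau>\<close>. Averaging against \<open>\<tau>\<close>, which has mass one, identifies
  the function of time up to a bounded term as \<open>- \<integral>\<^sub>0\<^sup>t g\<close> with \<open>g = \<integral> (\<tau> P + u\<^sup>2) dx\<close>. Jensen's and the energy
  inequality give \<open>A \<le> g \<le> G\<close>, so that at almost every \<open>x\<close> a bounded perturbation of \<open>\<mu> ln \<tau>\<close> solves an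
  ordinary differential equation with right-hand side \<open>P - g\<close>: it decreases where \<open>\<tau>\<close> is large and increases
  where \<open>\<tau>\<close> is small. Hence \<open>\<tau>\<close> is bounded above and below uniformly in time.

  With these bounds, the energy relative to the stationary state plus \<open>\<epsilon> \<integral> u Y\<close>, where
  \<open>Y\<^sub>x = \<tau> - \<tau>\<^sub>s\<close> and \<open>Y\<close> vanishes at both ends, is equivalent to \<open>\<parallel>u\<parallel>\<^sup>2 + \<parallel>\<tau> - \<tau>\<^sub>s\<parallel>\<^sup>2\<close> and is dissipated at a
  rate proportional to itself.
\<close>

section \<open>Smooth cut-off functions\<close>

lemma C_k_imp_continuous: "C_k k f \<Longrightarrow> continuous_on UNIV f"
  by (cases k) (auto intro!: differentiable_imp_continuous_on simp: differentiable_on_def)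

lemma C_k_const: "C_k k (\<lambda>_. c)"
  by (induction k arbitrary: c) auto

lemma C_k_SucI:
  assumes "\<And>x. (f has_derivative f' x) (at x)" "\<And>v. C_k k (\<lambda>x. f' x v)"
  shows "C_k (Suc k) f"
proof -
  have "frechet_derivative f (at x) = f' x" for x
    using assms(1) frechet_derivative_at by metis
  then show ?thesis using assms by (auto simp: differentiable_def)
qed

lemma C_k_SucD: "C_k (Suc k) f \<Longrightarrow> (f has_derivative frechet_derivative f (at x)) (at x)"
  by (simp add: frechet_derivative_works[symmetric])

lemma C_k_lower: "C_k (Suc k) f \<Longrightarrow> C_k k f"
proof (induction k arbitrary: f)
  case 0
  show ?case using C_k_imp_continuous[OF 0] by (simp only: C_k.simps)
next
  case (Suc k)
  then show ?case by (auto intro!: Suc.IH)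
qed

lemma C_k_add:
  assumes "C_k k f" "C_k k g"
  shows "C_k k (\<lambda>x. f x + g x)"
  using assms
proof (induction k arbitrary: f g)
  case 0
  then show ?case by (auto intro: continuous_intros)
next
  case (Suc k)
  show ?case
  proof (rule C_k_SucI)
    show "((\<lambda>x. f x + g x) has_derivative
      (\<lambda>v. frechet_derivative f (at x) v + frechet_derivative g (at x) v)) (at x)" for x
      by (intro has_derivative_add C_k_SucD[OF Suc.prems(1)] C_k_SucD[OF Suc.prems(2)])
    show "C_k k (\<lambda>x. frechet_derivative f (at x) v + frechet_derivative g (at x) v)" for v
      using Suc by auto
  qed
qed

lemma C_k_mult:
  assumes "C_k k f" "C_k k g"
  shows "C_k k (\<lambda>x. f x * g x)"
  using assms
proof (induction k arbitrary: f g)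
  case 0
  then show ?case by (auto intro: continuous_intros)
next
  case (Suc k)
  show ?case
  proof (rule C_k_SucI)
    show "((\<lambda>x. f x * g x) has_derivative
      (\<lambda>v. f x * frechet_derivative g (at x) v + frechet_derivative f (at x) v * g x)) (at x)" for x
      by (intro has_derivative_mult C_k_SucD[OF Suc.prems(1)] C_k_SucD[OF Suc.prems(2)])
    show "C_k k (\<lambda>x. f x * frechet_derivative g (at x) v + frechet_derivative f (at x) v * g x)" for v
      using Suc.prems by (intro C_k_add Suc.IH) (auto intro: C_k_lower simp del: C_k.simps(2), auto)
  qed
qed

lemma C_k_diff:
  assumes "C_k k f" "C_k k g"
  shows "C_k k (\<lambda>x. f x - g x)"
  using C_k_add[OF assms(1) C_k_mult[OF C_k_const[of k "-1"] assms(2)]] by simp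

lemma C_k_Suc_real:
  fixes f :: "real \<Rightarrow> real"
  assumes "\<And>x. (f has_real_derivative f' x) (at x)" "C_k k f'"
  shows "C_k (Suc k) f"
  using assms by (intro C_k_SucI[where f' = "\<lambda>x v. f' x * v"])
    (auto simp: has_field_derivative_def intro: C_k_mult C_k_const)

lemma C_k_deriv:
  fixes f :: "real \<Rightarrow> real"
  assumes "C_k (Suc k) f"
  shows "(f has_real_derivative deriv f x) (at x)" "C_k k (deriv f)"
proof -
  have D: "f field_differentiable (at x)" for x
    using assms by (auto simp: field_differentiable_def real_differentiable_def)
  then show d: "(f has_real_derivative deriv f x) (at x)" for x
    using DERIV_deriv_iff_field_differentiable by blast
  then have "frechet_derivative f (at x) = (\<lambda>v. deriv f x * v)" for x
    by (metis frechet_derivative_at has_field_derivative_def)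
  then show "C_k k (deriv f)"
    using assms by (auto dest: spec[of _ 1])
qed

lemma C_k_compose_linear:
  fixes f :: "real \<Rightarrow> real" and l :: "'a::euclidean_space \<Rightarrow> real"
  assumes l: "bounded_linear l" and "C_k k f"
  shows "C_k k (\<lambda>p. f (l p + c))"
  using assms(2)
proof (induction k arbitrary: f)
  case 0
  then show ?case
    using continuous_on_compose2[of UNIV f UNIV "\<lambda>p. l p + c"]
    by (simp add: continuous_on_add linear_continuous_on[OF l])
next
  case (Suc k)
  show ?case
  proof (rule C_k_SucI)
    show "((\<lambda>p. f (l p + c)) has_derivative (\<lambda>v. frechet_derivative f (at (l p + c)) (l v))) (at p)" for p
      by (rule has_derivative_compose[OF _ C_k_SucD[OF Suc.prems], where f = "\<lambda>p. l p + c"])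
        (auto intro!: derivative_eq_intros bounded_linear_imp_has_derivative l)
    show "C_k k (\<lambda>p. frechet_derivative f (at (l p + c)) (l v))" for v
      using Suc by (intro Suc.IH) auto
  qed
qed

lemma C_k_affine:
  fixes f :: "real \<Rightarrow> real"
  assumes "C_k k f"
  shows "C_k k (\<lambda>x. f (m * x + c))"
  using C_k_compose_linear[OF bounded_linear_mult_right[of m] assms] by simp

definition flat :: "real poly \<Rightarrow> real \<Rightarrow> real" where
  "flat p x = (if x > 0 then poly p (1 / x) * exp (- (1 / x)) else 0)"

lemma poly_exp_tendsto_0: "((\<lambda>y::real. poly p y * exp (- y)) \<longlongrightarrow> 0) at_top"
proof -
  have "((\<lambda>y::real. \<Sum>i\<le>degree p. coeff p i * (y ^ i / exp y)) \<longlongrightarrow> (\<Sum>i\<le>degree p. coeff p i * 0)) at_top"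
    by (intro tendsto_sum tendsto_mult tendsto_const tendsto_power_div_exp_0)
  then show ?thesis
    by (simp add: poly_altdef sum_distrib_right exp_minus divide_inverse mult.assoc)
qed

lemma flat_has_derivative:
  "(flat p has_real_derivative flat ((p - pderiv p) * [:0, 0, 1:]) x) (at x)"
proof -
  consider "x > 0" | "x < 0" | "x = 0" by linarith
  then show ?thesis
  proof cases
    case 1
    have "((\<lambda>x. poly p (1 / x) * exp (- (1 / x))) has_real_derivative
       flat ((p - pderiv p) * [:0, 0, 1:]) x) (at x)"
      using 1 by (auto intro!: derivative_eq_intros simp: flat_def power2_eq_square field_simps)
    moreover have "\<forall>\<^sub>F y in nhds x. poly p (1 / y) * exp (- (1 / y)) = flat p y"
      using 1 by (intro eventually_nhds_in_open[of "{0<..}" x, THEN eventually_mono])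
        (auto simp: flat_def)
    ultimately show ?thesis
      by (subst DERIV_cong_ev[symmetric, OF refl _ refl]) auto
  next
    case 2
    have "((\<lambda>x. 0) has_real_derivative flat ((p - pderiv p) * [:0, 0, 1:]) x) (at x)"
      using 2 by (auto simp: flat_def)
    moreover have "\<forall>\<^sub>F y in nhds x. 0 = flat p y"
      using 2 by (intro eventually_nhds_in_open[of "{..<0}" x, THEN eventually_mono])
        (auto simp: flat_def)
    ultimately show ?thesis
      by (subst DERIV_cong_ev[symmetric, OF refl _ refl]) auto
  next
    case 3
    have "((\<lambda>h. poly (p * [:0, 1:]) (inverse h) * exp (- inverse h)) \<longlongrightarrow> 0) (at_right 0)"
      using filterlim_compose[OF poly_exp_tendsto_0 filterlim_inverse_at_top_right] .
    then have "((\<lambda>h. (flat p h) / h) \<longlongrightarrow> 0) (at_right 0)"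
      by (rule Lim_transform_eventually) (auto simp: eventually_at_filter flat_def field_simps)
    moreover have "((\<lambda>h. (flat p h) / h) \<longlongrightarrow> 0) (at_left 0)"
      by (rule Lim_transform_eventually[where f = "\<lambda>_. 0"])
        (auto simp: eventually_at_filter flat_def)
    ultimately have "((\<lambda>h. (flat p h) / h) \<longlongrightarrow> 0) (at 0)"
      using filterlim_split_at by blast
    then show ?thesis
      using 3 by (simp add: DERIV_def flat_def)
  qed
qed

lemma C_k_flat: "C_k k (flat p)"
proof (induction k arbitrary: p)
  case 0
  show ?case
    using flat_has_derivative[of p] DERIV_isCont by (auto intro!: continuous_at_imp_continuous_on)
next
  case (Suc k)
  show ?case
    by (rule C_k_Suc_real[OF flat_has_derivative Suc])
qed

lemma antiderivative_real:
  fixes f :: "real \<Rightarrow> real"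
  assumes "continuous_on UNIV f"
  obtains F where "\<And>x. (F has_real_derivative f x) (at x)"
  using einterval_antiderivative[of "-\<infinity>" \<infinity> f] assms
  by (auto simp: continuous_on_eq_continuous_at has_real_derivative_iff_has_vector_derivative)

lemma C_k_antiderivative:
  fixes F f :: "real \<Rightarrow> real"
  assumes "\<And>x. (F has_real_derivative f x) (at x)" "\<forall>k. C_k k f"
  shows "C_k k F"
  using C_k_Suc_real[OF assms(1)] assms(2) C_k_lower by blast

lemma has_zero_derivative_imp_eq:
  fixes F :: "real \<Rightarrow> real"
  assumes "\<And>x. (F has_real_derivative f x) (at x)" "\<And>x. \<lbrakk>a < x; x < b\<rbrakk> \<Longrightarrow> f x = 0" "a \<le> b"
  shows "F a = F b"
proof (cases "a = b")
  case False
  then have "a < b" using assms by auto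
  have "continuous_on {a..b} F"
    using assms(1) DERIV_isCont by (auto intro!: continuous_at_imp_continuous_on)
  moreover have "(F has_real_derivative 0) (at x)" if "a < x" "x < b" for x
    using assms(1)[of x] assms(2)[OF that] by simp
  ultimately show ?thesis
    using DERIV_isconst_end[OF \<open>a < b\<close>, of F] by auto
qed simp

definition smooth_step :: "(real \<Rightarrow> real) \<Rightarrow> bool" where
  "smooth_step H \<longleftrightarrow> (\<forall>k. C_k k H) \<and> (\<forall>k. C_k k (deriv H)) \<and> (\<forall>x. 0 \<le> deriv H x) \<and>
     (\<forall>x. x \<le> 0 \<or> 1 \<le> x \<longrightarrow> deriv H x = 0) \<and> (\<forall>x\<le>0. H x = 0) \<and> (\<forall>x\<ge>1. H x = 1) \<and>
     (\<forall>x. 0 \<le> H x \<and> H x \<le> 1)"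

lemma smooth_step_exists: "\<exists>H. smooth_step H"
proof -
  define r where "r x = flat 1 x * flat 1 (1 - x)" for x :: real
  have r: "C_k k r" for k
    unfolding r_def[abs_def] using C_k_affine[OF C_k_flat, of k 1 "-1" 1]
    by (intro C_k_mult C_k_flat) simp
  have r_nonneg: "0 \<le> r x" for x by (auto simp: r_def flat_def)
  have r0: "x \<le> 0 \<or> 1 \<le> x \<Longrightarrow> r x = 0" for x by (auto simp: r_def flat_def)
  obtain F where F: "\<And>x. (F has_real_derivative r x) (at x)"
    using antiderivative_real[of r] r[of 0] by auto
  have "F 0 < F 1"
  proof (rule DERIV_pos_imp_increasing_open[of 0 1 F])
    show "continuous_on {0..1} F"
      using F DERIV_isCont by (auto intro!: continuous_at_imp_continuous_on)
    show "\<exists>y. DERIV F x :> y \<and> 0 < y" if "0 < x" "x < 1" for x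
      using F[of x] that by (intro exI[of _ "r x"]) (auto simp: r_def flat_def)
  qed simp
  define H where "H x = inverse (F 1 - F 0) * (F x - F 0)" for x
  define \<rho> where "\<rho> x = inverse (F 1 - F 0) * r x" for x
  have H: "(H has_real_derivative \<rho> x) (at x)" for x
    unfolding H_def[abs_def] \<rho>_def by (auto intro!: derivative_eq_intros F)
  have \<rho>: "C_k k \<rho>" for k
    unfolding \<rho>_def[abs_def] by (intro C_k_mult C_k_const r)
  have mono: "H x \<le> H y" if "x \<le> y" for x y
  proof (rule DERIV_nonneg_imp_nondecreasing[OF that])
    show "\<exists>y. (H has_real_derivative y) (at z) \<and> 0 \<le> y" for z
      using H[of z] r_nonneg[of z] \<open>F 0 < F 1\<close> by (intro exI[of _ "\<rho> z"]) (auto simp: \<rho>_def)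
  qed
  have 0: "H x = 0" if "x \<le> 0" for x
    using has_zero_derivative_imp_eq[OF H, of x 0] that by (auto simp: \<rho>_def r0 H_def)
  have 1: "H x = 1" if "1 \<le> x" for x
    using has_zero_derivative_imp_eq[OF H, of 1 x] that \<open>F 0 < F 1\<close> by (auto simp: \<rho>_def r0 H_def)
  have dH: "deriv H x = \<rho> x" for x by (rule DERIV_imp_deriv[OF H])
  have "smooth_step H"
    unfolding smooth_step_def dH[abs_def]
  proof (intro conjI allI impI)
    show "0 \<le> H x" for x using mono[of 0 x] 0[of x] 0[of 0] by linarith
    show "H x \<le> 1" for x using mono[of x 1] 1[of x] 1[of 1] by linarith
    show "C_k k H" for k using C_k_antiderivative[OF H] \<rho> by blast
    show "0 \<le> \<rho> x" for x using r_nonneg \<open>F 0 < F 1\<close> by (simp add: \<rho>_def)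
    show "\<rho> x = 0" if "x \<le> 0 \<or> 1 \<le> x" for x using that r0 by (simp add: \<rho>_def)
  qed (use \<rho> 0 1 in auto)
  then show ?thesis by blast
qed

definition ramp :: "real \<Rightarrow> real" where "ramp = (SOME H. smooth_step H)"

lemma ramp_smooth_step: "smooth_step ramp"
  unfolding ramp_def by (rule someI_ex[OF smooth_step_exists])

lemma ramp_C_k: "C_k k ramp" "C_k k (deriv ramp)"
  using ramp_smooth_step by (auto simp: smooth_step_def)

lemma ramp_continuous: "continuous_on UNIV ramp" "continuous_on UNIV (deriv ramp)"
  by (rule C_k_imp_continuous[OF ramp_C_k(1)] C_k_imp_continuous[OF ramp_C_k(2)])+

lemma ramp_deriv: "(ramp has_real_derivative deriv ramp x) (at x)"
  by (rule C_k_deriv(1)[OF ramp_C_k(1)])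

lemma ramp:
  shows "x \<le> 0 \<Longrightarrow> ramp x = 0" "1 \<le> x \<Longrightarrow> ramp x = 1" "0 \<le> ramp x" "ramp x \<le> 1"
    "0 \<le> deriv ramp x" "x \<le> 0 \<Longrightarrow> deriv ramp x = 0" "1 \<le> x \<Longrightarrow> deriv ramp x = 0"
  using ramp_smooth_step by (auto simp: smooth_step_def)

lemma DERIV_affine:
  fixes H :: "real \<Rightarrow> real"
  assumes "\<And>x. (H has_real_derivative \<rho> x) (at x)"
  shows "((\<lambda>r. H (n * (r - s))) has_real_derivative n * \<rho> (n * (r - s))) (at r)"
proof -
  have "((\<lambda>r. n * (r - s)) has_real_derivative n) (at r)" by (auto intro!: derivative_eq_intros)
  from DERIV_chain2[OF assms this] show ?thesis by (simp add: mult.commute)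
qed

lemmas ramp_affine_deriv = DERIV_affine[OF ramp_deriv]

lemma test_functionI:
  assumes "\<And>k. C_k k \<phi>" "compact K" "\<And>x. x \<notin> K \<Longrightarrow> \<phi> x = 0" "K \<subseteq> U"
  shows "test_function U \<phi>"
proof -
  have "closure {x. \<phi> x \<noteq> 0} \<subseteq> K"
    using assms by (intro closure_minimal) (auto intro: compact_imp_closed)
  moreover from this have "compact (closure {x. \<phi> x \<noteq> 0})"
    using assms compact_imp_bounded bounded_subset compact_eq_bounded_closed by blast
  ultimately show ?thesis
    using assms by (auto simp: test_function_def)
qed

lemma test_function_deriv:
  fixes \<phi> :: "real \<Rightarrow> real"
  assumes "test_function U \<phi>"
  shows "(\<phi> has_real_derivative deriv \<phi> x) (at x)" "C_k k (deriv \<phi>)"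
  using assms C_k_deriv[of _ \<phi>] unfolding test_function_def by blast+

lemma test_function_outside:
  fixes \<phi> :: "'a::euclidean_space \<Rightarrow> real"
  assumes "test_function U \<phi>" "x \<notin> U"
  shows "\<phi> x = 0"
  using assms closure_subset[of "{x. \<phi> x \<noteq> 0}"] by (auto simp: test_function_def)

lemma test_function_bounded:
  fixes \<phi> :: "'a::euclidean_space \<Rightarrow> real"
  assumes "test_function U \<phi>"
  obtains C where "\<And>x. \<bar>\<phi> x\<bar> \<le> C"
proof -
  let ?K = "closure {x. \<phi> x \<noteq> 0}"
  have "C_k 0 \<phi>" using assms by (simp only: test_function_def)
  then have "compact (\<phi> ` ?K)"
    using assms by (intro compact_continuous_image) (auto simp: test_function_def intro: continuous_on_subset)
  then obtain C where C: "\<And>x. x \<in> ?K \<Longrightarrow> \<bar>\<phi> x\<bar> \<le> C"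
    using compact_imp_bounded by (fastforce simp: bounded_iff)
  have "\<bar>\<phi> x\<bar> \<le> max C 0" for x
    using C[of x] closure_subset[of "{x. \<phi> x \<noteq> 0}"] by (cases "\<phi> x = 0") (auto simp: subset_iff le_max_iff_disj)
  then show thesis using that by blast
qed

lemma test_function_deriv_test:
  fixes \<phi> :: "real \<Rightarrow> real"
  assumes "test_function U \<phi>"
  shows "test_function U (deriv \<phi>)"
proof (rule test_functionI)
  let ?K = "closure {x. \<phi> x \<noteq> 0}"
  show "compact ?K" "?K \<subseteq> U" using assms by (auto simp: test_function_def)
  show "deriv \<phi> x = 0" if "x \<notin> ?K" for x
  proof -
    have "((\<lambda>x. 0) has_real_derivative 0) (at x)" by simp
    moreover have "\<forall>\<^sub>F y in nhds x. 0 = \<phi> y"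
      using that closure_subset[of "{x. \<phi> x \<noteq> 0}"]
      by (intro eventually_nhds_in_open[of "- ?K" x, THEN eventually_mono]) (auto simp: closed_def[symmetric])
    ultimately have "(\<phi> has_real_derivative 0) (at x)"
      using DERIV_cong_ev[of x x "\<lambda>_. 0" \<phi> 0 0] by simp
    then show ?thesis by (rule DERIV_imp_deriv)
  qed
qed (use test_function_deriv[OF assms] in auto)

section \<open>Absolutely continuous functions on an interval\<close>

text \<open>Lebesgue measure on the interval \<open>(0, T)\<close>, as a measure on all Borel sets of the line: every Borel
  function on the line is then measurable, and integrals over windows reaching out of \<open>(0, T)\<close> are truncated.\<close>

definition ivl :: "real \<Rightarrow> real measure" where
  "ivl T = density lborel (indicator {0<..<T})"

lemma sets_ivl [simp, measurable_cong]: "sets (ivl T) = sets borel"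
  by (simp add: ivl_def)

lemma space_ivl [simp]: "space (ivl T) = UNIV"
  by (simp add: ivl_def)

lemma AE_ivl: "(AE x in ivl T. P x) \<longleftrightarrow> (AE x in lborel. 0 < x \<and> x < T \<longrightarrow> P x)"
  by (subst ivl_def, subst AE_density) (auto simp: indicator_def)

lemma AE_ivl_mem: "AE x in ivl T. 0 < x \<and> x < T"
  by (simp add: AE_ivl)

lemma emeasure_ivl: "A \<in> sets borel \<Longrightarrow> emeasure (ivl T) A = emeasure lborel (A \<inter> {0<..<T})"
  by (simp add: ivl_def emeasure_density nn_integral_indicator'[symmetric] indicator_inter_arith[symmetric] mult.commute
      cong: nn_integral_cong) 

lemma finite_measure_ivl: "finite_measure (ivl T)"
proof
  have "emeasure (ivl T) UNIV \<le> emeasure lborel {0..T}"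
    by (subst emeasure_ivl) (auto intro!: emeasure_mono)
  also have "\<dots> < \<infinity>" by (cases "0 \<le> T") auto
  finally show "emeasure (ivl T) (space (ivl T)) \<noteq> \<infinity>" by simp
qed

interpretation ivl: finite_measure "ivl T" for T
  by (rule finite_measure_ivl)

interpretation ivl2: pair_sigma_finite "ivl S" "ivl T" for S T
  by unfold_locales

lemma measure_ivl_le:
  assumes "a \<le> b"
  shows "measure (ivl T) {a<..b} \<le> b - a"
proof -
  have "emeasure (ivl T) {a<..b} \<le> emeasure lborel {a<..b}"
    unfolding emeasure_ivl[of "{a<..b}", simplified] by (intro emeasure_mono) auto
  then show ?thesis
    using assms by (simp add: measure_def enn2real_leI)
qed

lemma measure_ivl:
  assumes "0 \<le> a" "a \<le> b" "b \<le> T"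
  shows "measure (ivl T) {a<..b} = b - a"
proof -
  have "emeasure (ivl T) {a<..b} = emeasure lborel ({a<..b} \<inter> {0<..<T})"
    by (simp add: emeasure_ivl)
  also have "\<dots> = emeasure lborel ({a<..b})"
  proof (rule emeasure_eq_AE)
    show "AE x in lborel. x \<in> {a<..b} \<inter> {0<..<T} \<longleftrightarrow> x \<in> {a<..b}"
      using AE_lborel_singleton[of T] by eventually_elim (use assms in auto)
  qed auto
  finally show ?thesis
    using assms by (simp add: measure_def)
qed

lemma measure_ivl_UNIV: "0 \<le> T \<Longrightarrow> measure (ivl T) UNIV = T"
  by (simp add: measure_def emeasure_ivl)

lemma AE_ivl_neq: "AE x in ivl T. x \<noteq> c"
  using AE_lborel_singleton[of c] by (auto simp: AE_ivl)

definition ival :: "real \<Rightarrow> (real \<Rightarrow> real) \<Rightarrow> real \<Rightarrow> real \<Rightarrow> real" where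
  "ival T g a b = (\<integral>r. indicator {a<..b} r * g r \<partial>ivl T)"

lemma integrable_ind_mult:
  fixes g :: "real \<Rightarrow> real"
  assumes "integrable (ivl T) g" "A \<in> sets borel"
  shows "integrable (ivl T) (\<lambda>r. indicator A r * g r)"
  using integrable_mult_indicator[of A "ivl T" g] assms by simp

lemma ival_combine:
  assumes "integrable (ivl T) g" "a \<le> b" "b \<le> c"
  shows "ival T g a c = ival T g a b + ival T g b c"
proof -
  have "ival T g a b + ival T g b c = (\<integral>r. indicator {a<..b} r * g r + indicator {b<..c} r * g r \<partial>ivl T)"
    unfolding ival_def using assms by (intro Bochner_Integration.integral_add[symmetric] integrable_ind_mult) auto
  also have "\<dots> = ival T g a c"
    unfolding ival_def using assms by (intro Bochner_Integration.integral_cong) (auto simp: indicator_def)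
  finally show ?thesis by simp
qed

lemma ival_self [simp]: "ival T g a a = 0"
  by (simp add: ival_def)

lemma ival_all:
  assumes "0 \<le> T" "T \<le> T'" "g \<in> borel_measurable borel"
  shows "ival T g 0 T' = (\<integral>r. g r \<partial>ivl T)"
  unfolding ival_def using assms
  by (intro integral_cong_AE eventually_mono[OF AE_ivl_mem]) (auto simp: indicator_def)

lemma ival_add:
  assumes "integrable (ivl T) f" "integrable (ivl T) g"
  shows "ival T (\<lambda>r. f r + g r) a b = ival T f a b + ival T g a b"
  unfolding ival_def using assms
  by (subst Bochner_Integration.integral_add[symmetric]) (auto intro!: integrable_ind_mult simp: distrib_left)

lemma ival_diff:
  assumes "integrable (ivl T) f" "integrable (ivl T) g"
  shows "ival T (\<lambda>r. f r - g r) a b = ival T f a b - ival T g a b"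
  unfolding ival_def using assms
  by (subst Bochner_Integration.integral_diff[symmetric]) (auto intro!: integrable_ind_mult simp: right_diff_distrib)

lemma ival_mult: "ival T (\<lambda>r. c * g r) a b = c * ival T g a b"
  unfolding ival_def by (simp add: mult.left_commute)

lemma ival_mono_AE:
  assumes "integrable (ivl T) f" "integrable (ivl T) g" "AE r in ivl T. a < r \<and> r \<le> b \<longrightarrow> f r \<le> g r"
  shows "ival T f a b \<le> ival T g a b"
  unfolding ival_def using assms
  by (intro integral_mono_AE integrable_ind_mult) (auto elim!: eventually_mono simp: indicator_def)

lemma ival_cong_AE:
  assumes "f \<in> borel_measurable borel" "g \<in> borel_measurable borel"
    "AE r in ivl T. a < r \<and> r \<le> b \<longrightarrow> f r = g r"
  shows "ival T f a b = ival T g a b"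
  unfolding ival_def using assms
  by (intro integral_cong_AE) (auto elim!: eventually_mono simp: indicator_def)

lemma ival_abs_le:
  assumes "integrable (ivl T) g"
  shows "\<bar>ival T g a b\<bar> \<le> ival T (\<lambda>r. \<bar>g r\<bar>) a b"
proof -
  have "\<bar>ival T g a b\<bar> \<le> (\<integral>r. \<bar>indicator {a<..b} r * g r\<bar> \<partial>ivl T)"
    unfolding ival_def using integral_norm_bound[of "ivl T" "\<lambda>r. indicator {a<..b} r * g r"] by simp
  then show ?thesis by (simp add: ival_def abs_mult)
qed

lemma ival_nonneg: "(\<And>r. 0 \<le> g r) \<Longrightarrow> 0 \<le> ival T g a b"
  unfolding ival_def by (intro integral_nonneg_AE) auto

lemma ival_le_integral:
  assumes "integrable (ivl T) g" "\<And>r. 0 \<le> g r"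
  shows "ival T g a b \<le> (\<integral>r. g r \<partial>ivl T)"
  unfolding ival_def using assms
  by (intro integral_mono integrable_ind_mult) (auto simp: indicator_def)

lemma ival_const_le: "a \<le> b \<Longrightarrow> 0 \<le> c \<Longrightarrow> ival T (\<lambda>_. c) a b \<le> c * (b - a)"
  unfolding ival_def using measure_ivl_le[of a b T] by (simp add: mult_left_mono mult.commute)

lemma ival_const: "\<lbrakk>0 \<le> a; a \<le> b; b \<le> T\<rbrakk> \<Longrightarrow> ival T (\<lambda>_. c) a b = c * (b - a)"
  unfolding ival_def using measure_ivl[of a b T] by simp

lemma ival_tendsto:
  assumes g: "integrable (ivl T) g" and "a \<longlonglongrightarrow> a0" "b \<longlonglongrightarrow> b0"
  shows "(\<lambda>n. ival T g (a n) (b n)) \<longlonglongrightarrow> ival T g a0 b0"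
  unfolding ival_def
proof (rule integral_dominated_convergence)
  show "integrable (ivl T) (\<lambda>r. \<bar>g r\<bar>)" using g by auto
  show "AE r in ivl T. (\<lambda>n. indicator {a n<..b n} r * g r) \<longlonglongrightarrow> indicator {a0<..b0} r * g r"
    using AE_ivl_neq[of a0 T] AE_ivl_neq[of b0 T]
  proof eventually_elim
    case (elim r)
    have "\<forall>\<^sub>F n in sequentially. (a n < r) = (a0 < r)"
    proof (cases "a0 < r")
      case True
      then show ?thesis using order_tendstoD(2)[OF assms(2)] by (auto elim: eventually_mono)
    next
      case False
      then show ?thesis using order_tendstoD(1)[OF assms(2), of r] elim by (auto elim: eventually_mono)
    qed
    moreover have "\<forall>\<^sub>F n in sequentially. (r \<le> b n) = (r \<le> b0)"
    proof (cases "r < b0")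
      case True
      then show ?thesis using order_tendstoD(1)[OF assms(3)] by (force elim!: eventually_mono intro: less_imp_le)
    next
      case False
      then show ?thesis using order_tendstoD(2)[OF assms(3), of r] elim by (auto elim!: eventually_mono)
    qed
    ultimately have "\<forall>\<^sub>F n in sequentially. indicator {a0<..b0} r * g r = indicator {a n<..b n} r * g r"
      by eventually_elim (auto simp: indicator_def)
    then show ?case by (rule Lim_transform_eventually[OF tendsto_const])
  qed
qed (use g in \<open>auto simp: indicator_def\<close>)

lemma ival_continuous:
  assumes "integrable (ivl T) g"
  shows "continuous_on S (\<lambda>t. ival T g a t)"
  unfolding continuous_on_sequentially using ival_tendsto[OF assms] by (auto simp: o_def)

lemma ac_continuous:
  assumes g: "integrable (ivl T) g"
    and f: "\<And>a b. \<lbrakk>s \<le> a; a \<le> b; b \<le> t\<rbrakk> \<Longrightarrow> f b - f a = ival T g a b"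
  shows "continuous_on {s..t} f"
proof -
  have "continuous_on {s..t} (\<lambda>r. f s + ival T g s r)"
    by (intro continuous_intros ival_continuous g)
  then show ?thesis
    by (rule continuous_on_eq) (use f[of s] in fastforce)
qed

lemma continuous_on_bounded_interval:
  fixes h :: "real \<Rightarrow> real"
  assumes "continuous_on {s..t} h"
  obtains C where "\<And>r. r \<in> {s..t} \<Longrightarrow> \<bar>h r\<bar> \<le> C"
proof -
  have "bounded (h ` {s..t})"
    by (intro compact_imp_bounded compact_continuous_image assms compact_Icc)
  then obtain C where "\<forall>x\<in>{s..t}. \<bar>h x\<bar> \<le> C" by (auto simp: bounded_iff)
  then show thesis by (intro that) auto
qed

lemma integrable_mult_continuous:
  assumes g: "integrable (ivl T) g" and h: "continuous_on {s..t} (h :: real \<Rightarrow> real)"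
  shows "integrable (ivl T) (\<lambda>r. indicator {s<..t} r * (h r * g r))"
proof -
  obtain C where C: "\<And>r. r \<in> {s..t} \<Longrightarrow> \<bar>h r\<bar> \<le> C"
    using continuous_on_bounded_interval[OF h] by metis
  have [measurable]: "(\<lambda>r. indicator {s..t} r * h r) \<in> borel_measurable borel"
    using borel_measurable_continuous_on_indicator[OF _ h] by simp
  have [measurable]: "g \<in> borel_measurable borel" using g by auto
  have eq: "indicator {s<..t} r * (h r * g r) = indicator {s<..t} r * ((indicator {s..t} r * h r) * g r)" for r
    by (auto simp: indicator_def)
  show ?thesis
  proof (rule Bochner_Integration.integrable_bound)
    show "integrable (ivl T) (\<lambda>r. C * \<bar>g r\<bar>)" using g by auto
    show "(\<lambda>r. indicator {s<..t} r * (h r * g r)) \<in> borel_measurable (ivl T)"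
      unfolding eq by measurable
    show "AE r in ivl T. norm (indicator {s<..t} r * (h r * g r)) \<le> norm (C * \<bar>g r\<bar>)"
    proof (intro AE_I2)
      fix r show "norm (indicator {s<..t} r * (h r * g r)) \<le> norm (C * \<bar>g r\<bar>)"
        using C[of r] mult_right_mono[of "\<bar>h r\<bar>" "\<bar>C\<bar>" "\<bar>g r\<bar>"] by (auto simp: indicator_def abs_mult)
    qed
  qed
qed

lemma ac_chain:
  assumes g: "integrable (ivl T) g" and "s \<le> t"
    and f: "\<And>a b. \<lbrakk>s \<le> a; a \<le> b; b \<le> t\<rbrakk> \<Longrightarrow> f b - f a = ival T g a b"
    and range: "\<And>r. \<lbrakk>s \<le> r; r \<le> t\<rbrakk> \<Longrightarrow> f r \<in> {lo..hi}"
    and \<Phi>: "\<And>y. y \<in> {lo..hi} \<Longrightarrow> (\<Phi> has_real_derivative \<Phi>' y) (at y)"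
    and cont: "continuous_on {lo..hi} \<Phi>'"
  shows "\<Phi> (f t) - \<Phi> (f s) = ival T (\<lambda>r. \<Phi>' (f r) * g r) s t"
proof -
  define h where "h r = \<Phi>' (f r)" for r
  have fc: "continuous_on {s..t} f" by (rule ac_continuous[OF g f])
  have hc: "continuous_on {s..t} h"
    unfolding h_def using range by (intro continuous_on_compose2[OF cont fc]) auto
  define k where "k r = indicator {s<..t} r * (h r * g r)" for r
  have k: "integrable (ivl T) k"
    unfolding k_def[abs_def] by (rule integrable_mult_continuous[OF g hc])
  define m where "m a b = ival T (\<lambda>r. \<bar>g r\<bar>) a b" for a b
  define D where "D a b = \<Phi> (f b) - \<Phi> (f a) - ival T k a b" for a b
  have D_le: "\<bar>D s t\<bar> \<le> \<epsilon> * m s t" if "0 < \<epsilon>" for \<epsilon>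
  proof -
    have "s \<le> s \<and> t \<le> t \<longrightarrow> \<bar>D s t\<bar> \<le> \<epsilon> * m s t"
      using \<open>s \<le> t\<close>
    proof (induction rule: Bolzano[where P = "\<lambda>a b. s \<le> a \<and> b \<le> t \<longrightarrow> \<bar>D a b\<bar> \<le> \<epsilon> * m a b"])
      case (trans a b c)
      have "D a c = D a b + D b c" "m a c = m a b + m b c"
        unfolding D_def m_def using ival_combine[OF k, of a b c] ival_combine[of T "\<lambda>r. \<bar>g r\<bar>" a b c] g trans by auto
      then show ?case using trans by (auto simp: algebra_simps)
    next
      case (local x)
      obtain d where d: "d > 0" "\<And>r. r \<in> {s..t} \<Longrightarrow> \<bar>r - x\<bar> < d \<Longrightarrow> \<bar>h r - h x\<bar> < \<epsilon> / 2"
        using hc[unfolded continuous_on_iff, rule_format, of x "\<epsilon>/2"] local \<open>0 < \<epsilon>\<close> by (auto simp: dist_real_def)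
      show ?case
      proof (intro exI[of _ d] conjI allI impI)
        fix a b assume ab: "a \<le> x \<and> x \<le> b \<and> b - a < d" "s \<le> a \<and> b \<le> t"
        have "\<exists>z\<in>{a..b}. \<Phi> (f b) - \<Phi> (f a) = h z * (f b - f a)"
        proof -
          have fab: "f a \<in> {lo..hi}" "f b \<in> {lo..hi}" using range[of a] range[of b] ab by auto
          have fc': "continuous_on {a..b} f" using ab by (intro continuous_on_subset[OF fc]) auto
          consider "f a = f b" | "f a < f b" | "f b < f a" by linarith
          then show ?thesis
          proof cases
            case 1
            then show ?thesis using ab by (intro bexI[of _ a]) auto
          next
            case 2
            obtain y where "f a < y" "y < f b" "\<Phi> (f b) - \<Phi> (f a) = (f b - f a) * \<Phi>' y"
              using MVT2[OF 2, of \<Phi> \<Phi>'] \<Phi> fab by force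
            moreover obtain z where "a \<le> z" "z \<le> b" "f z = y"
              using IVT'[of f a y b] fc' ab calculation by auto
            ultimately show ?thesis by (intro bexI[of _ z]) (auto simp: h_def)
          next
            case 3
            obtain y where "f b < y" "y < f a" "\<Phi> (f a) - \<Phi> (f b) = (f a - f b) * \<Phi>' y"
              using MVT2[OF 3, of \<Phi> \<Phi>'] \<Phi> fab by force
            moreover obtain z where "a \<le> z" "z \<le> b" "f z = y"
              using IVT2'[of f b y a] fc' ab calculation by auto
            ultimately show ?thesis by (intro bexI[of _ z]) (auto simp: h_def algebra_simps)
          qed
        qed
        then obtain z where z: "z \<in> {a..b}" "\<Phi> (f b) - \<Phi> (f a) = h z * (f b - f a)" by auto
        have "D a b = h z * ival T g a b - ival T k a b"
          using z f[of a b] ab by (simp add: D_def)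
        also have "\<dots> = ival T (\<lambda>r. h z * g r - k r) a b"
          using g k by (subst ival_diff) (auto simp: ival_mult)
        finally have "\<bar>D a b\<bar> \<le> ival T (\<lambda>r. \<bar>h z * g r - k r\<bar>) a b"
          using ival_abs_le[of T "\<lambda>r. h z * g r - k r" a b] g k by auto
        also have "\<dots> \<le> ival T (\<lambda>r. \<epsilon> * \<bar>g r\<bar>) a b"
        proof (intro ival_mono_AE AE_I2 impI)
          fix r assume r: "a < r \<and> r \<le> b"
          have "\<bar>h z - h r\<bar> \<le> \<epsilon>"
          proof -
            have "\<bar>z - x\<bar> < d" "\<bar>r - x\<bar> < d" using r z ab by auto
            then have "\<bar>h z - h x\<bar> < \<epsilon> / 2" "\<bar>h r - h x\<bar> < \<epsilon> / 2"
              using d(2)[of z] d(2)[of r] r z ab by auto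
            then show ?thesis by linarith
          qed
          then have "\<bar>h z - h r\<bar> * \<bar>g r\<bar> \<le> \<epsilon> * \<bar>g r\<bar>" by (intro mult_right_mono) auto
          then show "\<bar>h z * g r - k r\<bar> \<le> \<epsilon> * \<bar>g r\<bar>"
            using r ab by (auto simp: k_def abs_mult[symmetric] algebra_simps)
        qed (use g k in auto)
        also have "\<dots> = \<epsilon> * m a b" by (simp add: m_def ival_mult)
        finally show "\<bar>D a b\<bar> \<le> \<epsilon> * m a b" .
      qed (use d in auto)
    qed
    then show ?thesis by simp
  qed
  have m0: "0 \<le> m s t" unfolding m_def by (rule ival_nonneg) auto
  have "\<bar>D s t\<bar> \<le> 0"
  proof (rule field_le_epsilon)
    fix e :: real assume "0 < e"
    then have "\<bar>D s t\<bar> \<le> e / (m s t + 1) * m s t"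
      using m0 by (intro D_le) simp
    also have "\<dots> \<le> e" using \<open>0 < e\<close> m0 by (simp add: field_simps)
    finally show "\<bar>D s t\<bar> \<le> 0 + e" by simp
  qed
  moreover have "ival T k s t = ival T (\<lambda>r. h r * g r) s t"
    unfolding ival_def k_def by (intro Bochner_Integration.integral_cong) (auto simp: indicator_def)
  ultimately show ?thesis by (simp add: D_def h_def)
qed

lemma ac_square:
  assumes g: "integrable (ivl T) g" and "s \<le> t"
    and f: "\<And>a b. \<lbrakk>s \<le> a; a \<le> b; b \<le> t\<rbrakk> \<Longrightarrow> f b - f a = ival T g a b"
  shows "(f t)\<^sup>2 - (f s)\<^sup>2 = ival T (\<lambda>r. 2 * f r * g r) s t"
proof -
  have "continuous_on {s..t} f" by (rule ac_continuous[OF g f])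
  then obtain C where "\<And>r. r \<in> {s..t} \<Longrightarrow> \<bar>f r\<bar> \<le> C"
    using continuous_on_bounded_interval by blast
  then have "f r \<in> {-C..C}" if "s \<le> r" "r \<le> t" for r
    using that by (auto simp: abs_le_iff minus_le_iff)
  then show ?thesis
    by (intro ac_chain[OF g \<open>s \<le> t\<close> f, where lo = "- C" and hi = C])
      (auto intro!: derivative_eq_intros continuous_intros)
qed

lemma ac_product:
  assumes g: "integrable (ivl T) g1" "integrable (ivl T) g2" and "s \<le> t"
    and f1: "\<And>a b. \<lbrakk>s \<le> a; a \<le> b; b \<le> t\<rbrakk> \<Longrightarrow> f1 b - f1 a = ival T g1 a b"
    and f2: "\<And>a b. \<lbrakk>s \<le> a; a \<le> b; b \<le> t\<rbrakk> \<Longrightarrow> f2 b - f2 a = ival T g2 a b"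
  shows "f1 t * f2 t - f1 s * f2 s = ival T (\<lambda>r. f2 r * g1 r + f1 r * g2 r) s t"
proof -
  let ?p = "\<lambda>r. 2 * (f1 r + f2 r) * (g1 r + g2 r)" and ?m = "\<lambda>r. 2 * (f1 r - f2 r) * (g1 r - g2 r)"
  have "(f1 t + f2 t)\<^sup>2 - (f1 s + f2 s)\<^sup>2 = ival T ?p s t"
    
  proof (rule ac_square)
    show "f1 b + f2 b - (f1 a + f2 a) = ival T (\<lambda>r. g1 r + g2 r) a b" if "s \<le> a" "a \<le> b" "b \<le> t" for a b
      using f1[OF that] f2[OF that] g by (simp add: ival_add)
  qed (use assms in auto)
  moreover have "(f1 t - f2 t)\<^sup>2 - (f1 s - f2 s)\<^sup>2 = ival T ?m s t"
    
  proof (rule ac_square)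
    show "f1 b - f2 b - (f1 a - f2 a) = ival T (\<lambda>r. g1 r - g2 r) a b" if "s \<le> a" "a \<le> b" "b \<le> t" for a b
      using f1[OF that] f2[OF that] g by (simp add: ival_diff)
  qed (use assms in auto)
  ultimately have "4 * (f1 t * f2 t - f1 s * f2 s) = ival T ?p s t - ival T ?m s t"
    by (simp add: power2_eq_square algebra_simps)
  also have "\<dots> = (\<integral>r. indicator {s<..t} r * ?p r - indicator {s<..t} r * ?m r \<partial>ivl T)"
  proof -
    have c: "continuous_on {s..t} f1" "continuous_on {s..t} f2"
      by (rule ac_continuous[OF g(1) f1] ac_continuous[OF g(2) f2]; assumption)+
    have "integrable (ivl T) (\<lambda>r. indicator {s<..t} r * ?p r)"
      using g c by (intro integrable_mult_continuous continuous_intros) auto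
    moreover have "integrable (ivl T) (\<lambda>r. indicator {s<..t} r * ?m r)"
      using g c by (intro integrable_mult_continuous continuous_intros) auto
    ultimately show ?thesis by (simp add: ival_def)
  qed
  also have "\<dots> = (\<integral>r. 4 * (indicator {s<..t} r * (f2 r * g1 r + f1 r * g2 r)) \<partial>ivl T)"
    by (intro Bochner_Integration.integral_cong) (auto simp: algebra_simps)
  finally show ?thesis by (simp add: ival_def)
qed

lemma integral_by_parts:
  fixes d q :: "real \<Rightarrow> real"
  assumes d: "integrable (ivl 1) d" and q: "integrable (ivl 1) q" and q0: "(\<integral>x. q x \<partial>ivl 1) = 0"
  shows "(\<integral>x. ival 1 d 0 x * q x \<partial>ivl 1) = - (\<integral>x. d x * ival 1 q 0 x \<partial>ivl 1)"
proof -
  have [measurable]: "d \<in> borel_measurable borel" "q \<in> borel_measurable borel" using d q by auto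
  have [measurable]: "ival 1 d 0 \<in> borel_measurable borel" "ival 1 q 0 \<in> borel_measurable borel"
    using ival_continuous[OF d, of UNIV 0] ival_continuous[OF q, of UNIV 0]
    by (auto intro: borel_measurable_continuous_onI)
  have *: "integrable (ivl 1) (\<lambda>x. ival 1 f 0 x * g x)" if "integrable (ivl 1) f" "integrable (ivl 1) g" for f g
  proof -
    have "integrable (ivl 1) (\<lambda>r. indicator {0<..1} r * (ival 1 f 0 r * g r))"
      by (rule integrable_mult_continuous[OF that(2) ival_continuous[OF that(1)]])
    moreover have [measurable]: "ival 1 f 0 \<in> borel_measurable borel" "g \<in> borel_measurable borel"
      using ival_continuous[OF that(1), of UNIV 0] that(2) by (auto intro: borel_measurable_continuous_onI)
    ultimately show ?thesis
      by (subst integrable_cong_AE[where g = "\<lambda>r. indicator {0<..1} r * (ival 1 f 0 r * g r)"])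
        (auto intro!: eventually_mono[OF AE_ivl_mem])
  qed
  have "ival 1 d 0 b - ival 1 d 0 a = ival 1 d a b" "ival 1 q 0 b - ival 1 q 0 a = ival 1 q a b"
    if "0 \<le> a" "a \<le> b" for a b
    using ival_combine[OF d that] ival_combine[OF q that] by auto
  from ac_product[OF d q, of 0 1 "ival 1 d 0" "ival 1 q 0", OF _ this]
  have "ival 1 (\<lambda>r. ival 1 q 0 r * d r + ival 1 d 0 r * q r) 0 1 = 0"
    using q0 by (simp add: ival_all)
  then show ?thesis
    using *[OF d q] *[OF q d] by (simp add: ival_all mult.commute)
qed

section \<open>Square integrable functions and Steklov averages\<close>

definition sq_int :: "'a measure \<Rightarrow> ('a \<Rightarrow> real) \<Rightarrow> bool" where
  "sq_int M f \<longleftrightarrow> f \<in> borel_measurable M \<and> integrable M (\<lambda>x. (f x)\<^sup>2)"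

lemma sq_int_measurable [measurable_dest]: "sq_int M f \<Longrightarrow> f \<in> borel_measurable M"
  by (simp add: sq_int_def)

lemma young: "\<bar>a * b\<bar> \<le> a\<^sup>2 / (2 * \<eta>) + \<eta> * b\<^sup>2 / 2" if "0 < \<eta>" for a b \<eta> :: real
proof -
  have "0 \<le> (\<bar>a\<bar> - \<eta> * \<bar>b\<bar>)\<^sup>2" by simp
  then have "2 * \<eta> * (\<bar>a\<bar> * \<bar>b\<bar>) \<le> a\<^sup>2 + \<eta>\<^sup>2 * b\<^sup>2"
    by (simp add: power2_eq_square algebra_simps)
  then show ?thesis
    using that by (simp add: abs_mult field_simps power2_eq_square)
qed

lemma young1: "\<bar>a * b\<bar> \<le> a\<^sup>2 / 2 + b\<^sup>2 / 2" for a b :: real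
  using young[of 1 a b] by simp

lemma sq_int_mult:
  assumes "sq_int M f" "sq_int M g"
  shows "integrable M (\<lambda>x. f x * g x)"
proof (rule Bochner_Integration.integrable_bound)
  show "integrable M (\<lambda>x. (f x)\<^sup>2 / 2 + (g x)\<^sup>2 / 2)"
    using assms by (auto simp: sq_int_def)
  show "(\<lambda>x. f x * g x) \<in> borel_measurable M" using assms by (auto simp: sq_int_def)
  show "AE x in M. norm (f x * g x) \<le> norm ((f x)\<^sup>2 / 2 + (g x)\<^sup>2 / 2)"
    using young1 by (auto intro!: AE_I2 simp: abs_of_nonneg)
qed

lemma sq_int_cmult: "sq_int M f \<Longrightarrow> sq_int M (\<lambda>x. c * f x)"
  by (auto simp: sq_int_def power_mult_distrib)

lemma sq_int_bounded_mult:
  assumes f: "sq_int M f" and [measurable]: "g \<in> borel_measurable M" and g: "AE x in M. \<bar>g x\<bar> \<le> C"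
  shows "sq_int M (\<lambda>x. g x * f x)"
  unfolding sq_int_def
proof
  have [measurable]: "f \<in> borel_measurable M" using f by measurable
  show "(\<lambda>x. g x * f x) \<in> borel_measurable M" by measurable
  show "integrable M (\<lambda>x. (g x * f x)\<^sup>2)"
  proof (rule Bochner_Integration.integrable_bound)
    show "integrable M (\<lambda>x. C\<^sup>2 * (f x)\<^sup>2)" using f by (auto simp: sq_int_def)
    show "AE x in M. norm ((g x * f x)\<^sup>2) \<le> norm (C\<^sup>2 * (f x)\<^sup>2)"
      using g
    proof eventually_elim
      case (elim x)
      then have "(g x)\<^sup>2 \<le> C\<^sup>2" by (metis abs_le_square_iff abs_of_nonneg abs_ge_zero order_trans)
      then show ?case by (auto simp: power_mult_distrib intro!: mult_right_mono)
    qed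
  qed measurable
qed

lemma sq_int_add:
  assumes "sq_int M f" "sq_int M g"
  shows "sq_int M (\<lambda>x. f x + g x)"
proof -
  have "(f x + g x)\<^sup>2 = (f x)\<^sup>2 + (g x)\<^sup>2 + 2 * (f x * g x)" for x
    by (simp add: power2_eq_square algebra_simps)
  then show ?thesis
    using assms sq_int_mult[OF assms] by (auto simp: sq_int_def)
qed

lemma sq_int_diff:
  assumes "sq_int M f" "sq_int M g"
  shows "sq_int M (\<lambda>x. f x - g x)"
  using sq_int_add[OF assms(1) sq_int_cmult[OF assms(2), of "-1"]] by simp

lemma (in finite_measure) sq_int_const: "sq_int M (\<lambda>x. c)"
  by (simp add: sq_int_def)

lemma (in finite_measure) sq_int_bounded:
  assumes [measurable]: "g \<in> borel_measurable M" and g: "AE x in M. \<bar>g x\<bar> \<le> C"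
  shows "sq_int M g"
  using sq_int_bounded_mult[OF sq_int_const[of 1] assms] by simp

lemma (in finite_measure) sq_int_integrable:
  assumes "sq_int M f"
  shows "integrable M f"
  using sq_int_mult[OF assms sq_int_const[of 1]] by simp

lemma (in finite_measure) square_integral_le:
  assumes "sq_int M f"
  shows "(\<integral>x. f x \<partial>M)\<^sup>2 \<le> measure M (space M) * (\<integral>x. (f x)\<^sup>2 \<partial>M)"
proof (cases "measure M (space M) = 0")
  case True
  then have "AE x in M. False"
    by (intro AE_I[of _ _ "space M"]) (auto simp: measure_eq_0_null_sets emeasure_eq_measure)
  then have "(\<integral>x. f x \<partial>M) = 0"
    by (intro integral_eq_zero_AE) auto
  then show ?thesis using True by simp
next
  case False
  define m where "m = measure M (space M)"
  define I where "I = (\<integral>x. f x \<partial>M)"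
  have m: "m > 0" using False by (simp add: m_def less_le)
  have "0 \<le> (\<integral>x. (f x - I / m)\<^sup>2 \<partial>M)" by (intro integral_nonneg_AE) auto
  also have "\<dots> = (\<integral>x. (f x)\<^sup>2 + (I / m)\<^sup>2 - 2 * (I / m) * f x \<partial>M)"
    by (intro Bochner_Integration.integral_cong) (auto simp: power2_eq_square algebra_simps)
  also have "\<dots> = (\<integral>x. (f x)\<^sup>2 \<partial>M) + (I / m)\<^sup>2 * m - 2 * (I / m) * I"
    using assms sq_int_integrable[OF assms] by (simp add: sq_int_def I_def m_def)
  also have "\<dots> = (\<integral>x. (f x)\<^sup>2 \<partial>M) - I\<^sup>2 / m"
    using m by (simp add: field_simps power2_eq_square)
  finally show ?thesis
    using m unfolding I_def[symmetric] m_def[symmetric] by (simp add: field_simps)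
qed

lemma sq_int_ind:
  assumes "sq_int M f" "A \<in> sets M"
  shows "sq_int M (\<lambda>x. indicator A x * f x)"
  using assms by (intro sq_int_bounded_mult[where C = 1]) auto

lemma integrable_pair_snd:
  fixes g :: "real \<Rightarrow> real"
  assumes "integrable (ivl T) g"
  shows "integrable (ivl S \<Otimes>\<^sub>M ivl T) (\<lambda>(x, y). g y)"
proof (rule ivl2.Fubini_integrable)
  have [measurable]: "g \<in> borel_measurable borel" using assms by auto
  show "(\<lambda>(x, y). g y) \<in> borel_measurable (ivl S \<Otimes>\<^sub>M ivl T)" by measurable
qed (use assms in auto)

lemma integrable_pair_fst:
  fixes g :: "real \<Rightarrow> real"
  assumes "integrable (ivl S) g"
  shows "integrable (ivl S \<Otimes>\<^sub>M ivl T) (\<lambda>(x, y). g x)"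
proof (rule ivl2.Fubini_integrable)
  have [measurable]: "g \<in> borel_measurable borel" using assms by auto
  show "(\<lambda>(x, y). g x) \<in> borel_measurable (ivl S \<Otimes>\<^sub>M ivl T)" by measurable
qed (use assms in auto)

lemma continuous_dense_L2:
  assumes f: "sq_int (ivl T) f" and "0 < \<epsilon>"
  obtains c C where "continuous_on UNIV c" "\<And>x. \<bar>c x\<bar> \<le> C" "(\<integral>x. (f x - c x)\<^sup>2 \<partial>ivl T) < \<epsilon>"
proof -
  have [measurable]: "f \<in> borel_measurable borel" using f by (auto simp: sq_int_def)
  define fN where "fN N x = max (- real N) (min (real N) (f x))" for N x
  have [measurable]: "fN N \<in> borel_measurable borel" for N unfolding fN_def[abs_def] by measurable
  have fN_le: "\<bar>fN N x\<bar> \<le> real N" for N x by (auto simp: fN_def)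
  have "(\<lambda>N. \<integral>x. (f x - fN N x)\<^sup>2 \<partial>ivl T) \<longlonglongrightarrow> (\<integral>x. 0 \<partial>ivl T)"
  proof (rule integral_dominated_convergence)
    show "integrable (ivl T) (\<lambda>x. (f x)\<^sup>2)" using f by (auto simp: sq_int_def)
    show "AE x in ivl T. (\<lambda>N. (f x - fN N x)\<^sup>2) \<longlonglongrightarrow> 0"
    proof (intro AE_I2)
      fix x
      obtain N0 :: nat where "\<bar>f x\<bar> \<le> real N0" using real_arch_simple by blast
      then have "\<forall>\<^sub>F N in sequentially. 0 = (f x - fN N x)\<^sup>2"
        by (intro eventually_sequentiallyI[of N0]) (auto simp: fN_def)
      then show "(\<lambda>N. (f x - fN N x)\<^sup>2) \<longlonglongrightarrow> 0" by (rule Lim_transform_eventually[OF tendsto_const])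
    qed
    show "AE x in ivl T. norm ((f x - fN N x)\<^sup>2) \<le> (f x)\<^sup>2" for N
    proof (intro AE_I2)
      fix x
      have "\<bar>f x - fN N x\<bar> \<le> \<bar>f x\<bar>" by (auto simp: fN_def max_def min_def)
      then show "norm ((f x - fN N x)\<^sup>2) \<le> (f x)\<^sup>2" by (simp add: abs_le_square_iff)
    qed
  qed auto
  then have "\<forall>\<^sub>F N in sequentially. (\<integral>x. (f x - fN N x)\<^sup>2 \<partial>ivl T) < \<epsilon> / 4"
    using order_tendstoD(2)[of _ 0 sequentially "\<epsilon> / 4"] \<open>0 < \<epsilon>\<close> by simp
  then obtain N where N: "(\<integral>x. (f x - fN N x)\<^sup>2 \<partial>ivl T) < \<epsilon> / 4"
    by (auto simp: eventually_sequentially)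
  have "fN N measurable_on UNIV"
    by (rule lebesgue_measurable_imp_measurable_on_real) (auto intro: measurable_completion)
  then obtain Z g where Z: "negligible Z" and g: "\<And>n. continuous_on UNIV (g n)"
    and lim: "\<And>x. x \<notin> Z \<Longrightarrow> (\<lambda>n. g n x) \<longlonglongrightarrow> fN N x"
    by (auto simp: measurable_on_def)
  define c where "c n x = max (- real N) (min (real N) (g n x))" for n x
  have c_cont: "continuous_on UNIV (c n)" for n
    unfolding c_def[abs_def] by (intro continuous_intros g)
  then have [measurable]: "c n \<in> borel_measurable borel" for n
    by (rule borel_measurable_continuous_onI)
  have c_le: "\<bar>c n x\<bar> \<le> real N" for n x by (auto simp: c_def)
  have "(\<lambda>n. \<integral>x. (fN N x - c n x)\<^sup>2 \<partial>ivl T) \<longlonglongrightarrow> (\<integral>x. 0 \<partial>ivl T)"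
  proof (rule integral_dominated_convergence)
    show "integrable (ivl T) (\<lambda>x. (2 * real N)\<^sup>2)" by simp
    have "AE x in lborel. x \<notin> Z"
      using Z by (subst AE_completion_iff[symmetric]) (simp add: negligible_iff_null_sets AE_not_in)
    then have "AE x in ivl T. x \<notin> Z" by (auto simp: AE_ivl)
    then show "AE x in ivl T. (\<lambda>n. (fN N x - c n x)\<^sup>2) \<longlonglongrightarrow> 0"
    proof eventually_elim
      case (elim x)
      have "(\<lambda>n. c n x) \<longlonglongrightarrow> max (- real N) (min (real N) (fN N x))"
        unfolding c_def by (intro tendsto_intros lim elim)
      also have "max (- real N) (min (real N) (fN N x)) = fN N x" using fN_le[of N x] by auto
      finally have "(\<lambda>n. (fN N x - c n x)\<^sup>2) \<longlonglongrightarrow> (fN N x - fN N x)\<^sup>2" by (intro tendsto_intros)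
      then show ?case by simp
    qed
    show "AE x in ivl T. norm ((fN N x - c n x)\<^sup>2) \<le> (2 * real N)\<^sup>2" for n
    proof (intro AE_I2)
      fix x
      have "\<bar>fN N x - c n x\<bar> \<le> \<bar>2 * real N\<bar>" using fN_le[of N x] c_le[of n x] by linarith
      then show "norm ((fN N x - c n x)\<^sup>2) \<le> (2 * real N)\<^sup>2" by (simp only: abs_le_square_iff real_norm_def abs_power2)
    qed
  qed auto
  then have "\<forall>\<^sub>F n in sequentially. (\<integral>x. (fN N x - c n x)\<^sup>2 \<partial>ivl T) < \<epsilon> / 4"
    using order_tendstoD(2)[of _ 0 sequentially "\<epsilon> / 4"] \<open>0 < \<epsilon>\<close> by simp
  then obtain n where n: "(\<integral>x. (fN N x - c n x)\<^sup>2 \<partial>ivl T) < \<epsilon> / 4"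
    by (auto simp: eventually_sequentially)
  have s1: "sq_int (ivl T) (fN N)" "sq_int (ivl T) (c n)"
    using fN_le c_le by (auto intro!: ivl.sq_int_bounded[where C = "real N"])
  then have s: "sq_int (ivl T) (\<lambda>x. f x - fN N x)" "sq_int (ivl T) (\<lambda>x. fN N x - c n x)" "sq_int (ivl T) (\<lambda>x. f x - c n x)"
    by (auto intro: sq_int_diff f)
  have "(\<integral>x. (f x - c n x)\<^sup>2 \<partial>ivl T) \<le> (\<integral>x. 2 * (f x - fN N x)\<^sup>2 + 2 * (fN N x - c n x)\<^sup>2 \<partial>ivl T)"
  proof (rule integral_mono)
    fix x
    have "0 \<le> ((f x - fN N x) - (fN N x - c n x))\<^sup>2" by simp
    then show "(f x - c n x)\<^sup>2 \<le> 2 * (f x - fN N x)\<^sup>2 + 2 * (fN N x - c n x)\<^sup>2"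
      by (simp add: power2_eq_square algebra_simps)
  qed (use s in \<open>auto simp: sq_int_def\<close>)
  also have "\<dots> = 2 * (\<integral>x. (f x - fN N x)\<^sup>2 \<partial>ivl T) + 2 * (\<integral>x. (fN N x - c n x)\<^sup>2 \<partial>ivl T)"
    using s by (simp add: sq_int_def)
  also have "\<dots> < \<epsilon>" using N n by simp
  finally show thesis using that[of "c n" "real N"] c_cont c_le by auto
qed

definition steklov :: "real \<Rightarrow> (real \<Rightarrow> real) \<Rightarrow> (real \<Rightarrow> real) \<Rightarrow> real \<Rightarrow> real \<Rightarrow> real \<Rightarrow> real" where
  "steklov T f g s t h = ival T (\<lambda>r. ival T f (r - h) r * g r) s t / h"

lemma ival_window_measurable [measurable]:
  assumes [measurable]: "f \<in> borel_measurable borel"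
  shows "(\<lambda>r. ival T f (r - h) r) \<in> borel_measurable borel"
proof -
  have "(\<lambda>r. \<integral>z. indicator {r - h<..r} z * f z \<partial>ivl T) = (\<lambda>r. \<integral>z. (if r - h < z \<and> z \<le> r then f z else 0) \<partial>ivl T)"
    by (intro ext Bochner_Integration.integral_cong) auto
  then show ?thesis
    unfolding ival_def by simp
qed

lemma integral_window_le:
  assumes f: "integrable (ivl T) f" "\<And>z. 0 \<le> f z" and "0 < h"
  shows "integrable (ivl T) (\<lambda>r. ival T f (r - h) r)"
    and "(\<integral>r. ival T f (r - h) r \<partial>ivl T) \<le> h * (\<integral>z. f z \<partial>ivl T)"
proof -
  have [measurable]: "f \<in> borel_measurable borel" using f by auto
  define k where "k r z = (if r - h < z \<and> z \<le> r then f z else 0)" for r z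
  have k: "integrable (ivl T \<Otimes>\<^sub>M ivl T) (case_prod k)"
  proof (rule Bochner_Integration.integrable_bound[OF integrable_pair_snd[OF f(1)]])
    show "case_prod k \<in> borel_measurable (ivl T \<Otimes>\<^sub>M ivl T)" unfolding k_def by measurable
  qed (auto simp: k_def f(2))
  have eq: "ival T f (r - h) r = (\<integral>z. k r z \<partial>ivl T)" for r
    unfolding ival_def k_def by (intro Bochner_Integration.integral_cong) (auto simp: indicator_def)
  show "integrable (ivl T) (\<lambda>r. ival T f (r - h) r)"
    unfolding eq by (rule ivl2.integrable_fst[OF k])
  have "(\<integral>r. ival T f (r - h) r \<partial>ivl T) = (\<integral>z. \<integral>r. k r z \<partial>ivl T \<partial>ivl T)"
    unfolding eq by (rule ivl2.Fubini_integral[OF k, symmetric])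
  also have "\<dots> \<le> (\<integral>z. h * f z \<partial>ivl T)"
  proof (rule integral_mono)
    show "integrable (ivl T) (\<lambda>z. \<integral>r. k r z \<partial>ivl T)" by (rule ivl2.integrable_snd[OF k])
    fix z
    have "(\<integral>r. k r z \<partial>ivl T) = (\<integral>r. f z * indicator {z..<z+h} r \<partial>ivl T)"
      by (intro Bochner_Integration.integral_cong) (auto simp: k_def indicator_def)
    also have "\<dots> = f z * measure (ivl T) {z..<z+h}" by simp
    also have "measure (ivl T) {z..<z+h} \<le> h"
    proof -
      have "emeasure (ivl T) {z..<z+h} \<le> emeasure lborel {z..<z+h}"
        by (subst emeasure_ivl) (auto intro!: emeasure_mono)
      then show ?thesis using \<open>0 < h\<close> by (simp add: measure_def enn2real_leI)
    qed
    then have "f z * measure (ivl T) {z..<z+h} \<le> h * f z"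
      by (metis f(2) mult.commute mult_left_mono)
    finally show "(\<integral>r. k r z \<partial>ivl T) \<le> h * f z" .
  qed (use f in auto)
  finally show "(\<integral>r. ival T f (r - h) r \<partial>ivl T) \<le> h * (\<integral>z. f z \<partial>ivl T)" by simp
qed

lemma steklov_pointwise:
  assumes f: "sq_int (ivl T) f" and "0 < h" "0 < \<eta>"
  shows "\<bar>ival T f (r - h) r * y\<bar> \<le> ival T (\<lambda>z. (f z)\<^sup>2 / (2 * \<eta>)) (r - h) r + h * (\<eta> * y\<^sup>2 / 2)"
proof -
  have f1: "integrable (ivl T) f" by (rule ivl.sq_int_integrable[OF f])
  have f2: "integrable (ivl T) (\<lambda>z. (f z)\<^sup>2 / (2 * \<eta>))" using f by (auto simp: sq_int_def)
  have "\<bar>ival T f (r - h) r * y\<bar> = \<bar>ival T (\<lambda>z. y * f z) (r - h) r\<bar>"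
    by (simp add: ival_mult abs_mult mult.commute)
  also have "\<dots> \<le> ival T (\<lambda>z. \<bar>y * f z\<bar>) (r - h) r"
    using f1 by (intro ival_abs_le) auto
  also have "\<dots> \<le> ival T (\<lambda>z. (f z)\<^sup>2 / (2 * \<eta>) + \<eta> * y\<^sup>2 / 2) (r - h) r"
    using f1 f2 young[OF \<open>0 < \<eta>\<close>, of "f _" y]
    by (intro ival_mono_AE) (auto intro!: AE_I2 simp: mult.commute[of y])
  also have "\<dots> = ival T (\<lambda>z. (f z)\<^sup>2 / (2 * \<eta>)) (r - h) r + ival T (\<lambda>z. \<eta> * y\<^sup>2 / 2) (r - h) r"
    using f2 by (subst ival_add) auto
  also have "ival T (\<lambda>z. \<eta> * y\<^sup>2 / 2) (r - h) r \<le> h * (\<eta> * y\<^sup>2 / 2)"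
    using ival_const_le[of "r - h" r "\<eta> * y\<^sup>2 / 2" T] \<open>0 < h\<close> \<open>0 < \<eta>\<close> by (simp add: mult.commute)
  finally show ?thesis by simp
qed

lemma steklov_integrable:
  assumes f: "sq_int (ivl T) f" and g: "sq_int (ivl T) g" and "0 < h"
  shows "integrable (ivl T) (\<lambda>r. ival T f (r - h) r * g r)"
proof (rule Bochner_Integration.integrable_bound)
  have [measurable]: "f \<in> borel_measurable borel" "g \<in> borel_measurable borel" using f g by (auto simp: sq_int_def)
  show "integrable (ivl T) (\<lambda>r. ival T (\<lambda>z. (f z)\<^sup>2 / (2 * 1)) (r - h) r + h * (1 * (g r)\<^sup>2 / 2))"
    using f g \<open>0 < h\<close> by (intro Bochner_Integration.integrable_add integral_window_le) (auto simp: sq_int_def)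
  show "AE r in ivl T. norm (ival T f (r - h) r * g r)
      \<le> norm (ival T (\<lambda>z. (f z)\<^sup>2 / (2 * 1)) (r - h) r + h * (1 * (g r)\<^sup>2 / 2))"
    using steklov_pointwise[OF f \<open>0 < h\<close>, of 1] by (intro AE_I2) (smt (verit) real_norm_def)
qed (use f g in \<open>auto simp: sq_int_def\<close>)

lemma steklov_bound:
  assumes f: "sq_int (ivl T) f" and g: "sq_int (ivl T) g" and "0 < h" "0 < \<eta>"
  shows "\<bar>steklov T f g s t h\<bar> \<le> (\<integral>x. (f x)\<^sup>2 \<partial>ivl T) / (2 * \<eta>) + \<eta> * (\<integral>x. (g x)\<^sup>2 \<partial>ivl T) / 2"
proof -
  have f2: "integrable (ivl T) (\<lambda>z. (f z)\<^sup>2 / (2 * \<eta>))" using f by (auto simp: sq_int_def)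
  have g2: "integrable (ivl T) (\<lambda>r. h * (\<eta> * (g r)\<^sup>2 / 2))" using g by (auto simp: sq_int_def)
  note w = integral_window_le[OF f2 _ \<open>0 < h\<close>]
  have "\<bar>ival T (\<lambda>r. ival T f (r - h) r * g r) s t\<bar> \<le> ival T (\<lambda>r. \<bar>ival T f (r - h) r * g r\<bar>) s t"
    by (intro ival_abs_le steklov_integrable assms)
  also have "\<dots> \<le> ival T (\<lambda>r. ival T (\<lambda>z. (f z)\<^sup>2 / (2 * \<eta>)) (r - h) r + h * (\<eta> * (g r)\<^sup>2 / 2)) s t"
    using steklov_pointwise[OF f \<open>0 < h\<close> \<open>0 < \<eta>\<close>] steklov_integrable[OF f g \<open>0 < h\<close>] w g2 \<open>0 < \<eta>\<close>
    by (intro ival_mono_AE) auto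
  also have "\<dots> \<le> (\<integral>r. ival T (\<lambda>z. (f z)\<^sup>2 / (2 * \<eta>)) (r - h) r + h * (\<eta> * (g r)\<^sup>2 / 2) \<partial>ivl T)"
    using w g2 \<open>0 < \<eta>\<close> \<open>0 < h\<close>
    by (intro ival_le_integral) (auto intro!: add_nonneg_nonneg ival_nonneg)
  also have "\<dots> = (\<integral>r. ival T (\<lambda>z. (f z)\<^sup>2 / (2 * \<eta>)) (r - h) r \<partial>ivl T) + h * (\<eta> * (\<integral>x. (g x)\<^sup>2 \<partial>ivl T) / 2)"
    using w g2 \<open>0 < \<eta>\<close> by simp
  also have "\<dots> \<le> h * (\<integral>z. (f z)\<^sup>2 / (2 * \<eta>) \<partial>ivl T) + h * (\<eta> * (\<integral>x. (g x)\<^sup>2 \<partial>ivl T) / 2)"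
    using w \<open>0 < \<eta>\<close> by simp
  finally have "\<bar>ival T (\<lambda>r. ival T f (r - h) r * g r) s t\<bar>
      \<le> h * ((\<integral>x. (f x)\<^sup>2 \<partial>ivl T) / (2 * \<eta>) + \<eta> * (\<integral>x. (g x)\<^sup>2 \<partial>ivl T) / 2)"
    by (simp add: distrib_left)
  then show ?thesis
    using \<open>0 < h\<close> by (simp add: steklov_def pos_divide_le_eq mult.commute)
qed

lemma steklov_add:
  assumes "sq_int (ivl T) f1" "sq_int (ivl T) f2" "sq_int (ivl T) g" "0 < h"
  shows "steklov T (\<lambda>x. f1 x + f2 x) g s t h = steklov T f1 g s t h + steklov T f2 g s t h"
proof -
  have "ival T (\<lambda>z. f1 z + f2 z) (r - h) r * g r = ival T f1 (r - h) r * g r + ival T f2 (r - h) r * g r" for r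
    using assms by (subst ival_add) (auto intro: ivl.sq_int_integrable simp: distrib_right)
  then show ?thesis
    unfolding steklov_def using steklov_integrable assms
    by (simp add: ival_add add_divide_distrib)
qed

lemma average_tendsto:
  assumes c: "continuous_on UNIV c" "\<And>x. \<bar>c x\<bar> \<le> C" and r: "0 < r" "r < T"
    and h: "\<And>n. 0 < h n" "h \<longlonglongrightarrow> 0"
  shows "(\<lambda>n::nat. ival T c (r - h n) r / h n) \<longlonglongrightarrow> c r"
proof (rule LIMSEQ_I)
  fix e :: real assume "0 < e"
  have ci: "integrable (ivl T) c"
    using c borel_measurable_continuous_onI[OF c(1)] by (intro ivl.integrable_const_bound[of _ C]) auto
  obtain d where d: "0 < d" "\<And>x. \<bar>x - r\<bar> < d \<Longrightarrow> \<bar>c x - c r\<bar> < e / 2"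
    using c(1)[unfolded continuous_on_iff, rule_format, of r "e/2"] \<open>0 < e\<close> by (auto simp: dist_real_def)
  have "\<forall>\<^sub>F n in sequentially. h n < min d r"
    using order_tendstoD(2)[OF h(2), of d] order_tendstoD(2)[OF h(2), of r] d r by (simp add: eventually_conj)
  then obtain N where N: "\<And>n. n \<ge> N \<Longrightarrow> h n < min d r" by (auto simp: eventually_sequentially)
  show "\<exists>N. \<forall>n\<ge>N. norm (ival T c (r - h n) r / h n - c r) < e"
  proof (intro exI[of _ N] allI impI)
    fix n assume "N \<le> n"
    then have hn: "h n < d" "h n < r" using N by auto
    have k: "ival T (\<lambda>_. k) (r - h n) r = k * h n" for k
      using ival_const[of "r - h n" r T k] h(1)[of n] hn r by simp
    have "ival T c (r - h n) r - c r * h n = ival T (\<lambda>x. c x - c r) (r - h n) r"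
      using ci k by (subst ival_diff) auto
    also have "\<bar>\<dots>\<bar> \<le> ival T (\<lambda>x. \<bar>c x - c r\<bar>) (r - h n) r"
      using ci by (intro ival_abs_le) auto
    also have "\<dots> \<le> ival T (\<lambda>x. e / 2) (r - h n) r"
    proof (intro ival_mono_AE AE_I2 impI)
      fix x assume "r - h n < x \<and> x \<le> r"
      then have "\<bar>x - r\<bar> < d" using hn by auto
      then show "\<bar>c x - c r\<bar> \<le> e / 2" using d(2)[of x] by simp
    qed (use ci in auto)
    also have "\<dots> < e * h n" using k \<open>0 < e\<close> h(1)[of n] by simp
    finally have "\<bar>ival T c (r - h n) r - c r * h n\<bar> < e * h n" .
    moreover have "ival T c (r - h n) r / h n - c r = (ival T c (r - h n) r - c r * h n) / h n"
      using h(1)[of n] by (simp add: diff_divide_distrib)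
    ultimately show "norm (ival T c (r - h n) r / h n - c r) < e"
      using h(1)[of n] by (simp add: pos_divide_less_eq)
  qed
qed

lemma steklov_tendsto_continuous:
  assumes c: "continuous_on UNIV c" "\<And>x. \<bar>c x\<bar> \<le> C" and g: "sq_int (ivl T) g"
    and h: "\<And>n. 0 < h n" "h \<longlonglongrightarrow> 0"
  shows "(\<lambda>n::nat. steklov T c g s t (h n)) \<longlonglongrightarrow> ival T (\<lambda>r. c r * g r) s t"
proof -
  have [measurable]: "c \<in> borel_measurable borel" "g \<in> borel_measurable borel"
    using c g by (auto intro: borel_measurable_continuous_onI simp: sq_int_def)
  have ci: "integrable (ivl T) c"
    using c by (intro ivl.integrable_const_bound[of _ C]) auto
  have C: "0 \<le> C" using c(2)[of 0] by simp
  have "steklov T c g s t (h n) = (\<integral>r. indicator {s<..t} r * (ival T c (r - h n) r / h n * g r) \<partial>ivl T)" for n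
    unfolding steklov_def ival_def[of _ _ s t] by simp
  moreover have "(\<lambda>n. \<integral>r. indicator {s<..t} r * (ival T c (r - h n) r / h n * g r) \<partial>ivl T)
      \<longlonglongrightarrow> (\<integral>r. indicator {s<..t} r * (c r * g r) \<partial>ivl T)"
  proof (rule integral_dominated_convergence)
    show "integrable (ivl T) (\<lambda>r. C * \<bar>g r\<bar>)" using ivl.sq_int_integrable[OF g] by auto
    show "AE r in ivl T. (\<lambda>n. indicator {s<..t} r * (ival T c (r - h n) r / h n * g r))
        \<longlonglongrightarrow> indicator {s<..t} r * (c r * g r)"
      using AE_ivl_mem[of T]
    proof eventually_elim
      case (elim r)
      show ?case by (intro tendsto_intros average_tendsto[OF c _ _ h]) (use elim in auto)
    qed
    show "AE r in ivl T. norm (indicator {s<..t} r * (ival T c (r - h n) r / h n * g r)) \<le> C * \<bar>g r\<bar>" for n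
    proof (intro AE_I2)
      fix r
      have "\<bar>ival T c (r - h n) r\<bar> \<le> ival T (\<lambda>r. \<bar>c r\<bar>) (r - h n) r" using ci by (rule ival_abs_le)
      also have "\<dots> \<le> ival T (\<lambda>r. C) (r - h n) r" using ci c(2) by (intro ival_mono_AE) auto
      also have "\<dots> \<le> C * h n" using ival_const_le[of "r - h n" r C T] C h(1)[of n] by simp
      finally have "\<bar>ival T c (r - h n) r / h n\<bar> \<le> C" using h(1)[of n] by (simp add: pos_divide_le_eq)
      from mult_right_mono[OF this, of "\<bar>g r\<bar>"]
      show "norm (indicator {s<..t} r * (ival T c (r - h n) r / h n * g r)) \<le> C * \<bar>g r\<bar>"
        using C by (auto simp: indicator_def abs_mult)
    qed
  qed auto
  ultimately show ?thesis by (simp add: ival_def)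
qed

lemma steklov_tendsto:
  assumes f: "sq_int (ivl T) f" and g: "sq_int (ivl T) g"
    and h: "\<And>n. 0 < h n" "h \<longlonglongrightarrow> 0"
  shows "(\<lambda>n::nat. steklov T f g s t (h n)) \<longlonglongrightarrow> ival T (\<lambda>r. f r * g r) s t"
proof (rule LIMSEQ_I)
  fix e :: real assume "0 < e"
  define G where "G = (\<integral>x. (g x)\<^sup>2 \<partial>ivl T)"
  have G: "0 \<le> G" unfolding G_def by (intro integral_nonneg_AE) auto
  define \<eta> where "\<eta> = e / (4 * (1 + G))"
  have \<eta>: "0 < \<eta>" using G \<open>0 < e\<close> by (auto simp: \<eta>_def)
  have \<eta>G: "4 * \<eta> * (1 + G) = e" using G by (simp add: \<eta>_def field_simps)
  obtain c C where c: "continuous_on UNIV c" "\<And>x. \<bar>c x\<bar> \<le> C" "(\<integral>x. (f x - c x)\<^sup>2 \<partial>ivl T) < \<eta>\<^sup>2"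
    using continuous_dense_L2[OF f, of "\<eta>\<^sup>2"] \<eta> by auto
  have csq: "sq_int (ivl T) c"
    using c borel_measurable_continuous_onI[OF c(1)] by (intro ivl.sq_int_bounded[of _ _ C]) auto
  have d: "sq_int (ivl T) (\<lambda>x. f x - c x)" by (rule sq_int_diff[OF f csq])
  have small: "(\<integral>x. (f x - c x)\<^sup>2 \<partial>ivl T) / (2 * \<eta>) + \<eta> * G / 2 \<le> \<eta> * (1 + G) / 2"
    using c(3) \<eta> by (simp add: field_simps power2_eq_square)
  have 1: "\<bar>steklov T (\<lambda>x. f x - c x) g s t (h n)\<bar> \<le> \<eta> * (1 + G) / 2" for n
    using steklov_bound[OF d g h(1) \<eta>, of s t n] small by (simp add: G_def)
  have 2: "\<bar>ival T (\<lambda>r. (f r - c r) * g r) s t\<bar> \<le> \<eta> * (1 + G) / 2"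
  proof -
    have "\<bar>ival T (\<lambda>r. (f r - c r) * g r) s t\<bar> \<le> ival T (\<lambda>r. \<bar>(f r - c r) * g r\<bar>) s t"
      by (intro ival_abs_le sq_int_mult d g)
    also have "\<dots> \<le> (\<integral>r. \<bar>(f r - c r) * g r\<bar> \<partial>ivl T)"
      using sq_int_mult[OF d g] by (intro ival_le_integral) auto
    also have "\<dots> \<le> (\<integral>r. (f r - c r)\<^sup>2 / (2 * \<eta>) + \<eta> * (g r)\<^sup>2 / 2 \<partial>ivl T)"
      using sq_int_mult[OF d g] d g young[OF \<eta>] by (intro integral_mono) (auto simp: sq_int_def)
    also have "\<dots> = (\<integral>x. (f x - c x)\<^sup>2 \<partial>ivl T) / (2 * \<eta>) + \<eta> * G / 2"
      using d g by (simp add: sq_int_def G_def)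
    finally show ?thesis using small by simp
  qed
  obtain N where N: "\<And>n. n \<ge> N \<Longrightarrow> \<bar>steklov T c g s t (h n) - ival T (\<lambda>r. c r * g r) s t\<bar> < e / 2"
    using LIMSEQ_D[OF steklov_tendsto_continuous[OF c(1,2) g h, of s t], of "e/2"] \<open>0 < e\<close> by auto
  show "\<exists>N. \<forall>n\<ge>N. norm (steklov T f g s t (h n) - ival T (\<lambda>r. f r * g r) s t) < e"
  proof (intro exI[of _ N] allI impI)
    fix n assume "N \<le> n"
    have "steklov T f g s t (h n) = steklov T (\<lambda>x. f x - c x) g s t (h n) + steklov T c g s t (h n)"
      using steklov_add[OF d csq g h(1), of s t n] by simp
    moreover have "ival T (\<lambda>r. f r * g r) s t = ival T (\<lambda>r. (f r - c r) * g r) s t + ival T (\<lambda>r. c r * g r) s t"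
      using sq_int_mult[OF d g] sq_int_mult[OF csq g]
      by (subst ival_add[symmetric]) (auto simp: algebra_simps)
    ultimately show "norm (steklov T f g s t (h n) - ival T (\<lambda>r. f r * g r) s t) < e"
      using 1[of n] 2 N[OF \<open>N \<le> n\<close>] \<eta>G unfolding real_norm_def by linarith
  qed
qed

section \<open>Weak derivatives in one variable\<close>

lemma dens_real: "density M (indicator S) = density M (\<lambda>x. ennreal (indicator S x))"
  by (simp add: ennreal_indicator)

lemma integral_ivl:
  fixes f :: "real \<Rightarrow> real"
  assumes "f \<in> borel_measurable borel"
  shows "(\<integral>x. f x \<partial>ivl T) = (\<integral>x. indicator {0<..<T} x * f x \<partial>lborel)"
  unfolding ivl_def dens_real using assms by (subst integral_density) auto

lemma FTC_ivl:
  assumes F: "\<And>x. (F has_real_derivative f x) (at x)" and f: "continuous_on UNIV f"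
    and "0 \<le> a" "a \<le> b" "b \<le> T"
  shows "ival T f a b = F b - F a"
proof -
  have [measurable]: "f \<in> borel_measurable borel" using f by (rule borel_measurable_continuous_onI)
  have "ival T f a b = (\<integral>r. indicator {0<..<T} r * (indicator {a<..b} r * f r) \<partial>lborel)"
    unfolding ival_def by (subst integral_ivl) auto
  also have "\<dots> = (\<integral>r. indicator {a..b} r *\<^sub>R f r \<partial>lborel)"
  proof (rule integral_cong_AE)
    show "AE r in lborel. indicator {0<..<T} r * (indicator {a<..b} r * f r) = indicator {a..b} r *\<^sub>R f r"
      using AE_lborel_singleton[of a] AE_lborel_singleton[of T]
      by eventually_elim (use assms in \<open>auto simp: indicator_def\<close>)
  qed auto
  also have "\<dots> = F b - F a"
    using F f \<open>a \<le> b\<close>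
    by (intro integral_FTC_Icc) (auto intro: continuous_on_subset has_field_derivative_at_within
        simp: has_real_derivative_iff_has_vector_derivative[symmetric])
  finally show ?thesis .
qed

lemma bounded_continuous_integrable_ivl:
  assumes "continuous_on UNIV (f :: real \<Rightarrow> real)"
  shows "integrable (ivl T) f"
proof -
  obtain C where C: "\<And>r. r \<in> {0..T} \<Longrightarrow> \<bar>f r\<bar> \<le> C"
    using continuous_on_bounded_interval[OF continuous_on_subset[OF assms], of 0 T] by blast
  show ?thesis
    using borel_measurable_continuous_onI[OF assms] C
    by (intro ivl.integrable_const_bound[of _ C] eventually_mono[OF AE_ivl_mem]) auto
qed

lemma zero_window_imp_AE_zero:
  assumes f: "sq_int (ivl T) f" and "0 \<le> T" and zero: "\<And>a b. \<lbrakk>0 \<le> a; a \<le> b; b \<le> T\<rbrakk> \<Longrightarrow> ival T f a b = 0"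
  shows "AE x in ivl T. f x = 0"
proof -
  have [measurable]: "f \<in> borel_measurable borel" using f by (auto simp: sq_int_def)
  have fi: "integrable (ivl T) f" using f by (rule ivl.sq_int_integrable)
  have "ival T f (r - h) r = 0" if "0 < r" "r \<le> T" "0 < h" for r h
  proof (cases "0 \<le> r - h")
    case False
    have "ival T f (r - h) r = ival T f (r - h) 0 + ival T f 0 r"
      using False that by (intro ival_combine fi) auto
    moreover have "ival T f (r - h) 0 = ival T (\<lambda>_. 0) (r - h) 0"
      by (intro ival_cong_AE eventually_mono[OF AE_ivl_mem]) auto
    ultimately show ?thesis using that zero[of 0 r] by (simp add: ival_def)
  qed (use that zero in auto)
  then have "steklov T f f 0 T h = steklov T (\<lambda>_. 0) f 0 T h" if "0 < h" for h
    unfolding steklov_def ival_def[of _ _ 0 T] using that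
    by (intro arg_cong[of _ _ "\<lambda>x. x / h"] Bochner_Integration.integral_cong) (auto simp: indicator_def ival_def)
  then have "steklov T f f 0 T h = 0" if "0 < h" for h
    using that by (simp add: steklov_def ival_def)
  moreover have "(\<lambda>n. steklov T f f 0 T (1 / real (Suc n))) \<longlonglongrightarrow> ival T (\<lambda>r. f r * f r) 0 T"
    using LIMSEQ_inverse_real_of_nat by (intro steklov_tendsto f) (auto simp: inverse_eq_divide)
  ultimately have "ival T (\<lambda>r. f r * f r) 0 T = 0"
    by (simp add: LIMSEQ_const_iff)
  then have "(\<integral>r. (f r)\<^sup>2 \<partial>ivl T) = 0"
    using \<open>0 \<le> T\<close> by (subst (asm) ival_all) (auto simp: power2_eq_square)
  then show ?thesis
    using f by (subst (asm) integral_nonneg_eq_0_iff_AE) (auto simp: sq_int_def)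
qed

lemma test_function_ivl:
  assumes "test_function {0<..<T} \<phi>" "0 < T"
  shows "\<lbrakk>0 \<le> a; a \<le> b; b \<le> T\<rbrakk> \<Longrightarrow> ival T (deriv \<phi>) a b = \<phi> b - \<phi> a"
    and "(\<integral>x. deriv \<phi> x \<partial>ivl T) = 0"
    and "0 \<le> x \<Longrightarrow> x \<le> T \<Longrightarrow> ival T (deriv \<phi>) 0 x = \<phi> x"
proof -
  have c: "continuous_on UNIV (deriv \<phi>)" using test_function_deriv(2)[OF assms(1), of 0] by simp
  show *: "ival T (deriv \<phi>) a b = \<phi> b - \<phi> a" if "0 \<le> a" "a \<le> b" "b \<le> T" for a b
    using FTC_ivl[OF test_function_deriv(1)[OF assms(1)] c that] .
  have z: "\<phi> 0 = 0" "\<phi> T = 0" using assms by (auto intro: test_function_outside)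
  show "(\<integral>x. deriv \<phi> x \<partial>ivl T) = 0"
    using *[of 0 T] z assms c ival_all[of T T "deriv \<phi>"] by (simp add: borel_measurable_continuous_onI)
  show "0 \<le> x \<Longrightarrow> x \<le> T \<Longrightarrow> ival T (deriv \<phi>) 0 x = \<phi> x" using *[of 0 x] z by simp
qed

lemma test_function_continuous:
  fixes \<phi> :: "'a::euclidean_space \<Rightarrow> real"
  assumes "test_function U \<phi>" shows "continuous_on UNIV \<phi>"
  using assms C_k_imp_continuous by (auto simp: test_function_def)

lemma ramp_tendsto:
  assumes "r \<noteq> a" "r \<noteq> b" "a \<le> b"
  shows "(\<lambda>n. ramp (real n * (r - a)) - ramp (real n * (r - b))) \<longlonglongrightarrow> indicator {a<..b} r"
proof -
  have *: "(\<lambda>n. ramp (real n * (r - c))) \<longlonglongrightarrow> indicator {c<..} r" if "r \<noteq> c" for c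
  proof (cases "r < c")
    case True
    then show ?thesis using ramp(1)[of "real _ * (r - c)"] by (simp add: mult_nonneg_nonpos)
  next
    case False
    then have "0 < r - c" using that by simp
    then obtain N :: nat where "1 < real N * (r - c)" using ex_less_of_nat_mult by blast
    then have "1 \<le> real n * (r - c)" if "n \<ge> N" for n
      using mult_right_mono[of "real N" "real n" "r - c"] that \<open>0 < r - c\<close> by linarith
    then have "\<forall>\<^sub>F n in sequentially. indicator {c<..} r = ramp (real n * (r - c))"
      using \<open>0 < r - c\<close> ramp(2) by (intro eventually_sequentiallyI[of N]) auto
    then show ?thesis by (rule Lim_transform_eventually[OF tendsto_const])
  qed
  have "indicator {a<..b} r = (indicator {a<..} r - indicator {b<..} r :: real)"
    using assms by (auto simp: indicator_def)
  then show ?thesis using tendsto_diff[OF *[OF assms(1)] *[OF assms(2)]] by simp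
qed

lemma ramp_integral_tendsto:
  assumes g: "integrable (ivl T) g" and "a \<le> b"
  shows "(\<lambda>n. \<integral>r. g r * (ramp (real n * (r - a)) - ramp (real n * (r - b))) \<partial>ivl T) \<longlonglongrightarrow> ival T g a b"
proof -
  have [measurable]: "g \<in> borel_measurable borel" "ramp \<in> borel_measurable borel"
    using g ramp_continuous(1) by (auto intro: borel_measurable_continuous_onI)
  have "(\<lambda>n. \<integral>r. g r * (ramp (real n * (r - a)) - ramp (real n * (r - b))) \<partial>ivl T)
      \<longlonglongrightarrow> (\<integral>r. g r * indicator {a<..b} r \<partial>ivl T)"
  proof (rule integral_dominated_convergence)
    show "AE r in ivl T. (\<lambda>n. g r * (ramp (real n * (r - a)) - ramp (real n * (r - b)))) \<longlonglongrightarrow> g r * indicator {a<..b} r"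
      using AE_ivl_neq[of a T] AE_ivl_neq[of b T]
      by eventually_elim (intro tendsto_intros ramp_tendsto \<open>a \<le> b\<close>)
    show "AE r in ivl T. norm (g r * (ramp (real n * (r - a)) - ramp (real n * (r - b)))) \<le> \<bar>g r\<bar>" for n
    proof (intro AE_I2)
      fix r
      have "\<bar>ramp (real n * (r - a)) - ramp (real n * (r - b))\<bar> \<le> 1"
        using ramp(3,4)[of "real n * (r - a)"] ramp(3,4)[of "real n * (r - b)"] by linarith
      from mult_left_mono[OF this, of "\<bar>g r\<bar>"]
      show "norm (g r * (ramp (real n * (r - a)) - ramp (real n * (r - b)))) \<le> \<bar>g r\<bar>" by (simp add: abs_mult)
    qed
  qed (use g in auto)
  then show ?thesis by (simp add: ival_def mult.commute)
qed

lemma ramp_test_function: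
  assumes "0 < n" "a \<le> b" "{a..b + 1 / n} \<subseteq> U"
  shows "test_function U (\<lambda>r. ramp (n * (r - a)) - ramp (n * (r - b)))"
proof (rule test_functionI[where K = "{a..b + 1 / n}"])
  show "C_k k (\<lambda>r. ramp (n * (r - a)) - ramp (n * (r - b)))" for k
    using C_k_affine[OF ramp_C_k(1), of k n "- n * a"] C_k_affine[OF ramp_C_k(1), of k n "- n * b"]
    by (intro C_k_diff) (simp_all add: algebra_simps)
  fix r assume r: "r \<notin> {a..b + 1 / n}"
  show "ramp (n * (r - a)) - ramp (n * (r - b)) = 0"
  proof (cases "r < a")
    case True
    then have "n * (r - a) \<le> 0" "n * (r - b) \<le> 0" using assms(1,2) by (auto intro!: mult_nonneg_nonpos)
    then show ?thesis using ramp(1) by simp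
  next
    case False
    then have "b + 1 / n < r" using r by auto
    then have b: "1 < n * (r - b)" using \<open>0 < n\<close> by (simp add: field_simps)
    also have "n * (r - b) \<le> n * (r - a)" using assms(1,2) by auto
    finally show ?thesis using b ramp(2) by simp
  qed
qed (use assms in auto)

lemma delta_tendsto:
  fixes F :: "real \<Rightarrow> real"
  assumes F: "continuous_on {0..T} F" and Fi: "F \<in> borel_measurable borel" and s: "0 \<le> s" "s < T"
  shows "(\<lambda>n. \<integral>r. F r * (real n * deriv ramp (real n * (r - s))) \<partial>ivl T) \<longlonglongrightarrow> F s"
proof (rule LIMSEQ_I)
  fix e :: real assume "0 < e"
  note [measurable] = Fi
  have [measurable]: "deriv ramp \<in> borel_measurable borel" using ramp_continuous(2) by (rule borel_measurable_continuous_onI)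
  obtain d where d: "0 < d" "\<And>r. r \<in> {0..T} \<Longrightarrow> \<bar>r - s\<bar> < d \<Longrightarrow> \<bar>F r - F s\<bar> < e / 2"
    using F[unfolded continuous_on_iff, rule_format, of s "e/2"] s \<open>0 < e\<close> by (auto simp: dist_real_def)
  define m where "m = min d (T - s)"
  have "0 < m" using d s by (auto simp: m_def)
  then obtain N :: nat where N: "1 < real N * m" using ex_less_of_nat_mult by blast
  show "\<exists>N. \<forall>n\<ge>N. norm ((\<integral>r. F r * (real n * deriv ramp (real n * (r - s))) \<partial>ivl T) - F s) < e"
  proof (intro exI[of _ N] allI impI)
    fix n assume "N \<le> n"
    then have "real N * m \<le> real n * m" using \<open>0 < m\<close> by (intro mult_right_mono) auto
    then have n: "1 < real n * m" using N by linarith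
    then have "0 < real n" using \<open>0 < m\<close> by (metis mult_eq_0_iff not_one_less_zero of_nat_0_le_iff order_less_le)
    define k where "k r = real n * deriv ramp (real n * (r - s))" for r
    have kd: "((\<lambda>r. ramp (real n * (r - s))) has_real_derivative k r) (at r)" for r
      unfolding k_def by (rule ramp_affine_deriv)
    have kc: "continuous_on UNIV k"
      unfolding k_def[abs_def] by (intro continuous_intros continuous_on_compose2[OF ramp_continuous(2)]) auto
    have k: "integrable (ivl T) k" by (rule bounded_continuous_integrable_ivl[OF kc])
    have k0: "0 \<le> k r" for r using ramp(5) by (auto simp: k_def)
    have "n * m \<le> n * (T - s)" by (intro mult_left_mono) (auto simp: m_def)
    then have "(\<integral>r. k r \<partial>ivl T) = 1"
      using FTC_ivl[OF kd kc, of 0 T T] ival_all[of T T k] k s n ramp(1)[of "- (n * s)"] ramp(2)[of "n * (T - s)"]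
      by (auto simp: algebra_simps)
    then have k1: "(\<integral>r. k r \<partial>ivl T) = 1" .
    have supp: "\<bar>F r - F s\<bar> * k r \<le> e / 2 * k r" if "0 < r" "r < T" for r
    proof (cases "k r = 0")
      case False
      then have "deriv ramp (real n * (r - s)) \<noteq> 0" by (simp add: k_def)
      then have "0 < real n * (r - s)" "real n * (r - s) < 1"
        using ramp(6,7) not_le by blast+
      then have "0 < r - s" "real n * (r - s) < real n * m"
        using n zero_less_mult_pos[OF _ \<open>0 < real n\<close>] by (blast, linarith)
      then have "\<bar>r - s\<bar> < d"
        using \<open>0 < real n\<close> mult_less_cancel_left_pos[of "real n" "r - s" m] by (simp add: m_def)
      then have "\<bar>F r - F s\<bar> \<le> e / 2" using d(2)[of r] that by auto
      then show ?thesis using k0[of r] by (intro mult_right_mono) auto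
    qed auto
    obtain C where C: "\<And>r. r \<in> {0..T} \<Longrightarrow> \<bar>F r\<bar> \<le> C"
      using continuous_on_bounded_interval[OF F] by blast
    have Fk: "integrable (ivl T) (\<lambda>r. F r * k r)"
    proof (rule Bochner_Integration.integrable_bound)
      show "integrable (ivl T) (\<lambda>r. C * k r)" using k by auto
      show "AE r in ivl T. norm (F r * k r) \<le> norm (C * k r)"
        using AE_ivl_mem[of T]
      proof eventually_elim
        case (elim r)
        then have "\<bar>F r\<bar> \<le> \<bar>C\<bar>" using C[of r] by auto
        then show ?case by (auto simp: abs_mult intro!: mult_right_mono)
      qed
    qed (use k in auto)
    have "(\<integral>r. F r * k r \<partial>ivl T) - F s = (\<integral>r. F r * k r - F s * k r \<partial>ivl T)"
      using Fk k k1 by simp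
    also have "\<bar>\<dots>\<bar> \<le> (\<integral>r. e / 2 * k r \<partial>ivl T)"
    proof (rule order_trans)
      show "\<bar>\<integral>r. F r * k r - F s * k r \<partial>ivl T\<bar> \<le> (\<integral>r. \<bar>F r * k r - F s * k r\<bar> \<partial>ivl T)"
        using integral_norm_bound[of "ivl T" "\<lambda>r. F r * k r - F s * k r"] by simp
      show "(\<integral>r. \<bar>F r * k r - F s * k r\<bar> \<partial>ivl T) \<le> (\<integral>r. e / 2 * k r \<partial>ivl T)"
      proof (rule integral_mono_AE)
        show "AE r in ivl T. \<bar>F r * k r - F s * k r\<bar> \<le> e / 2 * k r"
          using AE_ivl_mem[of T]
        proof eventually_elim
          case (elim r)
          then show ?case using supp[of r] k0[of r] by (simp add: left_diff_distrib[symmetric] abs_mult)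
        qed
      qed (use Fk k in auto)
    qed
    also have "\<dots> < e" using k1 \<open>0 < e\<close> by simp
    finally show "norm ((\<integral>r. F r * (real n * deriv ramp (real n * (r - s))) \<partial>ivl T) - F s) < e"
      by (simp add: k_def)
  qed
qed

lemma integrable_continuous_interval:
  assumes F: "continuous_on {0..T} F" and [measurable]: "F \<in> borel_measurable borel"
  shows "sq_int (ivl T) F"
proof -
  obtain C where "\<And>r. r \<in> {0..T} \<Longrightarrow> \<bar>F r\<bar> \<le> C"
    using continuous_on_bounded_interval[OF F] by blast
  then show ?thesis
    by (intro ivl.sq_int_bounded[of _ _ C] eventually_mono[OF AE_ivl_mem]) auto
qed

lemma interval_exhaustion:
  fixes s t :: real
  assumes "s < t"
  obtains a b :: "nat \<Rightarrow> real" where "a \<longlonglongrightarrow> s" "b \<longlonglongrightarrow> t" "\<And>n. s < a n" "\<And>n. a n \<le> b n" "\<And>n. b n < t"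
proof -
  define \<delta> where "\<delta> n = (t - s) / (real n + 3)" for n :: nat
  have \<delta>: "0 < \<delta> n" "\<delta> n < (t - s) / 2" for n
    unfolding \<delta>_def using assms by (simp, intro divide_strict_left_mono) auto
  have "(\<lambda>n. s + \<delta> n) \<longlonglongrightarrow> s" "(\<lambda>n. t - \<delta> n) \<longlonglongrightarrow> t" unfolding \<delta>_def by real_asymp+
  moreover have "s + \<delta> n \<le> t - \<delta> n" for n using \<delta>(2)[of n] by (simp add: field_simps)
  ultimately show thesis using \<delta>(1) by (intro that[of "\<lambda>n. s + \<delta> n" "\<lambda>n. t - \<delta> n"]) auto
qed

lemma weak_derivative_primitive:
  assumes F: "continuous_on {0..T} F" and Fm: "F \<in> borel_measurable borel" and G: "integrable (ivl T) G"
    and weak: "\<And>\<phi>. test_function {0<..<T} \<phi> \<Longrightarrow> (\<integral>r. F r * deriv \<phi> r \<partial>ivl T) = - (\<integral>r. G r * \<phi> r \<partial>ivl T)"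
    and "0 \<le> s" "s \<le> t" "t \<le> T"
  shows "F t - F s = ival T G s t"
proof -
  note [measurable] = Fm borel_measurable_continuous_onI[OF ramp_continuous(2)]
  have Fs: "sq_int (ivl T) F" by (rule integrable_continuous_interval[OF F Fm])
  have inner: "F t - F s = ival T G s t" if st: "0 < s" "s \<le> t" "t < T" for s t
  proof -
    obtain N :: nat where N: "1 < real N * (T - t)" using ex_less_of_nat_mult[of "T - t" 1] st by auto
    define \<phi> where "\<phi> n r = ramp (real n * (r - s)) - ramp (real n * (r - t))" for n r
    have \<phi>: "(\<integral>r. F r * (real n * deriv ramp (real n * (r - s))) \<partial>ivl T) - (\<integral>r. F r * (real n * deriv ramp (real n * (r - t))) \<partial>ivl T)
         = - (\<integral>r. G r * (ramp (real n * (r - s)) - ramp (real n * (r - t))) \<partial>ivl T)" if "n \<ge> N" for n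
    proof -
      have "real N * (T - t) \<le> real n * (T - t)" using that st by (intro mult_right_mono) auto
      then have n: "1 < real n * (T - t)" using N by simp
      then have "n > 0" by (cases n) auto
      have tf: "test_function {0<..<T} (\<phi> n)"
      proof -
        have "t + 1 / real n < T" using n \<open>n > 0\<close> by (simp add: field_simps)
        then show ?thesis
          unfolding \<phi>_def using st \<open>n > 0\<close> by (intro ramp_test_function) auto
      qed
      have d: "(\<phi> n has_real_derivative real n * deriv ramp (real n * (r - s)) - real n * deriv ramp (real n * (r - t))) (at r)" for r
        unfolding \<phi>_def by (intro DERIV_diff ramp_affine_deriv)
      have i: "integrable (ivl T) (\<lambda>r. F r * (real n * deriv ramp (real n * (r - c))))" for c
      proof (rule sq_int_mult[OF Fs])
        have "continuous_on UNIV (\<lambda>r. real n * deriv ramp (real n * (r - c)))"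
          by (intro continuous_intros continuous_on_compose2[OF ramp_continuous(2)]) auto
        then show "sq_int (ivl T) (\<lambda>r. real n * deriv ramp (real n * (r - c)))"
          by (intro integrable_continuous_interval) (auto intro: continuous_on_subset)
      qed
      have "(\<integral>r. F r * deriv (\<phi> n) r \<partial>ivl T)
        = (\<integral>r. F r * (real n * deriv ramp (real n * (r - s))) - F r * (real n * deriv ramp (real n * (r - t))) \<partial>ivl T)"
        by (intro Bochner_Integration.integral_cong refl) (simp only: DERIV_imp_deriv[OF d] right_diff_distrib)
      then show ?thesis using weak[OF tf] i by (simp add: \<phi>_def)
    qed
    have "(\<lambda>n. (\<integral>r. F r * (real n * deriv ramp (real n * (r - s))) \<partial>ivl T) - (\<integral>r. F r * (real n * deriv ramp (real n * (r - t))) \<partial>ivl T))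
       \<longlonglongrightarrow> F s - F t"
      by (intro tendsto_diff delta_tendsto F Fm) (use st in auto)
    moreover have "(\<lambda>n. - (\<integral>r. G r * (ramp (real n * (r - s)) - ramp (real n * (r - t))) \<partial>ivl T)) \<longlonglongrightarrow> - ival T G s t"
      by (intro tendsto_minus ramp_integral_tendsto G st)
    then have "(\<lambda>n. (\<integral>r. F r * (real n * deriv ramp (real n * (r - s))) \<partial>ivl T) - (\<integral>r. F r * (real n * deriv ramp (real n * (r - t))) \<partial>ivl T))
       \<longlonglongrightarrow> - ival T G s t"
      by (rule Lim_transform_eventually) (use \<phi> in \<open>auto simp: eventually_sequentially intro!: exI[of _ N]\<close>)
    ultimately show ?thesis using LIMSEQ_unique by force
  qed
  show ?thesis
  proof (cases "s = t")
    case False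
    then have "s < t" using assms by simp
    obtain a b where ab: "a \<longlonglongrightarrow> s" "b \<longlonglongrightarrow> t" "\<And>n. s < a n" "\<And>n. a n \<le> b n" "\<And>n. b n < t"
      using interval_exhaustion[OF \<open>s < t\<close>] by metis
    have rng: "b n \<in> {0..T}" "a n \<in> {0..T}" for n
      using ab(3-5)[of n] assms(5,6,7) by (auto intro: order_trans less_imp_le)
    have "(\<lambda>n. F (b n) - F (a n)) \<longlonglongrightarrow> F t - F s"
      using F[unfolded continuous_on_sequentially] ab rng assms(5,6,7) by (intro tendsto_diff) (auto simp: o_def)
    moreover have "F (b n) - F (a n) = ival T G (a n) (b n)" for n
      using ab(3-5)[of n] assms(5,6,7) by (intro inner) auto
    moreover have "(\<lambda>n. ival T G (a n) (b n)) \<longlonglongrightarrow> ival T G s t"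
      by (intro ival_tendsto G ab)
    ultimately show ?thesis using LIMSEQ_unique by auto
  qed simp
qed

lemma unit_bump:
  obtains e0 :: "real \<Rightarrow> real"
  where "test_function {1/4..3/4} e0" "(\<integral>x. e0 x \<partial>ivl 1) = 1"
proof -
  define e0 where "e0 x = 2 * deriv ramp (2 * (x - 1 / 4))" for x
  have e0: "C_k k e0" for k unfolding e0_def[abs_def]
    using C_k_affine[OF ramp_C_k(2), of k 2 "- 1 / 2"] by (intro C_k_mult C_k_const) (simp add: algebra_simps)
  have e0d: "((\<lambda>x. ramp (2 * (x - 1 / 4))) has_real_derivative e0 x) (at x)" for x
    unfolding e0_def by (rule ramp_affine_deriv)
  have e0c: "continuous_on UNIV e0" using C_k_imp_continuous[OF e0] .
  have e0i: "integrable (ivl 1) e0" by (rule bounded_continuous_integrable_ivl[OF e0c])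
  show thesis
  proof (rule that[of e0])
    show "test_function {1/4..3/4} e0"
      by (rule test_functionI[OF e0 compact_Icc[of "1/4" "3/4"]]) (use ramp(6,7) in \<open>auto simp: e0_def not_le\<close>)
    show "(\<integral>x. e0 x \<partial>ivl 1) = 1"
      using FTC_ivl[OF e0d e0c, of 0 1 1] ival_all[of 1 1 e0] ramp(1,2) e0i by auto
  qed
qed

lemma du_Bois_Reymond:
  assumes W: "sq_int (ivl 1) W" and D: "sq_int (ivl 1) D"
    and weak: "\<And>\<phi>. test_function {0<..<1} \<phi> \<Longrightarrow> (\<integral>x. W x * deriv \<phi> x \<partial>ivl 1) = - (\<integral>x. D x * \<phi> x \<partial>ivl 1)"
  shows "\<exists>h. AE x in ivl 1. W x = ival 1 D 0 x + h"
proof -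
  have Di: "integrable (ivl 1) D" by (rule ivl.sq_int_integrable[OF D])
  define Z where "Z x = W x - ival 1 D 0 x" for x
  have Ps: "sq_int (ivl 1) (ival 1 D 0)"
    using ival_continuous[OF Di, of UNIV 0] by (intro integrable_continuous_interval ival_continuous[OF Di] borel_measurable_continuous_onI)
  have Z: "sq_int (ivl 1) Z" unfolding Z_def[abs_def] by (rule sq_int_diff[OF W Ps])
  have Zi: "integrable (ivl 1) Z" by (rule ivl.sq_int_integrable[OF Z])
  have Z0: "(\<integral>x. Z x * deriv \<phi> x \<partial>ivl 1) = 0" if \<phi>: "test_function {0<..<1} \<phi>" for \<phi>
  proof -
    have c: "continuous_on UNIV (deriv \<phi>)" using test_function_deriv(2)[OF \<phi>, of 0] by simp
    then have s: "sq_int (ivl 1) (deriv \<phi>)"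
      by (intro integrable_continuous_interval borel_measurable_continuous_onI) (auto intro: continuous_on_subset)
    have [measurable]: "D \<in> borel_measurable borel" "\<phi> \<in> borel_measurable borel" "deriv \<phi> \<in> borel_measurable borel"
      using Di test_function_continuous[OF \<phi>] c by (auto intro: borel_measurable_continuous_onI)
    have [measurable]: "ival 1 (deriv \<phi>) 0 \<in> borel_measurable borel"
      using ival_continuous[OF ivl.sq_int_integrable[OF s], of UNIV 0] by (rule borel_measurable_continuous_onI)
    have "(\<integral>x. ival 1 D 0 x * deriv \<phi> x \<partial>ivl 1) = - (\<integral>x. D x * ival 1 (deriv \<phi>) 0 x \<partial>ivl 1)"
      by (intro integral_by_parts Di ivl.sq_int_integrable[OF s] test_function_ivl(2)[OF \<phi>]) auto
    also have "(\<integral>x. D x * ival 1 (deriv \<phi>) 0 x \<partial>ivl 1) = (\<integral>x. D x * \<phi> x \<partial>ivl 1)"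
      using test_function_ivl(3)[OF \<phi>] by (intro integral_cong_AE eventually_mono[OF AE_ivl_mem]) auto
    finally show ?thesis
      using weak[OF \<phi>] sq_int_mult[OF W s] sq_int_mult[OF Ps s] by (simp add: Z_def left_diff_distrib)
  qed
  obtain e0 where e0t: "test_function {1/4..3/4} e0" and e01: "(\<integral>x. e0 x \<partial>ivl 1) = 1"
    by (rule unit_bump)
  have e0: "C_k k e0" for k using e0t by (simp add: test_function_def)
  have e0c: "continuous_on UNIV e0" using C_k_imp_continuous[OF e0] .
  have e0i: "integrable (ivl 1) e0" by (rule bounded_continuous_integrable_ivl[OF e0c])
  have e0s: "e0 x = 0" if "x \<notin> {1/4..3/4}" for x using test_function_outside[OF e0t that] .
  define k where "k = (\<integral>x. Z x * e0 x \<partial>ivl 1)"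
  have Ze0: "integrable (ivl 1) (\<lambda>x. Z x * e0 x)"
    by (intro sq_int_mult[OF Z] integrable_continuous_interval borel_measurable_continuous_onI)
      (auto intro: continuous_on_subset e0c)
  have inner: "ival 1 Z a b = k * (b - a)" if ab: "0 < a" "a \<le> b" "b < 1" for a b
  proof -
    obtain N :: nat where N: "1 < real N * (1 - b)" using ex_less_of_nat_mult[of "1 - b" 1] ab by auto
    define B where "B n r = ramp (real n * (r - a)) - ramp (real n * (r - b))" for n r
    have eq: "(\<integral>x. Z x * B n x \<partial>ivl 1) = (\<integral>x. 1 * B n x \<partial>ivl 1) * k" if "n \<ge> N" for n
    proof -
      have "real N * (1 - b) \<le> real n * (1 - b)" using that ab by (intro mult_right_mono) auto
      then have n: "1 < real n * (1 - b)" using N by simp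
      then have "n > 0" by (cases n) auto
      have tf: "test_function {a..b + 1 / n} (B n)"
        unfolding B_def using ab \<open>n > 0\<close> n by (intro ramp_test_function) auto
      define m where "m = (\<integral>x. B n x \<partial>ivl 1)"
      define q where "q x = B n x - m * e0 x" for x
      have Bk: "C_k j (B n)" for j using tf by (simp add: test_function_def)
      have q: "C_k j q" for j
        unfolding q_def[abs_def] by (intro C_k_diff C_k_mult C_k_const e0 Bk)
      have Bc: "continuous_on UNIV (B n)" using test_function_continuous[OF tf] .
      have Bi: "integrable (ivl 1) (B n)" by (rule bounded_continuous_integrable_ivl[OF Bc])
      have qc: "continuous_on UNIV q" using C_k_imp_continuous[OF q] .
      obtain Q0 where Q0: "\<And>x. (Q0 has_real_derivative q x) (at x)" using antiderivative_real[OF qc] by blast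
      define c where "c = min a (1/4)"
      define d where "d = max (b + 1 / n) (3/4)"
      have bn: "b + 1 / n < 1" using n \<open>n > 0\<close> by (simp add: field_simps)
      have cd: "0 < c" "c \<le> d" "d < 1" using ab bn \<open>n > 0\<close> by (auto simp: c_def d_def min_def max_def)
      have q0: "q x = 0" if "x \<notin> {c..d}" for x
      proof -
        have "x \<notin> {1/4..3/4}" "x \<notin> {a..b + 1 / n}" using that by (auto simp: c_def d_def min_le_iff_disj le_max_iff_disj)
        then show ?thesis using e0s[of x] test_function_outside[OF tf, of x] by (simp add: q_def)
      qed
      define \<phi> where "\<phi> x = Q0 x - Q0 0" for x
      have \<phi>d: "(\<phi> has_real_derivative q x) (at x)" for x
        unfolding \<phi>_def[abs_def] using DERIV_diff[OF Q0 DERIV_const[of "Q0 0"]] by simp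
      have "\<phi> 0 = 0" by (simp add: \<phi>_def)
      have "\<phi> 1 = ival 1 q 0 1" using FTC_ivl[OF \<phi>d qc, of 0 1 1] \<open>\<phi> 0 = 0\<close> by simp
      also have "\<dots> = (\<integral>x. q x \<partial>ivl 1)"
        using qc by (intro ival_all) (auto intro: borel_measurable_continuous_onI)
      also have "\<dots> = 0" using Bi e0i e01 by (simp add: q_def m_def)
      finally have "\<phi> 1 = 0" .
      have "test_function {0<..<1} \<phi>"
      proof (rule test_functionI[where K = "{c..d}"])
        show "C_k j \<phi>" for j using C_k_antiderivative[OF \<phi>d] q by blast
        fix x assume x: "x \<notin> {c..d}"
        show "\<phi> x = 0"
        proof (cases "x < c")
          case True
          have "max x 0 < c" using True cd by simp
          then have "\<phi> (min x 0) = \<phi> (max x 0)"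
            by (intro has_zero_derivative_imp_eq[OF \<phi>d] q0) auto
          then show ?thesis using \<open>\<phi> 0 = 0\<close> by (auto simp: min_def max_def split: if_splits)
        next
          case False
          then have "d < x" using x by auto
          then have "d < min x 1" using cd by simp
          then have "\<phi> (min x 1) = \<phi> (max x 1)"
            by (intro has_zero_derivative_imp_eq[OF \<phi>d] q0) auto
          then show ?thesis using \<open>\<phi> 1 = 0\<close> by (auto simp: min_def max_def split: if_splits)
        qed
      qed (use cd in auto)
      from Z0[OF this] have "(\<integral>x. Z x * q x \<partial>ivl 1) = 0"
        by (simp add: DERIV_imp_deriv[OF \<phi>d])
      moreover have "integrable (ivl 1) (\<lambda>x. Z x * B n x)"
        by (intro sq_int_mult[OF Z] integrable_continuous_interval borel_measurable_continuous_onI Bc)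
          (auto intro: continuous_on_subset Bc)
      ultimately show ?thesis
        using Ze0 by (simp add: q_def k_def m_def right_diff_distrib mult.left_commute[of "Z _"])
    qed
    have "(\<lambda>n. \<integral>x. Z x * B n x \<partial>ivl 1) \<longlonglongrightarrow> ival 1 Z a b"
      unfolding B_def by (intro ramp_integral_tendsto Zi ab)
    moreover have "(\<lambda>n. (\<integral>x. 1 * B n x \<partial>ivl 1) * k) \<longlonglongrightarrow> ival 1 (\<lambda>_. 1) a b * k"
      unfolding B_def by (intro tendsto_mult tendsto_const ramp_integral_tendsto ab) auto
    then have "(\<lambda>n. \<integral>x. Z x * B n x \<partial>ivl 1) \<longlonglongrightarrow> ival 1 (\<lambda>_. 1) a b * k"
      by (rule Lim_transform_eventually) (use eq in \<open>auto simp: eventually_sequentially intro!: exI[of _ N]\<close>)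
    ultimately have "ival 1 Z a b = ival 1 (\<lambda>_. 1) a b * k" by (rule LIMSEQ_unique)
    then show ?thesis using ival_const[of a b 1 1] ab by simp
  qed
  have Zk: "sq_int (ivl 1) (\<lambda>x. Z x - k)" by (intro sq_int_diff Z ivl.sq_int_const)
  have Zki: "integrable (ivl 1) (\<lambda>x. Z x - k)" by (rule ivl.sq_int_integrable[OF Zk])
  have "AE x in ivl 1. Z x - k = 0"
  proof (rule zero_window_imp_AE_zero[OF Zk])
    fix a b :: real assume ab: "0 \<le> a" "a \<le> b" "b \<le> 1"
    show "ival 1 (\<lambda>x. Z x - k) a b = 0"
    proof (cases "a = b")
      case False
      then have "a < b" using ab by simp
      obtain a' b' where ab': "a' \<longlonglongrightarrow> a" "b' \<longlonglongrightarrow> b" "\<And>n. a < a' n" "\<And>n. a' n \<le> b' n" "\<And>n. b' n < b"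
        using interval_exhaustion[OF \<open>a < b\<close>] by metis
      have "(\<lambda>n. ival 1 (\<lambda>x. Z x - k) (a' n) (b' n)) \<longlonglongrightarrow> ival 1 (\<lambda>x. Z x - k) a b"
        by (intro ival_tendsto Zki ab')
      moreover have "ival 1 (\<lambda>x. Z x - k) (a' n) (b' n) = 0" for n
      proof -
        have "0 < a' n" "b' n < 1" using ab'(3-5)[of n] ab by auto
        then show ?thesis
          using inner[of "a' n" "b' n"] ival_const[of "a' n" "b' n" 1 k] ab'(4)[of n] Zi by (subst ival_diff) auto
      qed
      ultimately show ?thesis by (simp add: LIMSEQ_const_iff)
    qed simp
  qed simp
  then show ?thesis
    by (intro exI[of _ k]) (auto simp: Z_def elim!: eventually_mono)
qed

section \<open>The energy inequality\<close>

lemma ival_measurable_param [measurable (raw)]: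
  assumes [measurable]: "(\<lambda>(p, s). f p s) \<in> borel_measurable (M \<Otimes>\<^sub>M borel)"
    "a \<in> borel_measurable M" "b \<in> borel_measurable M"
  shows "(\<lambda>p. ival T (f p) (a p) (b p)) \<in> borel_measurable M"
proof -
  have "(\<lambda>p. \<integral>r. indicator {a p<..b p} r * f p r \<partial>ivl T) = (\<lambda>p. \<integral>r. (if a p < r \<and> r \<le> b p then f p r else 0) \<partial>ivl T)"
    by (intro ext Bochner_Integration.integral_cong) auto
  then show ?thesis
    unfolding ival_def by simp
qed

abbreviation ivl2 :: "real \<Rightarrow> (real \<times> real) measure" where
  "ivl2 T \<equiv> ivl 1 \<Otimes>\<^sub>M ivl T"

lemma finite_measure_ivl2: "finite_measure (ivl2 T)"
  by (intro finite_measure_pair_measure finite_measure_ivl)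

interpretation ivl2f: finite_measure "ivl2 T" for T
  by (rule finite_measure_ivl2)

lemma AE_ivl2_fst:
  assumes "AE x in ivl S. R x"
  shows "AE p in ivl S \<Otimes>\<^sub>M ivl T. R (fst p)"
proof -
  obtain N where N: "{t \<in> space (ivl S). \<not> R t} \<subseteq> N" "N \<in> sets (ivl S)" "emeasure (ivl S) N = 0"
    using assms by (elim AE_E) auto
  show ?thesis
  proof (rule AE_I[of _ _ "N \<times> UNIV"])
    show "emeasure (ivl S \<Otimes>\<^sub>M ivl T) (N \<times> UNIV) = 0"
      using N sets.top[of "ivl T"] by (simp add: ivl.emeasure_pair_measure_Times del: sets.top)
    show "N \<times> UNIV \<in> sets (ivl S \<Otimes>\<^sub>M ivl T)" using N sets.top[of "ivl T"] by (auto intro!: pair_measureI)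
  qed (use N in auto)
qed

lemma ival_square_le:
  assumes "sq_int (ivl T) f" "0 \<le> T"
  shows "(ival T f a b)\<^sup>2 \<le> T * (\<integral>x. (f x)\<^sup>2 \<partial>ivl T)"
proof -
  have s: "sq_int (ivl T) (\<lambda>x. indicator {a<..b} x * f x)" using assms by (intro sq_int_ind) auto
  have "(ival T f a b)\<^sup>2 \<le> T * (\<integral>x. (indicator {a<..b} x * f x)\<^sup>2 \<partial>ivl T)"
    unfolding ival_def using ivl.square_integral_le[OF s] measure_ivl_UNIV[OF \<open>0 \<le> T\<close>] by simp
  also have "(\<integral>x. (indicator {a<..b} x * f x)\<^sup>2 \<partial>ivl T) \<le> (\<integral>x. (f x)\<^sup>2 \<partial>ivl T)"
    using s assms by (intro integral_mono) (auto simp: sq_int_def indicator_def)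
  finally show ?thesis using \<open>0 \<le> T\<close> by (simp add: mult_left_mono)
qed

lemma ivl2_swap:
  assumes f: "integrable (ivl2 T) (case_prod f)"
  shows "integrable (ivl 1) (\<lambda>x. ival T (f x) a b)"
    and "(\<integral>x. ival T (f x) a b \<partial>ivl 1) = ival T (\<lambda>t. \<integral>x. f x t \<partial>ivl 1) a b"
    and "integrable (ivl T) (\<lambda>t. \<integral>x. f x t \<partial>ivl 1)"
    and "AE t in ivl T. integrable (ivl 1) (\<lambda>x. f x t)"
proof -
  define g where "g x t = indicator {a<..b} t * f x t" for x t
  have [measurable]: "case_prod f \<in> borel_measurable (ivl2 T)" using f by auto
  have g: "integrable (ivl2 T) (case_prod g)"
  proof (rule Bochner_Integration.integrable_bound[OF f])
    show "case_prod g \<in> borel_measurable (ivl2 T)" unfolding g_def by measurable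
  qed (auto simp: g_def indicator_def)
  have eq: "ival T (f x) a b = (\<integral>t. g x t \<partial>ivl T)" for x by (simp add: ival_def g_def)
  show "integrable (ivl 1) (\<lambda>x. ival T (f x) a b)" unfolding eq by (rule ivl2.integrable_fst[OF g])
  show "(\<integral>x. ival T (f x) a b \<partial>ivl 1) = ival T (\<lambda>t. \<integral>x. f x t \<partial>ivl 1) a b"
    unfolding eq ivl2.Fubini_integral[OF g, symmetric] by (simp add: ival_def g_def)
  show "integrable (ivl T) (\<lambda>t. \<integral>x. f x t \<partial>ivl 1)" by (rule ivl2.integrable_snd[OF f])
  show "AE t in ivl T. integrable (ivl 1) (\<lambda>x. f x t)" by (rule ivl2.AE_integrable_snd[OF f])
qed

lemma sq_int_ival_slice:
  assumes f: "sq_int (ivl2 T) (case_prod f)" "\<And>x. sq_int (ivl T) (f x)" and "0 \<le> T"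
    and fm: "case_prod f \<in> borel_measurable (borel \<Otimes>\<^sub>M borel)"
  shows "sq_int (ivl 1) (\<lambda>x. ival T (f x) a b)"
  unfolding sq_int_def
proof
  note [measurable (raw)] = measurable_compose[OF measurable_Pair fm, simplified]
  show m: "(\<lambda>x. ival T (f x) a b) \<in> borel_measurable (ivl 1)" by measurable
  show "integrable (ivl 1) (\<lambda>x. (ival T (f x) a b)\<^sup>2)"
  proof (rule Bochner_Integration.integrable_bound)
    have "integrable (ivl 1) (\<lambda>x. \<integral>t. (f x t)\<^sup>2 \<partial>ivl T)"
      using f(1) by (intro ivl2.integrable_fst) (simp add: sq_int_def case_prod_unfold)
    then show "integrable (ivl 1) (\<lambda>x. T * (\<integral>t. (f x t)\<^sup>2 \<partial>ivl T))" by simp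
    show "AE x in ivl 1. norm ((ival T (f x) a b)\<^sup>2) \<le> norm (T * (\<integral>t. (f x t)\<^sup>2 \<partial>ivl T))"
      using ival_square_le[OF f(2) \<open>0 \<le> T\<close>] by (auto intro!: AE_I2 order_trans[OF _ abs_ge_self])
  qed (use m in measurable)
qed

lemma sq_int_ivl2_ival:
  assumes f: "sq_int (ivl2 T) (case_prod f)" "\<And>x. sq_int (ivl T) (f x)" and "0 \<le> T"
    and fm: "case_prod f \<in> borel_measurable (borel \<Otimes>\<^sub>M borel)"
    and [measurable]: "a \<in> borel_measurable borel" "b \<in> borel_measurable borel"
  shows "sq_int (ivl2 T) (\<lambda>(x, t). ival T (f x) (a t) (b t))"
  unfolding sq_int_def
proof
  note [measurable] = fm measurable_compose[OF measurable_Pair fm, measurable (raw)]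
  show m: "(\<lambda>(x, t). ival T (f x) (a t) (b t)) \<in> borel_measurable (ivl2 T)"
    by measurable
  show "integrable (ivl2 T) (\<lambda>p. (case p of (x, t) \<Rightarrow> ival T (f x) (a t) (b t))\<^sup>2)"
  proof (rule Bochner_Integration.integrable_bound)
    have "integrable (ivl 1) (\<lambda>x. \<integral>t. (f x t)\<^sup>2 \<partial>ivl T)"
      using f(1) by (intro ivl2.integrable_fst) (simp add: sq_int_def case_prod_unfold)
    then show "integrable (ivl2 T) (\<lambda>(x, t). T * (\<integral>t. (f x t)\<^sup>2 \<partial>ivl T))"
      by (intro integrable_pair_fst) auto
    show "AE p in ivl2 T. norm ((case p of (x, t) \<Rightarrow> ival T (f x) (a t) (b t))\<^sup>2)
        \<le> norm (case p of (x, t) \<Rightarrow> T * (\<integral>t. (f x t)\<^sup>2 \<partial>ivl T))"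
      using ival_square_le[OF f(2) \<open>0 \<le> T\<close>] by (auto intro!: AE_I2 order_trans[OF _ abs_ge_self])
  qed (use m in measurable)
qed

text \<open>\<open>Q\<close> stands for \<open>(b\<^sub>0 \<tau>\<^sub>0)\<^sup>2 / 2\<close>, so that \<open>Q / \<tau>\<^sup>2\<close> is the magnetic pressure \<open>b\<^sup>2 / 2\<close>. All functions are
  Borel representatives, modified on null sets so that their bounds hold everywhere.\<close>

locale mhd_data =
  fixes A \<gamma> \<mu> :: real and \<tau>0 u0 Q \<tau>s :: "real \<Rightarrow> real" and a a' m s1 s2 C0 :: real
  assumes A: "0 < A" and \<gamma>: "1 < \<gamma>" and \<mu>: "0 < \<mu>"
    and \<tau>0_m [measurable]: "\<tau>0 \<in> borel_measurable borel"
    and Q_m [measurable]: "Q \<in> borel_measurable borel"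
    and \<tau>s_m [measurable]: "\<tau>s \<in> borel_measurable borel"
    and a: "0 < a" "\<And>x. a \<le> \<tau>0 x" "\<And>x. \<tau>0 x \<le> a'"
    and Q: "\<And>x. 0 \<le> Q x" "\<And>x. Q x \<le> m"
    and u0: "sq_int (ivl 1) u0"
    and \<tau>0_mass: "(\<integral>x. \<tau>0 x \<partial>ivl 1) = 1"
    and s: "0 < s1" "\<And>x. s1 \<le> \<tau>s x" "\<And>x. \<tau>s x \<le> s2"
    and \<tau>s_mass: "(\<integral>x. \<tau>s x \<partial>ivl 1) = 1"
    and stationary: "AE x in ivl 1. A * \<tau>s x powr (- \<gamma>) + Q x / (\<tau>s x)\<^sup>2 = C0"
begin

definition P :: "real \<Rightarrow> real \<Rightarrow> real" where
  "P x y = A * y powr (- \<gamma>) + Q x / y\<^sup>2"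

text \<open>The internal energy, an antiderivative of \<open>- P x\<close>.\<close>

definition \<Phi> :: "real \<Rightarrow> real \<Rightarrow> real" where
  "\<Phi> x y = A / (\<gamma> - 1) * y powr (1 - \<gamma>) + Q x / y"

lemma P_measurable [measurable (raw)]:
  assumes [measurable]: "f \<in> borel_measurable M" "g \<in> borel_measurable M"
  shows "(\<lambda>x. P (f x) (g x)) \<in> borel_measurable M"
proof -
  have [measurable]: "(\<lambda>x. Q (f x)) \<in> borel_measurable M" by (rule measurable_compose[OF assms(1) Q_m])
  show ?thesis unfolding P_def by measurable
qed

lemma \<Phi>_measurable [measurable (raw)]:
  assumes [measurable]: "f \<in> borel_measurable M" "g \<in> borel_measurable M"
  shows "(\<lambda>x. \<Phi> (f x) (g x)) \<in> borel_measurable M"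
proof -
  have [measurable]: "(\<lambda>x. Q (f x)) \<in> borel_measurable M" by (rule measurable_compose[OF assms(1) Q_m])
  show ?thesis unfolding \<Phi>_def by measurable
qed

lemma m_nonneg: "0 \<le> m" using Q[of 0] by linarith

lemma P_antimono:
  assumes "0 < y" "y \<le> z"
  shows "P x z \<le> P x y"
  unfolding P_def
proof (rule add_mono)
  show "A * z powr - \<gamma> \<le> A * y powr - \<gamma>"
    using A \<gamma> assms by (intro mult_left_mono powr_mono2') auto
  show "Q x / z\<^sup>2 \<le> Q x / y\<^sup>2"
    using Q(1)[of x] assms by (intro divide_left_mono power_mono) auto
qed

lemma P_pos: "0 < y \<Longrightarrow> 0 < P x y"
  unfolding P_def using A Q(1)[of x] by (intro add_pos_nonneg) auto

lemma P_le: "\<lbrakk>0 < c; c \<le> y\<rbrakk> \<Longrightarrow> P x y \<le> A * c powr (- \<gamma>) + m / c\<^sup>2"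
  using P_antimono[of c y x] divide_right_mono[OF Q(2)[of x], of "c\<^sup>2"] by (simp add: P_def)

lemma \<Phi>_nonneg: "0 < y \<Longrightarrow> 0 \<le> \<Phi> x y"
  unfolding \<Phi>_def using A \<gamma> Q(1)[of x] by (intro add_nonneg_nonneg) auto

lemma \<Phi>_le:
  assumes "0 < c" "c \<le> y"
  shows "\<Phi> x y \<le> A / (\<gamma> - 1) * c powr (1 - \<gamma>) + m / c"
proof -
  have "\<Phi> x y \<le> A / (\<gamma> - 1) * c powr (1 - \<gamma>) + Q x / c"
    unfolding \<Phi>_def
  proof (rule add_mono)
    show "A / (\<gamma> - 1) * y powr (1 - \<gamma>) \<le> A / (\<gamma> - 1) * c powr (1 - \<gamma>)"
      using A \<gamma> assms by (intro mult_left_mono powr_mono2') auto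
    show "Q x / y \<le> Q x / c" using Q(1)[of x] assms by (intro divide_left_mono) auto
  qed
  then show ?thesis using divide_right_mono[OF Q(2)[of x], of c] assms by simp
qed

lemma \<Phi>_deriv:
  assumes "0 < y"
  shows "(\<Phi> x has_real_derivative - P x y) (at y)"
proof -
  have "((\<lambda>y. A / (\<gamma> - 1) * y powr (1 - \<gamma>)) has_real_derivative
      A / (\<gamma> - 1) * ((1 - \<gamma>) * y powr (1 - \<gamma> - 1))) (at y)"
    using assms by (intro DERIV_cmult has_real_derivative_powr)
  moreover have "A / (\<gamma> - 1) * ((1 - \<gamma>) * y powr (1 - \<gamma> - 1)) = - (A * y powr (- \<gamma>))"
    using \<gamma> by (simp add: divide_simps) (simp add: algebra_simps)
  moreover have "((\<lambda>y. Q x / y) has_real_derivative - (Q x / y\<^sup>2)) (at y)"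
    using assms by (auto intro!: derivative_eq_intros simp: power2_eq_square)
  ultimately have "((\<lambda>y. A / (\<gamma> - 1) * y powr (1 - \<gamma>) + Q x / y) has_real_derivative
      - (A * y powr (- \<gamma>)) + - (Q x / y\<^sup>2)) (at y)"
    by (intro DERIV_add) simp_all
  then show ?thesis by (simp add: \<Phi>_def[abs_def] P_def)
qed

lemma P_continuous_on: "0 < c \<Longrightarrow> continuous_on {c..d} (P x)"
  unfolding P_def[abs_def] by (auto intro!: continuous_intros)

lemma u0_i: "integrable (ivl 1) u0" by (rule ivl.sq_int_integrable[OF u0])

definition U0 :: "real \<Rightarrow> real" where "U0 x = ival 1 u0 0 x"

lemma U0_m [measurable]: "U0 \<in> borel_measurable borel"
  unfolding U0_def[abs_def] using ival_continuous[OF u0_i, of UNIV 0] by (rule borel_measurable_continuous_onI)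

lemma U0_s: "sq_int (ivl 1) U0"
  unfolding U0_def[abs_def] using ival_continuous[OF u0_i, of UNIV 0]
  by (intro integrable_continuous_interval ival_continuous u0_i borel_measurable_continuous_onI)

lemma \<tau>0_s: "sq_int (ivl 1) \<tau>0"
proof (rule ivl.sq_int_bounded[of _ _ a'])
  show "AE x in ivl 1. \<bar>\<tau>0 x\<bar> \<le> a'"
  proof (intro AE_I2)
    fix x show "\<bar>\<tau>0 x\<bar> \<le> a'" using a(1) a(2)[of x] a(3)[of x] by simp
  qed
qed simp

lemma \<tau>s_s: "sq_int (ivl 1) \<tau>s"
proof (rule ivl.sq_int_bounded[of _ _ s2])
  show "AE x in ivl 1. \<bar>\<tau>s x\<bar> \<le> s2"
  proof (intro AE_I2)
    fix x show "\<bar>\<tau>s x\<bar> \<le> s2" using s(1) s(2)[of x] s(3)[of x] by simp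
  qed
qed simp

end

locale mhd_flow = mhd_data +
  fixes T :: real and v :: "real \<Rightarrow> real \<Rightarrow> real" and c C :: real
  assumes T: "0 < T"
    and v_meas: "case_prod v \<in> borel_measurable (borel \<Otimes>\<^sub>M borel)"
    and v_s: "sq_int (ivl2 T) (case_prod v)" "\<And>x. sq_int (ivl T) (v x)"
    and c: "0 < c" "\<And>x t. \<lbrakk>0 \<le> t; t \<le> T\<rbrakk> \<Longrightarrow> c \<le> \<tau>0 x + ival T (v x) 0 t"
      "\<And>x t. \<lbrakk>0 \<le> t; t \<le> T\<rbrakk> \<Longrightarrow> \<tau>0 x + ival T (v x) 0 t \<le> C"
begin

lemma v_measurable [measurable (raw)]:
  assumes [measurable]: "f \<in> borel_measurable M" "g \<in> borel_measurable M"
  shows "(\<lambda>x. v (f x) (g x)) \<in> borel_measurable M"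
  using measurable_compose[OF measurable_Pair v_meas, OF assms] by simp

definition th :: "real \<Rightarrow> real \<Rightarrow> real" where "th x t = \<tau>0 x + ival T (v x) 0 t"
definition \<sigma> :: "real \<Rightarrow> real \<Rightarrow> real" where "\<sigma> x t = \<mu> * v x t / th x t - P x (th x t)"
definition S :: "real \<Rightarrow> real \<Rightarrow> real" where "S x t = U0 x + ival T (\<sigma> x) 0 t"

lemma th_measurable [measurable (raw)]:
  assumes [measurable]: "f \<in> borel_measurable M" "g \<in> borel_measurable M"
  shows "(\<lambda>x. th (f x) (g x)) \<in> borel_measurable M"
proof -
  have [measurable]: "(\<lambda>x. \<tau>0 (f x)) \<in> borel_measurable M" by (rule measurable_compose[OF assms(1) \<tau>0_m])
  show ?thesis unfolding th_def by measurable
qed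

lemma \<sigma>_measurable [measurable (raw)]:
  assumes [measurable]: "f \<in> borel_measurable M" "g \<in> borel_measurable M"
  shows "(\<lambda>x. \<sigma> (f x) (g x)) \<in> borel_measurable M"
  unfolding \<sigma>_def by measurable

lemma S_measurable [measurable (raw)]:
  assumes [measurable]: "f \<in> borel_measurable M" "g \<in> borel_measurable M"
  shows "(\<lambda>x. S (f x) (g x)) \<in> borel_measurable M"
proof -
  have [measurable]: "(\<lambda>x. U0 (f x)) \<in> borel_measurable M" by (rule measurable_compose[OF assms(1) U0_m])
  show ?thesis unfolding S_def by measurable
qed

lemma v_i: "integrable (ivl T) (v x)" by (rule ivl.sq_int_integrable[OF v_s(2)])

lemma th_diff: "\<lbrakk>0 \<le> r; r \<le> t\<rbrakk> \<Longrightarrow> th x t - th x r = ival T (v x) r t"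
  unfolding th_def using ival_combine[OF v_i, of 0 r t x] by simp

lemma th_0 [simp]: "th x 0 = \<tau>0 x" by (simp add: th_def)

lemma th_le: "c \<le> th x t" "th x t \<le> C"
proof -
  consider "t < 0" | "0 \<le> t" "t \<le> T" | "T < t" by linarith
  then have "c \<le> th x t \<and> th x t \<le> C"
  proof cases
    case 1
    then have "th x t = \<tau>0 x + ival T (v x) 0 0" by (simp add: th_def ival_def)
    then show ?thesis using c(2)[of 0 x] c(3)[of 0 x] T by auto
  next
    case 3
    then have "ival T (v x) 0 t = ival T (v x) 0 T"
      using T v_i[of x] by (simp add: ival_all)
    then show ?thesis using c(2)[of T x] c(3)[of T x] T by (auto simp: th_def)
  qed (use c in \<open>auto simp: th_def\<close>)
  then show "c \<le> th x t" "th x t \<le> C" by auto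
qed

lemma th_pos: "0 < th x t" using th_le(1)[of x t] c(1) by simp

lemma th_continuous: "continuous_on X (th x)"
  unfolding th_def[abs_def] by (intro continuous_intros ival_continuous v_i)

lemma P_th: "0 \<le> P x (th x t)" "P x (th x t) \<le> A * c powr (- \<gamma>) + m / c\<^sup>2"
  using P_pos[OF th_pos, of x x t] P_le[OF c(1) th_le(1), of x x t] by auto

lemma P_s: "sq_int (ivl2 T) (\<lambda>(x, t). P x (th x t))" "sq_int (ivl T) (\<lambda>t. P x (th x t))"
    "sq_int (ivl 1) (\<lambda>x. P x (th x t))"
proof -
  show "sq_int (ivl2 T) (\<lambda>(x, t). P x (th x t))"
  proof (rule ivl2f.sq_int_bounded)
    show "AE p in ivl2 T. \<bar>case p of (x, t) \<Rightarrow> P x (th x t)\<bar> \<le> A * c powr (- \<gamma>) + m / c\<^sup>2"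
      using P_th by (auto intro!: AE_I2)
  qed measurable
  show "sq_int (ivl T) (\<lambda>t. P x (th x t))"
    using P_th by (intro ivl.sq_int_bounded[where C = "A * c powr (- \<gamma>) + m / c\<^sup>2"] AE_I2) auto
  show "sq_int (ivl 1) (\<lambda>x. P x (th x t))"
    using P_th by (intro ivl.sq_int_bounded[where C = "A * c powr (- \<gamma>) + m / c\<^sup>2"] AE_I2) auto
qed

lemma th_s: "sq_int (ivl2 T) (\<lambda>(x, t). th x t)" "sq_int (ivl 1) (\<lambda>x. th x t)"
proof -
  have b: "\<bar>th x t\<bar> \<le> C" for x t using th_pos[of x t] th_le(2)[of x t] by simp
  show "sq_int (ivl2 T) (\<lambda>(x, t). th x t)"
    using b by (intro ivl2f.sq_int_bounded[where C = C] AE_I2) auto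
  show "sq_int (ivl 1) (\<lambda>x. th x t)"
    using b by (intro ivl.sq_int_bounded[where C = C] AE_I2) auto
qed

lemma inv_th: "\<bar>1 / th x t\<bar> \<le> 1 / c"
  using th_le(1)[of x t] c(1) by (simp add: frac_le)

lemma v_th_s: "sq_int (ivl2 T) (\<lambda>(x, t). v x t / th x t)" "sq_int (ivl T) (\<lambda>t. v x t / th x t)"
proof -
  have "sq_int (ivl2 T) (\<lambda>p. (1 / th (fst p) (snd p)) * case_prod v p)"
    by (intro sq_int_bounded_mult[where C = "1/c"] v_s AE_I2 inv_th) measurable
  then show "sq_int (ivl2 T) (\<lambda>(x, t). v x t / th x t)" by (simp add: case_prod_unfold)
  have "sq_int (ivl T) (\<lambda>t. (1 / th x t) * v x t)"
    by (intro sq_int_bounded_mult[where C = "1/c"] v_s AE_I2 inv_th) measurable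
  then show "sq_int (ivl T) (\<lambda>t. v x t / th x t)" by simp
qed

lemma \<sigma>_s: "sq_int (ivl2 T) (case_prod \<sigma>)" "sq_int (ivl T) (\<sigma> x)"
proof -
  have "sq_int (ivl2 T) (\<lambda>p. \<mu> * (case p of (x, t) \<Rightarrow> v x t / th x t) - (case p of (x, t) \<Rightarrow> P x (th x t)))"
    by (intro sq_int_diff sq_int_cmult v_th_s P_s)
  then show "sq_int (ivl2 T) (case_prod \<sigma>)" by (simp add: \<sigma>_def case_prod_unfold)
  have "sq_int (ivl T) (\<lambda>t. \<mu> * (v x t / th x t) - P x (th x t))"
    by (intro sq_int_diff sq_int_cmult v_th_s P_s)
  then show "sq_int (ivl T) (\<sigma> x)" by (simp add: \<sigma>_def[abs_def])
qed

lemma \<sigma>_i: "integrable (ivl T) (\<sigma> x)" by (rule ivl.sq_int_integrable[OF \<sigma>_s(2)])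

lemma \<sigma>_meas: "case_prod \<sigma> \<in> borel_measurable (borel \<Otimes>\<^sub>M borel)" by measurable

lemma S_diff: "\<lbrakk>0 \<le> r; r \<le> t\<rbrakk> \<Longrightarrow> S x t - S x r = ival T (\<sigma> x) r t"
  unfolding S_def using ival_combine[OF \<sigma>_i, of 0 r t x] by simp

lemma S_s: "sq_int (ivl2 T) (case_prod S)"
proof -
  have U: "sq_int (ivl2 T) (\<lambda>(x, t). U0 x)"
    using U0_s integrable_pair_fst[of 1 "\<lambda>x. (U0 x)\<^sup>2" T] unfolding sq_int_def by (auto simp: case_prod_unfold)
  have I: "sq_int (ivl2 T) (\<lambda>(x, t). ival T (\<sigma> x) 0 t)"
    using T \<sigma>_meas by (intro sq_int_ivl2_ival \<sigma>_s) auto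
  show ?thesis using sq_int_add[OF U I] by (simp add: S_def case_prod_unfold)
qed

lemma sq_int_ivl2_slice:
  assumes "sq_int (ivl2 T) (case_prod f)" "case_prod f \<in> borel_measurable (borel \<Otimes>\<^sub>M borel)"
  shows "AE t in ivl T. sq_int (ivl 1) (\<lambda>x. f x t)"
proof -
  note [measurable] = measurable_compose[OF measurable_Pair assms(2), measurable (raw)]
  have "AE t in ivl T. integrable (ivl 1) (\<lambda>x. (f x t)\<^sup>2)"
    using assms(1) by (intro ivl2.AE_integrable_snd) (simp add: sq_int_def case_prod_unfold)
  moreover have "(\<lambda>x. f x t) \<in> borel_measurable borel" for t
    using measurable_compose[OF measurable_Pair assms(2), of "\<lambda>x. x" borel "\<lambda>_. t"] by simp
  ultimately show ?thesis by (auto simp: sq_int_def)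
qed

lemma slices: "AE t in ivl T. sq_int (ivl 1) (\<lambda>x. v x t)" "AE t in ivl T. sq_int (ivl 1) (\<lambda>x. \<sigma> x t)"
    "AE t in ivl T. sq_int (ivl 1) (\<lambda>x. S x t)"
proof -
  have "case_prod S \<in> borel_measurable (borel \<Otimes>\<^sub>M borel)" by measurable
  then show "AE t in ivl T. sq_int (ivl 1) (\<lambda>x. v x t)" "AE t in ivl T. sq_int (ivl 1) (\<lambda>x. \<sigma> x t)"
    "AE t in ivl T. sq_int (ivl 1) (\<lambda>x. S x t)"
    by (intro sq_int_ivl2_slice v_s v_meas \<sigma>_s \<sigma>_meas S_s; simp)+
qed

lemma prod_i:
  assumes "sq_int (ivl2 T) (case_prod f)" "sq_int (ivl2 T) (case_prod g)"
  shows "integrable (ivl2 T) (\<lambda>(x, t). f x t * g x t)"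
  using sq_int_mult[OF assms] by (simp add: case_prod_unfold)

end

text \<open>\<open>v\<close> is \<open>u\<^sub>x\<close>, \<open>th\<close> is the specific volume, and \<open>w\<close> is the velocity as a continuous curve in \<open>L\<^sup>2\<close>. The
  assumption \<open>S_w\<close> is the momentum equation integrated in time and space: \<open>S\<close> is the primitive of
  \<open>w t\<close> up to a function of time.\<close>

locale mhd_sol = mhd_flow +
  fixes w :: "real \<Rightarrow> real \<Rightarrow> real"
  assumes v_mean: "AE t in ivl T. (\<integral>x. v x t \<partial>ivl 1) = 0"
    and w_s: "\<And>t. \<lbrakk>0 \<le> t; t < T\<rbrakk> \<Longrightarrow> sq_int (ivl 1) (w t)"
    and w_cont: "continuous_on {0..<T} (\<lambda>t. \<integral>x. (w t x)\<^sup>2 \<partial>ivl 1)"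
    and w_0: "AE x in ivl 1. w 0 x = u0 x"
    and w_v: "AE t in ivl T. AE x in ivl 1. w t x = ival 1 (\<lambda>y. v y t) 0 x"
    and S_w: "\<And>t. \<lbrakk>0 \<le> t; t < T\<rbrakk> \<Longrightarrow> \<exists>h. AE x in ivl 1. S x t = ival 1 (w t) 0 x + h"
begin

definition e :: "real \<Rightarrow> real" where "e t = (\<integral>x. (w t x)\<^sup>2 \<partial>ivl 1)"

lemma mass: "\<lbrakk>0 \<le> t; t < T\<rbrakk> \<Longrightarrow> (\<integral>x. th x t \<partial>ivl 1) = 1"
proof -
  have v: "integrable (ivl2 T) (case_prod v)" by (rule ivl2f.sq_int_integrable[OF v_s(1)])
  have "(\<integral>x. th x t \<partial>ivl 1) = (\<integral>x. \<tau>0 x \<partial>ivl 1) + (\<integral>x. ival T (v x) 0 t \<partial>ivl 1)"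
    unfolding th_def using ivl2_swap(1)[OF v] ivl.sq_int_integrable[OF \<tau>0_s] by simp
  also have "(\<integral>x. ival T (v x) 0 t \<partial>ivl 1) = ival T (\<lambda>t. \<integral>x. v x t \<partial>ivl 1) 0 t"
    by (rule ivl2_swap(2)[OF v])
  also have "\<dots> = ival T (\<lambda>t. 0) 0 t"
    using ivl2_swap(3)[OF v] v_mean by (intro ival_cong_AE) auto
  finally show ?thesis by (simp add: \<tau>0_mass ival_def)
qed

lemma w_parts:
  assumes r: "0 < r" "r < T" and sv: "sq_int (ivl 1) (\<lambda>x. v x r)" and vm: "(\<integral>x. v x r \<partial>ivl 1) = 0"
    and wv: "AE x in ivl 1. w r x = ival 1 (\<lambda>y. v y r) 0 x" and d: "sq_int (ivl 1) d"
  shows "(\<integral>x. (ival 1 d 0 x + k) * v x r \<partial>ivl 1) = - (\<integral>x. d x * w r x \<partial>ivl 1)"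
proof -
  have di: "integrable (ivl 1) d" by (rule ivl.sq_int_integrable[OF d])
  have dm [measurable]: "d \<in> borel_measurable borel" "w r \<in> borel_measurable borel" using di w_s[of r] r by (auto simp: sq_int_def)
  have "sq_int (ivl 1) (ival 1 d 0)"
    by (intro integrable_continuous_interval ival_continuous[OF di] borel_measurable_continuous_onI)
  then have i: "integrable (ivl 1) (\<lambda>x. ival 1 d 0 x * v x r)" by (intro sq_int_mult sv)
  have vi: "integrable (ivl 1) (\<lambda>x. v x r)" by (rule ivl.sq_int_integrable[OF sv])
  have "(\<integral>x. (ival 1 d 0 x + k) * v x r \<partial>ivl 1) = (\<integral>x. ival 1 d 0 x * v x r \<partial>ivl 1)"
    using i vi vm by (simp add: distrib_right)
  also have "\<dots> = - (\<integral>x. d x * ival 1 (\<lambda>x. v x r) 0 x \<partial>ivl 1)"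
    by (rule integral_by_parts[OF di vi vm])
  also have "(\<integral>x. d x * ival 1 (\<lambda>x. v x r) 0 x \<partial>ivl 1) = (\<integral>x. d x * w r x \<partial>ivl 1)"
    using wv by (intro integral_cong_AE) auto
  finally show ?thesis .
qed

lemma w_increment:
  assumes r: "0 < r" "r < T" "0 < h"
    and sv: "sq_int (ivl 1) (\<lambda>x. v x r)" and vm: "(\<integral>x. v x r \<partial>ivl 1) = 0"
    and wv: "AE x in ivl 1. w r x = ival 1 (\<lambda>y. v y r) 0 x"
  shows "e r - e (max 0 (r - h)) \<le> - 2 * (\<integral>x. ival T (\<sigma> x) (r - h) r * v x r \<partial>ivl 1)"
proof -
  define r' where "r' = max 0 (r - h)"
  have r': "0 \<le> r'" "r' < T" "r' \<le> r" using r by (auto simp: r'_def)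
  note ws = w_s[of r] w_s[of r']
  have ws': "sq_int (ivl 1) (w r)" "sq_int (ivl 1) (w r')" using ws r r' by auto
  have wi: "integrable (ivl 1) (w r)" "integrable (ivl 1) (w r')" using ws' by (auto intro: ivl.sq_int_integrable)
  have d: "sq_int (ivl 1) (\<lambda>x. w r x - w r' x)" by (intro sq_int_diff ws')
  obtain h1 where h1: "AE x in ivl 1. S x r = ival 1 (w r) 0 x + h1" using S_w[of r] r by auto
  obtain h2 where h2: "AE x in ivl 1. S x r' = ival 1 (w r') 0 x + h2" using S_w[of r'] r' by auto
  have win: "ival T (\<sigma> x) (r - h) r = S x r - S x r'" for x
  proof (cases "0 \<le> r - h")
    case True
    then show ?thesis using S_diff[of "r - h" r x] r by (simp add: r'_def)
  next
    case False
    have "ival T (\<sigma> x) (r - h) r = ival T (\<sigma> x) (r - h) 0 + ival T (\<sigma> x) 0 r"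
      using False r by (intro ival_combine \<sigma>_i) auto
    moreover have "ival T (\<sigma> x) (r - h) 0 = ival T (\<lambda>_. 0) (r - h) 0"
      using \<sigma>_i by (intro ival_cong_AE eventually_mono[OF AE_ivl_mem]) auto
    ultimately show ?thesis using False S_diff[of 0 r x] r by (simp add: r'_def ival_def)
  qed
  have "e r - e r' = (\<integral>x. (w r x)\<^sup>2 - (w r' x)\<^sup>2 \<partial>ivl 1)"
    unfolding e_def using ws' by (simp add: sq_int_def)
  also have "\<dots> \<le> (\<integral>x. 2 * ((w r x - w r' x) * w r x) \<partial>ivl 1)"
  proof (rule integral_mono)
    fix x
    have "0 \<le> (w r x - w r' x)\<^sup>2" by simp
    then show "(w r x)\<^sup>2 - (w r' x)\<^sup>2 \<le> 2 * ((w r x - w r' x) * w r x)"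
      by (simp add: power2_eq_square algebra_simps)
  qed (use ws' sq_int_mult[OF d ws'(1)] in \<open>auto simp: sq_int_def\<close>)
  also have "\<dots> = - 2 * (\<integral>x. (ival 1 (\<lambda>x. w r x - w r' x) 0 x + (h1 - h2)) * v x r \<partial>ivl 1)"
    using w_parts[OF r(1,2) sv vm wv d, of "h1 - h2"] by simp
  also have "(\<integral>x. (ival 1 (\<lambda>x. w r x - w r' x) 0 x + (h1 - h2)) * v x r \<partial>ivl 1)
     = (\<integral>x. ival T (\<sigma> x) (r - h) r * v x r \<partial>ivl 1)"
  proof (rule integral_cong_AE)
    have m: "ival 1 (\<lambda>x. w r x - w r' x) 0 \<in> borel_measurable borel"
      using ival_continuous[OF ivl.sq_int_integrable[OF d], of UNIV 0] by (rule borel_measurable_continuous_onI)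
    then show "(\<lambda>x. (ival 1 (\<lambda>x. w r x - w r' x) 0 x + (h1 - h2)) * v x r) \<in> borel_measurable (ivl 1)"
      by measurable
    show "(\<lambda>x. ival T (\<sigma> x) (r - h) r * v x r) \<in> borel_measurable (ivl 1)"
      by measurable
    show "AE x in ivl 1. (ival 1 (\<lambda>x. w r x - w r' x) 0 x + (h1 - h2)) * v x r = ival T (\<sigma> x) (r - h) r * v x r"
      using h1 h2 by eventually_elim (simp add: win ival_diff[OF wi])
  qed
  finally show ?thesis by (simp add: r'_def)
qed

text \<open>Neither \<open>u\<^sub>t\<close> nor \<open>\<sigma>\<^sub>x\<close> need be a function. Instead, \<open>\<parallel>w r\<parallel>\<^sup>2 - \<parallel>w (r - h)\<parallel>\<^sup>2\<close> is at most
  \<open>2 \<langle>w r - w (r - h), w r\<rangle>\<close>, which only involves a backward Steklov average of \<open>\<sigma>\<close>.\<close>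

lemma energy_kinetic:
  assumes st: "0 \<le> s" "s \<le> t" "t < T"
  shows "e t - e s \<le> - 2 * ival T (\<lambda>r. \<integral>x. \<sigma> x r * v x r \<partial>ivl 1) s t"
proof -
  define e' where "e' r = e (max 0 (min r t))" for r
  have ec: "continuous_on UNIV e'"
    unfolding e'_def e_def by (rule continuous_on_compose2[OF w_cont]) (use st in \<open>auto intro!: continuous_intros\<close>)
  obtain Eh where Eh: "\<And>r. (Eh has_real_derivative e' r) (at r)" using antiderivative_real[OF ec] by blast
  define h where "h n = 1 / real (Suc n)" for n
  have h: "0 < h n" "h \<longlonglongrightarrow> 0" for n
    using LIMSEQ_inverse_real_of_nat unfolding h_def[abs_def] by (auto simp: inverse_eq_divide)
  have bd: "(\<lambda>n. (Eh r - Eh (r - h n)) / h n) \<longlonglongrightarrow> e' r" for r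
  proof -
    have "(\<lambda>n. (Eh (r + (- h n)) - Eh r) / (- h n)) \<longlonglongrightarrow> e' r"
    proof (rule filterlim_compose[OF Eh[of r, unfolded DERIV_def]])
      have "(\<lambda>n. - h n) \<longlonglongrightarrow> - 0" by (intro tendsto_intros h)
      then show "filterlim (\<lambda>n. - h n) (at 0) sequentially"
        by (intro filterlim_atI) (auto simp: h_def intro!: always_eventually)
    qed
    then show ?thesis by (simp add: minus_divide_right[symmetric] minus_divide_left diff_divide_distrib)
  qed
  have lhs: "(\<lambda>n. ival T (\<lambda>r. e' r - e' (r - h n)) s t / h n) \<longlonglongrightarrow> e' t - e' s"
  proof -
    have "ival T (\<lambda>r. e' r - e' (r - h n)) s t / h n = (Eh t - Eh (t - h n)) / h n - (Eh s - Eh (s - h n)) / h n" for n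
    proof -
      have c: "continuous_on UNIV (\<lambda>r. e' r - e' (r - h n))"
        by (intro continuous_intros ec continuous_on_compose2[OF ec]) auto
      have "((\<lambda>r. Eh r - Eh (1 * (r - h n))) has_real_derivative e' r - 1 * e' (1 * (r - h n))) (at r)" for r
        by (intro DERIV_diff Eh DERIV_affine)
      then have d: "((\<lambda>r. Eh r - Eh (r - h n)) has_real_derivative e' r - e' (r - h n)) (at r)" for r by simp
      have "ival T (\<lambda>r. e' r - e' (r - h n)) s t = (Eh t - Eh (t - h n)) - (Eh s - Eh (s - h n))"
        using FTC_ivl[OF d c, of s t T] st by simp
      then show ?thesis by (simp add: diff_divide_distrib)
    qed
    then show ?thesis using tendsto_diff[OF bd bd] by simp
  qed
  have kint: "integrable (ivl2 T) (\<lambda>(x, r). ival T (\<sigma> x) (r - h n) r * v x r)" for n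
    by (intro prod_i sq_int_ivl2_ival \<sigma>_s \<sigma>_meas v_s) (use T in auto)
  have rhs: "(\<lambda>n. - 2 * (\<integral>x. steklov T (\<sigma> x) (v x) s t (h n) \<partial>ivl 1)) \<longlonglongrightarrow>
     - 2 * (\<integral>x. ival T (\<lambda>r. \<sigma> x r * v x r) s t \<partial>ivl 1)"
  proof (intro tendsto_mult tendsto_const integral_dominated_convergence)
    show "integrable (ivl 1) (\<lambda>x. (\<integral>r. (\<sigma> x r)\<^sup>2 \<partial>ivl T) / (2 * 1) + 1 * (\<integral>r. (v x r)\<^sup>2 \<partial>ivl T) / 2)"
      using \<sigma>_s(1) v_s(1) ivl2.integrable_fst[of 1 T "\<lambda>x r. (\<sigma> x r)\<^sup>2"] ivl2.integrable_fst[of 1 T "\<lambda>x r. (v x r)\<^sup>2"]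
      by (simp add: sq_int_def case_prod_unfold)
    show "AE x in ivl 1. (\<lambda>n. steklov T (\<sigma> x) (v x) s t (h n)) \<longlonglongrightarrow> ival T (\<lambda>r. \<sigma> x r * v x r) s t"
      by (intro AE_I2 steklov_tendsto \<sigma>_s v_s h)
    show "AE x in ivl 1. norm (steklov T (\<sigma> x) (v x) s t (h n))
       \<le> (\<integral>r. (\<sigma> x r)\<^sup>2 \<partial>ivl T) / (2 * 1) + 1 * (\<integral>r. (v x r)\<^sup>2 \<partial>ivl T) / 2" for n
      using steklov_bound[OF \<sigma>_s(2) v_s(2) h(1), of 1] by (auto intro!: AE_I2)
  qed (unfold steklov_def, measurable)
  have "ival T (\<lambda>r. e' r - e' (r - h n)) s t / h n \<le> - 2 * (\<integral>x. steklov T (\<sigma> x) (v x) s t (h n) \<partial>ivl 1)" for n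
  proof -
    have "ival T (\<lambda>r. e' r - e' (r - h n)) s t
       \<le> ival T (\<lambda>r. - 2 * (\<integral>x. ival T (\<sigma> x) (r - h n) r * v x r \<partial>ivl 1)) s t"
    proof (rule ival_mono_AE)
      show "integrable (ivl T) (\<lambda>r. e' r - e' (r - h n))"
        by (intro bounded_continuous_integrable_ivl continuous_intros ec continuous_on_compose2[OF ec]) auto
      show "integrable (ivl T) (\<lambda>r. - 2 * (\<integral>x. ival T (\<sigma> x) (r - h n) r * v x r \<partial>ivl 1))"
        using ivl2_swap(3)[OF kint[of n]] by simp
      show "AE r in ivl T. s < r \<and> r \<le> t \<longrightarrow> e' r - e' (r - h n)
          \<le> - 2 * (\<integral>x. ival T (\<sigma> x) (r - h n) r * v x r \<partial>ivl 1)"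
        using slices(1) v_mean w_v AE_ivl_mem[of T]
      proof eventually_elim
        case (elim r)
        show ?case
        proof
          assume r: "s < r \<and> r \<le> t"
          then have "e' r = e r" "e' (r - h n) = e (max 0 (r - h n))"
            using st h(1)[of n] by (auto simp: e'_def min_def)
          then show "e' r - e' (r - h n) \<le> - 2 * (\<integral>x. ival T (\<sigma> x) (r - h n) r * v x r \<partial>ivl 1)"
            using w_increment[of r "h n"] elim h(1)[of n] by simp
        qed
      qed
    qed
    also have "\<dots> = - 2 * (\<integral>x. ival T (\<lambda>r. ival T (\<sigma> x) (r - h n) r * v x r) s t \<partial>ivl 1)"
      using ivl2_swap(2)[OF kint[of n], of s t] ival_mult[of T "- 2"] by simp
    finally have "ival T (\<lambda>r. e' r - e' (r - h n)) s t / h n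
        \<le> - 2 * (\<integral>x. ival T (\<lambda>r. ival T (\<sigma> x) (r - h n) r * v x r) s t \<partial>ivl 1) / h n"
      using h(1)[of n] by (intro divide_right_mono) auto
    then show ?thesis by (simp add: steklov_def)
  qed
  then have "e' t - e' s \<le> - 2 * (\<integral>x. ival T (\<lambda>r. \<sigma> x r * v x r) s t \<partial>ivl 1)"
    by (intro LIMSEQ_le[OF lhs rhs]) auto
  also have "(\<integral>x. ival T (\<lambda>r. \<sigma> x r * v x r) s t \<partial>ivl 1) = ival T (\<lambda>r. \<integral>x. \<sigma> x r * v x r \<partial>ivl 1) s t"
    by (rule ivl2_swap(2)[OF prod_i[OF \<sigma>_s(1) v_s(1)]])
  finally show ?thesis using st by (simp add: e'_def)
qed

lemma \<Phi>_i: "integrable (ivl 1) (\<lambda>x. \<Phi> x (th x t))"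
  using \<Phi>_nonneg[OF th_pos] \<Phi>_le[OF c(1) th_le(1)]
  by (intro ivl.integrable_const_bound[where B = "A / (\<gamma> - 1) * c powr (1 - \<gamma>) + m / c"] AE_I2) auto

lemma energy_potential:
  assumes st: "0 \<le> s" "s \<le> t" "t < T"
  shows "(\<integral>x. \<Phi> x (th x t) \<partial>ivl 1) - (\<integral>x. \<Phi> x (th x s) \<partial>ivl 1)
    = - ival T (\<lambda>r. \<integral>x. P x (th x r) * v x r \<partial>ivl 1) s t"
proof -
  have "\<Phi> x (th x t) - \<Phi> x (th x s) = ival T (\<lambda>r. - P x (th x r) * v x r) s t" for x
    by (rule ac_chain[OF v_i[of x] st(2), where lo = c and hi = C])
      (use st c(1) th_le in \<open>auto intro!: th_diff \<Phi>_deriv P_continuous_on continuous_intros\<close>)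
  then have *: "\<Phi> x (th x t) - \<Phi> x (th x s) = - ival T (\<lambda>r. P x (th x r) * v x r) s t" for x
    using ival_mult[of T "-1" "\<lambda>r. P x (th x r) * v x r" s t] by simp
  have "(\<integral>x. \<Phi> x (th x t) \<partial>ivl 1) - (\<integral>x. \<Phi> x (th x s) \<partial>ivl 1)
     = (\<integral>x. - ival T (\<lambda>r. P x (th x r) * v x r) s t \<partial>ivl 1)"
    unfolding *[symmetric] using \<Phi>_i by simp
  then show ?thesis
    using ivl2_swap(2)[OF prod_i[OF P_s(1) v_s(1)]] by simp
qed

definition diss :: "real \<Rightarrow> real" where "diss r = (\<integral>x. (v x r)\<^sup>2 / th x r \<partial>ivl 1)"

lemma diss_i: "integrable (ivl2 T) (\<lambda>(x, t). (v x t)\<^sup>2 / th x t)"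
  using prod_i[OF v_th_s(1) v_s(1)] by (simp add: power2_eq_square)

lemma diss_nonneg: "0 \<le> diss r"
  unfolding diss_def using th_pos by (intro integral_nonneg_AE AE_I2) (simp add: less_imp_le)

lemma energy:
  assumes st: "0 \<le> s" "s \<le> t" "t < T"
  shows "(e t / 2 + (\<integral>x. \<Phi> x (th x t) \<partial>ivl 1)) - (e s / 2 + (\<integral>x. \<Phi> x (th x s) \<partial>ivl 1))
    \<le> - ival T (\<lambda>r. \<mu> * diss r) s t"
proof -
  have i: "integrable (ivl2 T) (\<lambda>(x, t). \<sigma> x t * v x t)" "integrable (ivl2 T) (\<lambda>(x, t). P x (th x t) * v x t)"
    by (intro prod_i \<sigma>_s v_s P_s)+
  have "ival T (\<lambda>r. \<mu> * diss r) s t = ival T (\<lambda>r. (\<integral>x. \<sigma> x r * v x r \<partial>ivl 1) + (\<integral>x. P x (th x r) * v x r \<partial>ivl 1)) s t"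
  proof (rule ival_cong_AE)
    show "AE r in ivl T. s < r \<and> r \<le> t \<longrightarrow> \<mu> * diss r = (\<integral>x. \<sigma> x r * v x r \<partial>ivl 1) + (\<integral>x. P x (th x r) * v x r \<partial>ivl 1)"
      using ivl2_swap(4)[OF i(1)] ivl2_swap(4)[OF i(2)]
    proof eventually_elim
      case (elim r)
      have "(\<integral>x. \<sigma> x r * v x r \<partial>ivl 1) + (\<integral>x. P x (th x r) * v x r \<partial>ivl 1)
        = (\<integral>x. \<sigma> x r * v x r + P x (th x r) * v x r \<partial>ivl 1)" using elim by simp
      also have "\<dots> = (\<integral>x. \<mu> * ((v x r)\<^sup>2 / th x r) \<partial>ivl 1)"
        by (intro Bochner_Integration.integral_cong) (auto simp: \<sigma>_def power2_eq_square algebra_simps)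
      also have "\<dots> = \<mu> * diss r" unfolding diss_def by (rule integral_mult_right_zero)
      finally show ?case by simp
    qed
  qed (unfold diss_def, measurable)
  also have "\<dots> = ival T (\<lambda>r. \<integral>x. \<sigma> x r * v x r \<partial>ivl 1) s t + ival T (\<lambda>r. \<integral>x. P x (th x r) * v x r \<partial>ivl 1) s t"
    by (intro ival_add ivl2_swap(3) i)
  finally show ?thesis
    using energy_kinetic[OF st] energy_potential[OF st] by simp
qed

end

section \<open>Uniform bounds for the specific volume\<close>

lemma barrier_upper:
  fixes f :: "real \<Rightarrow> real"
  assumes f: "continuous_on {0..t} f" and "0 \<le> t" "f 0 \<le> Z"
    and step: "\<And>s. \<lbrakk>0 \<le> s; s \<le> t; \<And>r. s < r \<Longrightarrow> r \<le> t \<Longrightarrow> Z < f r\<rbrakk> \<Longrightarrow> f t \<le> f s"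
  shows "f t \<le> Z"
proof -
  define K where "K = {r \<in> {0..t}. f r \<le> Z}"
  have "closed K"
    unfolding K_def by (intro continuous_on_closed_Collect_le f continuous_intros closed_atLeastAtMost)
  then have "compact K"
    unfolding K_def compact_eq_bounded_closed by (auto intro: bounded_subset[of "{0..t}"])
  moreover have "K \<noteq> {}" using assms by (auto simp: K_def)
  ultimately obtain s where s: "s \<in> K" "\<And>r. r \<in> K \<Longrightarrow> r \<le> s"
    using compact_attains_sup by metis
  have "f t \<le> f s"
  proof (rule step)
    show "Z < f r" if "s < r" "r \<le> t" for r
      using s(2)[of r] s(1) that by (force simp: K_def)
  qed (use s in \<open>auto simp: K_def\<close>)
  then show ?thesis using s(1) by (simp add: K_def)
qed

lemma barrier_lower:
  fixes f :: "real \<Rightarrow> real"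
  assumes f: "continuous_on {0..t} f" and "0 \<le> t" "Z \<le> f 0"
    and step: "\<And>s. \<lbrakk>0 \<le> s; s \<le> t; \<And>r. s < r \<Longrightarrow> r \<le> t \<Longrightarrow> f r < Z\<rbrakk> \<Longrightarrow> f s \<le> f t"
  shows "Z \<le> f t"
  using barrier_upper[of t "\<lambda>r. - f r" "- Z"] assms by (auto intro!: continuous_intros)

lemma dense_bound:
  fixes f :: "real \<Rightarrow> real"
  assumes f: "continuous_on UNIV f" and q: "\<And>q. \<lbrakk>q \<in> \<rat>; 0 \<le> q; q < T\<rbrakk> \<Longrightarrow> \<bar>f q\<bar> \<le> K" and t: "0 \<le> t" "t < T"
  shows "\<bar>f t\<bar> \<le> K"
proof (rule ccontr)
  assume "\<not> \<bar>f t\<bar> \<le> K"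
  then have "0 < \<bar>f t\<bar> - K" by simp
  then obtain d where d: "0 < d" "\<And>s. \<bar>s - t\<bar> < d \<Longrightarrow> \<bar>f s - f t\<bar> < \<bar>f t\<bar> - K"
    using f[unfolded continuous_on_iff, rule_format, of t "\<bar>f t\<bar> - K"] by (auto simp: dist_real_def)
  obtain q where q': "q \<in> \<rat>" "t < q" "q < min (t + d) T"
    using Rats_dense_in_real[of t "min (t + d) T"] t d(1) by auto
  then have "\<bar>f q - f t\<bar> < \<bar>f t\<bar> - K" by (intro d(2)) auto
  moreover have "\<bar>f q\<bar> \<le> K" using q' t by (intro q) auto
  ultimately show False by linarith
qed

context mhd_data
begin

definition E0 :: real where "E0 = (\<integral>x. (u0 x)\<^sup>2 \<partial>ivl 1) / 2 + (\<integral>x. \<Phi> x (\<tau>0 x) \<partial>ivl 1)"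
definition K :: real where "K = 2 * (1 + 2 * E0)"
definition G :: real where "G = (\<gamma> + 2) * E0"
definition s_up :: real where "s_up = 1 + m / A"
definition s_lo :: real where "s_lo = min 1 (A / (G + 1))"
definition Z_up :: real where "Z_up = max (\<mu> * ln a') (\<mu> * ln s_up + K)"
definition Z_lo :: real where "Z_lo = min (\<mu> * ln a) (\<mu> * ln s_lo - K)"
definition hi :: real where "hi = exp ((Z_up + K) / \<mu>)"
definition lo :: real where "lo = exp ((Z_lo - K) / \<mu>)"

lemma \<Phi>\<tau>0_nonneg: "0 \<le> (\<integral>x. \<Phi> x (\<tau>0 x) \<partial>ivl 1)"
  using a \<Phi>_nonneg by (intro integral_nonneg_AE AE_I2) (meson less_le_trans)

lemma u0_E0: "(\<integral>x. (u0 x)\<^sup>2 \<partial>ivl 1) \<le> 2 * E0"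
  using \<Phi>\<tau>0_nonneg by (simp add: E0_def)

lemma E0_nonneg: "0 \<le> E0"
proof -
  have "0 \<le> (\<integral>x. (u0 x)\<^sup>2 \<partial>ivl 1)" by (intro integral_nonneg_AE) auto
  then show ?thesis using u0_E0 by linarith
qed

lemma G_nonneg: "0 \<le> G" unfolding G_def using E0_nonneg \<gamma> by auto

lemma mult_P:
  assumes "0 < y"
  shows "y * P x y = A * y powr (1 - \<gamma>) + Q x / y"
  using assms by (simp add: P_def distrib_left power2_eq_square powr_diff powr_minus field_simps)

lemma mult_P_le:
  assumes "0 < y"
  shows "y * P x y \<le> \<gamma> * \<Phi> x y"
proof -
  have "A * y powr (1 - \<gamma>) \<le> \<gamma> * (A / (\<gamma> - 1) * y powr (1 - \<gamma>))"
  proof -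
    have "A \<le> \<gamma> * (A / (\<gamma> - 1))" using A \<gamma> by (simp add: field_simps)
    then show ?thesis by (metis mult.assoc mult_right_mono powr_ge_zero)
  qed
  moreover have "Q x / y \<le> \<gamma> * (Q x / y)"
    using \<gamma> Q(1)[of x] assms mult_right_mono[of 1 \<gamma> "Q x / y"] by simp
  ultimately show ?thesis unfolding mult_P[OF assms] \<Phi>_def distrib_left by linarith
qed

text \<open>Integrated over the mass-one profile, the linear part drops out and a lower bound \<open>A\<close> remains.\<close>

lemma mult_P_ge:
  assumes "0 < y"
  shows "A * (1 + (1 - \<gamma>) * (y - 1)) \<le> y * P x y"
proof -
  have "1 + (1 - \<gamma>) * (y - 1) \<le> 1 + (1 - \<gamma>) * ln y"
    using ln_le_minus_one[OF assms] \<gamma> by (simp add: mult_left_mono_neg)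
  also have "\<dots> \<le> exp ((1 - \<gamma>) * ln y)" by (rule exp_ge_add_one_self)
  also have "\<dots> = y powr (1 - \<gamma>)" using assms by (simp add: powr_def)
  finally have "A * (1 + (1 - \<gamma>) * (y - 1)) \<le> A * y powr (1 - \<gamma>)" using A by simp
  moreover have "0 \<le> Q x / y" using Q(1)[of x] assms by simp
  ultimately show ?thesis unfolding mult_P[OF assms] by linarith
qed

lemma P_s_up:
  assumes "s_up \<le> y"
  shows "P x y \<le> A"
proof -
  have "1 \<le> s_up" using m_nonneg A by (simp add: s_up_def)
  then have y: "1 \<le> y" using assms by simp
  have "y powr (- \<gamma>) \<le> y powr (- 1)" using y \<gamma> by (intro powr_mono) auto
  then have "A * y powr (- \<gamma>) \<le> A / y" using A y by (simp add: powr_minus divide_inverse)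
  moreover have "Q x / y\<^sup>2 \<le> m / y"
  proof -
    have "Q x / y\<^sup>2 \<le> m / y\<^sup>2" using Q(2) by (intro divide_right_mono) auto
    also have "\<dots> \<le> m / y" using y m_nonneg by (intro divide_left_mono) (auto simp: power2_eq_square)
    finally show ?thesis .
  qed
  ultimately have "P x y \<le> (A + m) / y" by (simp add: P_def add_divide_distrib)
  also have "A + m \<le> A * y" using assms A by (simp add: s_up_def field_simps)
  then have "(A + m) / y \<le> A" using y by (simp add: divide_le_eq)
  finally show ?thesis .
qed

lemma s_lo_pos: "0 < s_lo" using A G_nonneg by (simp add: s_lo_def)

lemma P_s_lo:
  assumes "0 < y" "y \<le> s_lo"
  shows "G \<le> P x y"
proof -
  have y: "y \<le> 1" "y \<le> A / (G + 1)" using assms by (auto simp: s_lo_def)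
  have "G \<le> A / y"
    using y G_nonneg assms by (simp add: field_simps)
  also have "\<dots> = A * y powr (- 1)" using assms by (simp add: powr_minus divide_inverse)
  also have "\<dots> \<le> A * y powr (- \<gamma>)" using A y \<gamma> assms by (intro mult_left_mono powr_mono') auto
  also have "\<dots> \<le> P x y" using Q(1)[of x] by (simp add: P_def)
  finally show ?thesis .
qed

lemma primitive_bound:
  assumes f: "sq_int (ivl 1) f" "(\<integral>x. (f x)\<^sup>2 \<partial>ivl 1) \<le> 2 * E0"
  shows "\<bar>ival 1 f 0 x\<bar> \<le> (1 + 2 * E0) / 2"
proof -
  have "(ival 1 f 0 x)\<^sup>2 \<le> 2 * E0" using ival_square_le[OF f(1), of 0 x] f(2) by simp
  then show ?thesis using young1[of 1 "ival 1 f 0 x"] by simp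
qed

lemma U0_le: "\<bar>U0 x\<bar> \<le> (1 + 2 * E0) / 2"
  unfolding U0_def by (rule primitive_bound[OF u0 u0_E0])

end

context mhd_sol
begin

lemma e_0: "e 0 = (\<integral>x. (u0 x)\<^sup>2 \<partial>ivl 1)"
  unfolding e_def using w_0 w_s[of 0] T u0
  by (intro integral_cong_AE) (auto simp: sq_int_def elim: eventually_mono)

lemma energy_bound:
  assumes "0 \<le> t" "t < T"
  shows "e t / 2 + (\<integral>x. \<Phi> x (th x t) \<partial>ivl 1) \<le> E0"
proof -
  have "0 \<le> ival T (\<lambda>r. \<mu> * diss r) 0 t" using \<mu> diss_nonneg by (intro ival_nonneg) auto
  then show ?thesis using energy[of 0 t] assms by (simp add: E0_def e_0)
qed

lemma e_nonneg: "0 \<le> e t"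
  unfolding e_def by (intro integral_nonneg_AE) auto

lemma e_le: "\<lbrakk>0 \<le> t; t < T\<rbrakk> \<Longrightarrow> e t \<le> 2 * E0"
proof -
  have "0 \<le> (\<integral>x. \<Phi> x (th x t) \<partial>ivl 1)" using \<Phi>_nonneg th_pos by (intro integral_nonneg_AE AE_I2) auto
  then show "\<lbrakk>0 \<le> t; t < T\<rbrakk> \<Longrightarrow> e t \<le> 2 * E0" using energy_bound[of t] by simp
qed

lemma \<Phi>_E0: "\<lbrakk>0 \<le> t; t < T\<rbrakk> \<Longrightarrow> (\<integral>x. \<Phi> x (th x t) \<partial>ivl 1) \<le> E0"
  using energy_bound[of t] e_nonneg[of t] by simp

lemma W_m: "\<lbrakk>0 \<le> t; t < T\<rbrakk> \<Longrightarrow> ival 1 (w t) 0 \<in> borel_measurable borel"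
  using ival_continuous[OF ivl.sq_int_integrable[OF w_s], of t UNIV 0] by (auto intro: borel_measurable_continuous_onI)

lemma W_s: "\<lbrakk>0 \<le> t; t < T\<rbrakk> \<Longrightarrow> sq_int (ivl 1) (ival 1 (w t) 0)"
  by (intro integrable_continuous_interval ival_continuous ivl.sq_int_integrable[OF w_s] W_m)

lemma S_slice: "sq_int (ivl 1) (\<lambda>x. S x t)"
  unfolding S_def using T by (intro sq_int_add U0_s sq_int_ival_slice \<sigma>_s \<sigma>_meas) simp

lemma v_S: "AE r in ivl T. (\<integral>x. v x r * S x r \<partial>ivl 1) = - e r"
  using slices(1) v_mean w_v AE_ivl_mem[of T]
proof eventually_elim
  case (elim r)
  then have r: "0 < r" "r < T" by auto
  obtain h where h: "AE x in ivl 1. S x r = ival 1 (w r) 0 x + h" using S_w[of r] r by auto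
  have [measurable]: "ival 1 (w r) 0 \<in> borel_measurable borel" using W_m[of r] r by simp
  have "(\<integral>x. v x r * S x r \<partial>ivl 1) = (\<integral>x. (ival 1 (w r) 0 x + h) * v x r \<partial>ivl 1)"
    using h by (intro integral_cong_AE) (auto elim!: eventually_mono)
  also have "\<dots> = - (\<integral>x. w r x * w r x \<partial>ivl 1)"
    using elim r by (intro w_parts w_s) auto
  finally show ?case by (simp add: e_def power2_eq_square)
qed

lemma bounded_diff_s:
  assumes [measurable]: "f \<in> borel_measurable borel" and f: "\<And>x. \<bar>f x\<bar> \<le> B"
  shows "sq_int (ivl2 T) (\<lambda>(x, t). th x t - f x)" "sq_int (ivl 1) (\<lambda>x. th x t - f x)"
proof -
  have b: "\<bar>th x t - f x\<bar> \<le> C + B" for x t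
    using th_pos[of x t] th_le(2)[of x t] f[of x] by linarith
  show "sq_int (ivl2 T) (\<lambda>(x, t). th x t - f x)"
    using b by (intro ivl2f.sq_int_bounded[where C = "C + B"] AE_I2) auto
  show "sq_int (ivl 1) (\<lambda>x. th x t - f x)"
    using b by (intro ivl.sq_int_bounded[where C = "C + B"] AE_I2) auto
qed

lemma flux_i:
  assumes [measurable]: "f \<in> borel_measurable borel" and f: "\<And>x. \<bar>f x\<bar> \<le> B"
  shows "integrable (ivl2 T) (\<lambda>(x, r). v x r * S x r + (th x r - f x) * \<sigma> x r)"
    and "integrable (ivl2 T) (\<lambda>(x, r). (th x r - f x) * \<sigma> x r)"
  using Bochner_Integration.integrable_add[OF prod_i[OF v_s(1) S_s] prod_i[OF bounded_diff_s(1)[OF assms] \<sigma>_s(1)]]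
    prod_i[OF bounded_diff_s(1)[OF assms] \<sigma>_s(1)]
  by (simp_all add: case_prod_unfold)

lemma flux_identity:
  assumes fm: "f \<in> borel_measurable borel" and f: "\<And>x. \<bar>f x\<bar> \<le> B"
    and st: "0 \<le> s" "s \<le> t" "t < T"
  shows "(\<integral>x. (th x t - f x) * S x t \<partial>ivl 1) - (\<integral>x. (th x s - f x) * S x s \<partial>ivl 1)
    = ival T (\<lambda>r. \<integral>x. v x r * S x r + (th x r - f x) * \<sigma> x r \<partial>ivl 1) s t"
proof -
  have "(th x t - f x) * S x t - (th x s - f x) * S x s
     = ival T (\<lambda>r. S x r * v x r + (th x r - f x) * \<sigma> x r) s t" for x
    by (rule ac_product[OF v_i[of x] \<sigma>_i[of x] st(2)]) (use st th_diff S_diff in auto)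
  then have *: "ival T (\<lambda>r. v x r * S x r + (th x r - f x) * \<sigma> x r) s t
     = (th x t - f x) * S x t - (th x s - f x) * S x s" for x
    by (simp add: mult.commute)
  have "(\<integral>x. (th x t - f x) * S x t \<partial>ivl 1) - (\<integral>x. (th x s - f x) * S x s \<partial>ivl 1)
     = (\<integral>x. (th x t - f x) * S x t - (th x s - f x) * S x s \<partial>ivl 1)"
    by (intro Bochner_Integration.integral_diff[symmetric] sq_int_mult bounded_diff_s[OF fm f] S_slice)
  then show ?thesis
    unfolding *[symmetric] using ivl2_swap(2)[OF flux_i(1)[OF fm f]] by simp
qed

text \<open>For almost every time this is \<open>\<integral> th P + u\<^sup>2\<close>, see \<open>g_eq\<close>.\<close>

definition g :: "real \<Rightarrow> real" where
  "g r = - (\<integral>x. v x r * S x r + th x r * \<sigma> x r \<partial>ivl 1)"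

lemma g_i: "integrable (ivl T) g"
  using ivl2_swap(3)[OF flux_i(1)[of "\<lambda>_. 0" 0]] by (simp add: g_def[abs_def])

lemma g_eq: "AE r in ivl T. g r = e r + (\<integral>x. th x r * P x (th x r) \<partial>ivl 1)"
  using v_S slices v_mean AE_ivl_mem[of T]
proof eventually_elim
  case (elim r)
  have i: "integrable (ivl 1) (\<lambda>x. v x r * S x r)" "integrable (ivl 1) (\<lambda>x. th x r * \<sigma> x r)"
    "integrable (ivl 1) (\<lambda>x. th x r * P x (th x r))"
    using elim by (auto intro: sq_int_mult th_s P_s)
  have vi: "integrable (ivl 1) (\<lambda>x. v x r)" using elim by (intro ivl.sq_int_integrable) auto
  have "th x r * \<sigma> x r = \<mu> * v x r - th x r * P x (th x r)" for x
    using th_pos[of x r] by (simp add: \<sigma>_def right_diff_distrib)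
  then have "(\<integral>x. th x r * \<sigma> x r \<partial>ivl 1) = - (\<integral>x. th x r * P x (th x r) \<partial>ivl 1)"
    using i vi elim by simp
  then show ?case using i elim by (simp add: g_def)
qed

lemma thP_i: "integrable (ivl 1) (\<lambda>x. th x r * P x (th x r))"
  by (intro sq_int_mult th_s P_s)

lemma g_bounds: "AE r in ivl T. A \<le> g r \<and> g r \<le> G"
  using g_eq AE_ivl_mem[of T]
proof eventually_elim
  case (elim r)
  then have r: "0 \<le> r" "r < T" by auto
  have ti: "integrable (ivl 1) (\<lambda>x. th x r)" by (rule ivl.sq_int_integrable[OF th_s(2)])
  have "(\<integral>x. A * (1 + (1 - \<gamma>) * (th x r - 1)) \<partial>ivl 1) \<le> (\<integral>x. th x r * P x (th x r) \<partial>ivl 1)"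
    using ti by (intro integral_mono mult_P_ge th_pos thP_i) auto
  moreover have "(\<integral>x. A * (1 + (1 - \<gamma>) * (th x r - 1)) \<partial>ivl 1) = A"
    using ti mass[OF r] measure_ivl_UNIV[of 1] by simp
  moreover have "(\<integral>x. th x r * P x (th x r) \<partial>ivl 1) \<le> (\<integral>x. \<gamma> * \<Phi> x (th x r) \<partial>ivl 1)"
    using \<Phi>_i by (intro integral_mono mult_P_le th_pos thP_i) auto
  moreover have "\<dots> \<le> \<gamma> * E0" using \<Phi>_E0[OF r] \<gamma> by simp
  moreover have "G = \<gamma> * E0 + 2 * E0" by (simp add: G_def distrib_right)
  ultimately show ?case
    using elim e_le[OF r] e_nonneg[of r] by linarith
qed

text \<open>The bounded perturbation \<open>\<zeta>\<close> of \<open>\<mu> ln th\<close> solves an ordinary differential equation at almost every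
  point, and its right-hand side pushes it back from large and from very negative values.\<close>

definition \<zeta> :: "real \<Rightarrow> real \<Rightarrow> real" where
  "\<zeta> x t = \<mu> * ln (\<tau>0 x) + ival T (\<lambda>r. P x (th x r) - g r) 0 t"

lemma P_g_i: "integrable (ivl T) (\<lambda>r. P x (th x r) - g r)"
  using ivl.sq_int_integrable[OF P_s(2)] g_i by simp

lemma log_th:
  assumes t: "0 \<le> t"
  shows "\<mu> * ln (th x t) - \<zeta> x t = S x t - U0 x + ival T g 0 t"
proof -
  have Pi: "integrable (ivl T) (\<lambda>r. P x (th x r))" by (rule ivl.sq_int_integrable[OF P_s(2)])
  have "\<mu> * ln (th x t) - \<mu> * ln (th x 0) = ival T (\<lambda>r. \<mu> / th x r * v x r) 0 t"
  proof (rule ac_chain[OF v_i[of x] t, where lo = c and hi = C])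
    fix y assume "y \<in> {c..C}"
    then have "0 < y" using c(1) by auto
    then show "((\<lambda>y. \<mu> * ln y) has_real_derivative \<mu> / y) (at y)"
      by (auto intro!: derivative_eq_intros)
  next
    show "continuous_on {c..C} ((/) \<mu>)" using c(1) by (intro continuous_intros) auto
  qed (use th_diff th_le in auto)
  also have "\<dots> = ival T (\<lambda>r. \<sigma> x r + P x (th x r)) 0 t" by (simp add: \<sigma>_def)
  also have "\<dots> = (S x t - U0 x) + ival T (\<lambda>r. P x (th x r)) 0 t"
    using \<sigma>_i Pi by (simp add: ival_add S_def)
  finally show ?thesis
    using Pi g_i by (simp add: \<zeta>_def ival_diff)
qed

lemma \<zeta>_close:
  assumes t: "0 \<le> t" "t < T"
  shows "AE x in ivl 1. \<bar>\<mu> * ln (th x t) - \<zeta> x t\<bar> \<le> K"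
proof -
  obtain h where h: "AE x in ivl 1. S x t = ival 1 (w t) 0 x + h" using S_w[OF t] by blast
  let ?W = "ival 1 (w t) 0" and ?k = "(1 + 2 * E0) / 2"
  have [measurable]: "?W \<in> borel_measurable borel" by (rule W_m[OF t])
  have W_le: "\<bar>?W x\<bar> \<le> ?k" for x
    using e_le[OF t] by (intro primitive_bound w_s t) (simp add: e_def)
  have ti: "integrable (ivl 1) (\<lambda>x. th x t)" for t by (rule ivl.sq_int_integrable[OF th_s(2)])
  have avg: "\<bar>\<integral>x. th x t * f x \<partial>ivl 1\<bar> \<le> ?k" if f: "sq_int (ivl 1) f" "\<And>x. \<bar>f x\<bar> \<le> ?k" "0 \<le> t" "t < T" for f t
  proof -
    have "\<bar>\<integral>x. th x t * f x \<partial>ivl 1\<bar> \<le> (\<integral>x. \<bar>th x t * f x\<bar> \<partial>ivl 1)"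
      using integral_norm_bound[of "ivl 1" "\<lambda>x. th x t * f x"] by simp
    also have "\<dots> \<le> (\<integral>x. th x t * ?k \<partial>ivl 1)"
    proof (rule integral_mono)
      show "integrable (ivl 1) (\<lambda>x. \<bar>th x t * f x\<bar>)"
        by (rule integrable_abs[OF sq_int_mult[OF th_s(2) f(1)]])
      show "\<bar>th x t * f x\<bar> \<le> th x t * ?k" for x
        unfolding abs_mult using th_pos[of x t] f(2)[of x] by (simp only: abs_of_pos mult_left_mono less_imp_le)
    qed (use ti in auto)
    also have "\<dots> = ?k" using mass[OF f(3,4)] ti[of t] by simp
    finally show ?thesis .
  qed
  have "(\<integral>x. th x t * S x t \<partial>ivl 1) = (\<integral>x. th x t * ?W x + th x t * h \<partial>ivl 1)"
    using h by (intro integral_cong_AE) (auto elim!: eventually_mono simp: distrib_left)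
  also have "\<dots> = (\<integral>x. th x t * ?W x \<partial>ivl 1) + h"
    using ti[of t] mass[OF t] sq_int_mult[OF th_s(2) W_s[OF t]] by simp
  finally have 1: "(\<integral>x. th x t * S x t \<partial>ivl 1) = (\<integral>x. th x t * ?W x \<partial>ivl 1) + h" .
  have "(\<integral>x. th x t * S x t \<partial>ivl 1) - (\<integral>x. th x 0 * U0 x \<partial>ivl 1) = ival T (\<lambda>r. - g r) 0 t"
    using flux_identity[of "\<lambda>_. 0" 0 0 t] t by (simp add: g_def S_def)
  also have "\<dots> = - ival T g 0 t" using ival_mult[of T "- 1" g] by simp
  finally have 2: "h + ival T g 0 t = (\<integral>x. th x 0 * U0 x \<partial>ivl 1) - (\<integral>x. th x t * ?W x \<partial>ivl 1)"
    using 1 by simp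
  have "\<bar>h + ival T g 0 t\<bar> \<le> 2 * ?k"
    unfolding 2 using avg[OF U0_s U0_le, of 0] avg[OF W_s[OF t] W_le t] T by linarith
  with h show ?thesis
  proof (elim eventually_mono)
    fix x assume "S x t = ?W x + h"
    then have "\<mu> * ln (th x t) - \<zeta> x t = ?W x - U0 x + (h + ival T g 0 t)"
      using log_th[OF t(1), of x] by simp
    then show "\<bar>\<mu> * ln (th x t) - \<zeta> x t\<bar> \<le> K"
      using W_le[of x] U0_le[of x] \<open>\<bar>h + ival T g 0 t\<bar> \<le> 2 * ?k\<close> unfolding K_def by linarith
  qed
qed

lemma \<zeta>_continuous: "continuous_on X (\<zeta> x)"
  unfolding \<zeta>_def[abs_def] by (intro continuous_intros ival_continuous P_g_i)

lemma \<zeta>_close_all: "AE x in ivl 1. \<forall>t. 0 \<le> t \<and> t < T \<longrightarrow> \<bar>\<mu> * ln (th x t) - \<zeta> x t\<bar> \<le> K"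
proof -
  have "AE x in ivl 1. \<forall>q\<in>\<rat>. 0 \<le> q \<and> q < T \<longrightarrow> \<bar>\<mu> * ln (th x q) - \<zeta> x q\<bar> \<le> K"
    using \<zeta>_close by (subst AE_ball_countable) (auto intro: countable_rat)
  then show ?thesis
  proof (elim eventually_mono, intro allI impI)
    fix x t assume q: "\<forall>q\<in>\<rat>. 0 \<le> q \<and> q < T \<longrightarrow> \<bar>\<mu> * ln (th x q) - \<zeta> x q\<bar> \<le> K" and t: "0 \<le> t \<and> t < T"
    have "continuous_on UNIV (\<lambda>t. \<mu> * ln (th x t) - \<zeta> x t)"
      using th_pos[of x] by (intro continuous_intros th_continuous \<zeta>_continuous) (auto simp: less_imp_neq[symmetric])
    then show "\<bar>\<mu> * ln (th x t) - \<zeta> x t\<bar> \<le> K"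
      by (rule dense_bound[where T = T]) (use q t in auto)
  qed
qed

lemma \<zeta>_diff: "\<lbrakk>0 \<le> s; s \<le> t\<rbrakk> \<Longrightarrow> \<zeta> x t - \<zeta> x s = ival T (\<lambda>r. P x (th x r) - g r) s t"
  unfolding \<zeta>_def using ival_combine[OF P_g_i, of 0 s t x] by simp

lemma th_bounds: "AE x in ivl 1. \<forall>t. 0 \<le> t \<and> t < T \<longrightarrow> lo \<le> th x t \<and> th x t \<le> hi"
  using \<zeta>_close_all
proof eventually_elim
  case (elim x)
  have close: "\<bar>\<mu> * ln (th x t) - \<zeta> x t\<bar> \<le> K" if "0 \<le> t" "t < T" for t using elim that by auto
  have s_up: "0 < s_up" using m_nonneg A by (simp add: s_up_def add_pos_nonneg)
  have gi: "AE r in ivl T. s < r \<and> r \<le> t \<longrightarrow> P x (th x r) - g r \<le> 0"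
    if "\<And>r. s < r \<Longrightarrow> r \<le> t \<Longrightarrow> s_up \<le> th x r" for s t
    using g_bounds by (elim eventually_mono) (use P_s_up[of "th x _" x] that in \<open>fastforce\<close>)
  have gi': "AE r in ivl T. s < r \<and> r \<le> t \<longrightarrow> 0 \<le> P x (th x r) - g r"
    if "\<And>r. s < r \<Longrightarrow> r \<le> t \<Longrightarrow> th x r \<le> s_lo" for s t
    using g_bounds by (elim eventually_mono) (use P_s_lo[OF th_pos, of x _ x] that in \<open>fastforce\<close>)
  show ?case
  proof (intro allI impI)
    fix t assume "0 \<le> t \<and> t < T"
    then have t: "0 \<le> t" "t < T" by auto
    have "\<zeta> x t \<le> Z_up"
    proof (rule barrier_upper[OF \<zeta>_continuous t(1)])
      have "ln (\<tau>0 x) \<le> ln a'" using a(1) a(2)[of x] a(3)[of x] by (subst ln_le_cancel_iff) auto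
      then show "\<zeta> x 0 \<le> Z_up" using \<mu> by (simp add: \<zeta>_def Z_up_def le_max_iff_disj)
      fix s assume s: "0 \<le> s" "s \<le> t" and Z: "\<And>r. s < r \<Longrightarrow> r \<le> t \<Longrightarrow> Z_up < \<zeta> x r"
      have "s_up \<le> th x r" if r: "s < r" "r \<le> t" for r
      proof -
        have "\<mu> * ln s_up \<le> \<mu> * ln (th x r)"
        proof -
          have "\<mu> * ln s_up + K \<le> Z_up" by (simp add: Z_up_def)
          moreover have "\<bar>\<mu> * ln (th x r) - \<zeta> x r\<bar> \<le> K" using r s t by (intro close) auto
          ultimately show ?thesis using Z[OF r] by linarith
        qed
        then show ?thesis using \<mu> s_up th_pos[of x r] by simp
      qed
      then have "ival T (\<lambda>r. P x (th x r) - g r) s t \<le> ival T (\<lambda>_. 0) s t"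
        by (intro ival_mono_AE P_g_i gi) auto
      then show "\<zeta> x t \<le> \<zeta> x s" using \<zeta>_diff[OF s, of x] by (simp add: ival_def)
    qed
    then have "\<mu> * ln (th x t) \<le> Z_up + K" using close[OF t] by linarith
    then have "ln (th x t) \<le> (Z_up + K) / \<mu>" using \<mu> by (simp add: field_simps)
    then have "th x t \<le> hi" unfolding hi_def using th_pos[of x t] by (metis exp_le_cancel_iff exp_ln)
    moreover have "Z_lo \<le> \<zeta> x t"
    proof (rule barrier_lower[OF \<zeta>_continuous t(1)])
      have "ln a \<le> ln (\<tau>0 x)" using a(1) a(2)[of x] by (subst ln_le_cancel_iff) auto
      then show "Z_lo \<le> \<zeta> x 0" using \<mu> by (simp add: \<zeta>_def Z_lo_def min_le_iff_disj)
      fix s assume s: "0 \<le> s" "s \<le> t" and Z: "\<And>r. s < r \<Longrightarrow> r \<le> t \<Longrightarrow> \<zeta> x r < Z_lo"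
      have "th x r \<le> s_lo" if r: "s < r" "r \<le> t" for r
      proof -
        have "\<mu> * ln (th x r) \<le> \<mu> * ln s_lo"
        proof -
          have "Z_lo \<le> \<mu> * ln s_lo - K" by (simp add: Z_lo_def)
          moreover have "\<bar>\<mu> * ln (th x r) - \<zeta> x r\<bar> \<le> K" using r s t by (intro close) auto
          ultimately show ?thesis using Z[OF r] by linarith
        qed
        then show ?thesis using \<mu> s_lo_pos th_pos[of x r] by simp
      qed
      then have "ival T (\<lambda>_. 0) s t \<le> ival T (\<lambda>r. P x (th x r) - g r) s t"
        by (intro ival_mono_AE P_g_i gi') auto
      then show "\<zeta> x s \<le> \<zeta> x t" using \<zeta>_diff[OF s, of x] by (simp add: ival_def)
    qed
    then have "Z_lo - K \<le> \<mu> * ln (th x t)" using close[OF t] by linarith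
    then have "(Z_lo - K) / \<mu> \<le> ln (th x t)" using \<mu> by (simp add: field_simps)
    then have "lo \<le> th x t" unfolding lo_def using th_pos[of x t] by (metis exp_le_cancel_iff exp_ln)
    ultimately show "lo \<le> th x t \<and> th x t \<le> hi" by simp
  qed
qed

end

section \<open>Exponential decay\<close>

lemma exponential_decay:
  fixes f :: "real \<Rightarrow> real"
  assumes step: "\<And>s t. \<lbrakk>0 \<le> s; s \<le> t; t < T\<rbrakk> \<Longrightarrow> f t - f s \<le> - \<delta> * (t - s) * f t"
    and "0 < \<delta>" "0 \<le> t" "t < T"
  shows "f t \<le> exp (- \<delta> * t) * f 0"
proof -
  have *: "(1 + \<delta> * t / real n) ^ k * f (real k * (t / n)) \<le> f 0" if "k \<le> n" for n k
    using that
  proof (induction k)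
    case (Suc k)
    let ?h = "t / n"
    have n: "0 < real n" using Suc by simp
    have h: "0 \<le> ?h" using n assms by simp
    have "real (Suc k) * ?h \<le> real n * ?h" using Suc h by (intro mult_right_mono) auto
    then have "real (Suc k) * ?h < T" using n assms by simp
    then have "(1 + \<delta> * ?h) * f (real (Suc k) * ?h) \<le> f (real k * ?h)"
    proof -
      have "real k * ?h \<le> real (Suc k) * ?h" using h by (intro mult_right_mono) auto
      then have "f (real (Suc k) * ?h) - f (real k * ?h)
          \<le> - \<delta> * (real (Suc k) * ?h - real k * ?h) * f (real (Suc k) * ?h)"
        using \<open>real (Suc k) * ?h < T\<close> mult_nonneg_nonneg[OF of_nat_0_le_iff h, of k] by (intro step)
      also have "real (Suc k) * ?h - real k * ?h = ?h" by (simp add: of_nat_Suc distrib_right del: times_divide_eq_right times_divide_eq_left)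
      finally show ?thesis unfolding distrib_right mult_minus_left mult_1_left by linarith
    qed
    then have "(1 + \<delta> * t / n) ^ k * ((1 + \<delta> * t / n) * f (real (Suc k) * ?h)) \<le> (1 + \<delta> * t / n) ^ k * f (real k * ?h)"
      using assms n by (intro mult_left_mono) auto
    also have "\<dots> \<le> f 0" using Suc by simp
    finally show ?case by (simp add: mult.assoc mult.left_commute)
  qed simp
  have "(\<lambda>n. (1 + \<delta> * t / real n) ^ n * f t) \<longlonglongrightarrow> exp (\<delta> * t) * f t"
    by (intro tendsto_intros tendsto_exp_limit_sequentially)
  moreover have "\<forall>\<^sub>F n in sequentially. (1 + \<delta> * t / real n) ^ n * f t \<le> f 0"
  proof (rule eventually_sequentiallyI[of 1])
    fix n :: nat assume "1 \<le> n"
    then show "(1 + \<delta> * t / real n) ^ n * f t \<le> f 0" using *[of n n] by simp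
  qed
  ultimately have "exp (\<delta> * t) * f t \<le> f 0"
    by (intro tendsto_upperbound) auto
  then show ?thesis by (simp add: exp_minus field_simps)
qed

lemma minimum_by_derivative_sign:
  fixes h :: "real \<Rightarrow> real"
  assumes h: "\<And>x. x \<in> {l..u} \<Longrightarrow> (h has_real_derivative h' x) (at x)"
    and sign: "\<And>x. x \<in> {l..u} \<Longrightarrow> 0 \<le> h' x * (x - z)" and "z \<in> {l..u}" "y \<in> {l..u}"
  shows "h z \<le> h y"
proof -
  consider "y = z" | "z < y" | "y < z" by linarith
  then show ?thesis
  proof cases
    case 2
    obtain x where x: "z < x" "x < y" "h y - h z = (y - z) * h' x"
      using MVT2[OF 2, of h h'] h assms by force
    then have "0 \<le> h' x" using sign[of x] assms by (auto simp: zero_le_mult_iff)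
    then show ?thesis using x 2 by (metis diff_ge_0_iff_ge less_imp_le mult_nonneg_nonneg)
  next
    case 3
    obtain x where x: "y < x" "x < z" "h z - h y = (z - y) * h' x"
      using MVT2[OF 3, of h h'] h assms by force
    then have "h' x \<le> 0" using sign[of x] assms by (auto simp: zero_le_mult_iff)
    then have "h z - h y \<le> 0" unfolding x(3) using 3 by (intro mult_nonneg_nonpos) auto
    then show ?thesis by simp
  qed simp
qed

context mhd_data
begin

definition lo' :: real where "lo' = min lo s1"
definition hi' :: real where "hi' = max hi s2"
definition k1 :: real where "k1 = A * \<gamma> * hi' powr (- \<gamma> - 1)"
definition k2 :: real where "k2 = A * \<gamma> * lo' powr (- \<gamma> - 1) + 2 * m / lo' ^ 3"
definition \<kappa> :: real where "\<kappa> = \<mu>\<^sup>2 / (2 * k1 * lo'\<^sup>2)"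
definition \<epsilon> :: real where "\<epsilon> = min (min (1 / 2) (k1 / 2)) (\<mu> / (2 * hi') / (1 + \<kappa>))"
definition \<delta>\<^sub>0 :: real where "\<delta>\<^sub>0 = min (\<mu> / (2 * hi')) (\<epsilon> * k1 / 2)"
definition \<delta> :: real where "\<delta> = \<delta>\<^sub>0 / (1 + \<epsilon> + k2)"
definition L\<^sub>0 :: real where
  "L\<^sub>0 = (\<integral>x. (u0 x)\<^sup>2 \<partial>ivl 1) / 2 + ((\<integral>x. \<Phi> x (\<tau>0 x) \<partial>ivl 1) - (\<integral>x. \<Phi> x (\<tau>s x) \<partial>ivl 1))
     - \<epsilon> * (\<integral>x. (\<tau>0 x - \<tau>s x) * U0 x \<partial>ivl 1)"

lemma lo'_pos: "0 < lo'" using s(1) by (simp add: lo'_def lo_def)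

lemma lo'_le_hi': "lo' \<le> hi'"
  using s(2)[of 0] s(3)[of 0] by (simp add: lo'_def hi'_def min_le_iff_disj le_max_iff_disj)

lemma hi'_pos: "0 < hi'" using lo'_pos lo'_le_hi' by linarith

lemma k1_pos: "0 < k1" using A \<gamma> hi'_pos by (simp add: k1_def)

lemma k2_nonneg: "0 \<le> k2" using A \<gamma> lo'_pos m_nonneg by (simp add: k2_def)

lemma \<kappa>_nonneg: "0 \<le> \<kappa>" using k1_pos by (simp add: \<kappa>_def)

lemma \<epsilon>_bounds: "0 < \<epsilon>" "\<epsilon> \<le> 1 / 2" "\<epsilon> \<le> k1 / 2" "\<epsilon> * (1 + \<kappa>) \<le> \<mu> / (2 * hi')"
proof -
  show "0 < \<epsilon>" using k1_pos \<mu> hi'_pos \<kappa>_nonneg by (simp add: \<epsilon>_def)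
  show "\<epsilon> \<le> 1 / 2" "\<epsilon> \<le> k1 / 2" unfolding \<epsilon>_def by linarith+
  have "\<epsilon> \<le> \<mu> / (2 * hi') / (1 + \<kappa>)" unfolding \<epsilon>_def by (rule min.cobounded2)
  moreover have "0 < 1 + \<kappa>" using \<kappa>_nonneg by simp
  ultimately show "\<epsilon> * (1 + \<kappa>) \<le> \<mu> / (2 * hi')" by (simp only: pos_le_divide_eq)
qed

lemma \<delta>\<^sub>0_pos: "0 < \<delta>\<^sub>0" using \<mu> hi'_pos \<epsilon>_bounds(1) k1_pos by (simp add: \<delta>\<^sub>0_def)

lemma \<delta>_pos: "0 < \<delta>" using \<delta>\<^sub>0_pos \<epsilon>_bounds(1) k2_nonneg by (simp add: \<delta>_def)

lemma P_deriv:
  assumes "0 < y"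
  shows "(P x has_real_derivative - (A * \<gamma> * y powr (- \<gamma> - 1) + 2 * Q x / y ^ 3)) (at y)"
proof -
  have "((\<lambda>y. A * y powr (- \<gamma>)) has_real_derivative A * (- \<gamma> * y powr (- \<gamma> - 1))) (at y)"
    using assms by (intro DERIV_cmult has_real_derivative_powr)
  moreover have "((\<lambda>y. Q x / y\<^sup>2) has_real_derivative - (2 * Q x / y ^ 3)) (at y)"
    using assms by (auto intro!: derivative_eq_intros simp: power2_eq_square power3_eq_cube field_simps)
  ultimately show ?thesis
    unfolding P_def[abs_def] by (rule DERIV_cong[OF DERIV_add]) simp
qed

lemma P_slope:
  assumes "lo' \<le> z" "z \<le> y" "y \<le> hi'"
  shows "k1 * (y - z) \<le> P x z - P x y" "P x z - P x y \<le> k2 * (y - z)"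
proof -
  have "k1 * (y - z) \<le> P x z - P x y \<and> P x z - P x y \<le> k2 * (y - z)"
  proof (cases "z = y")
    case False
    then have "z < y" using assms by simp
    let ?d = "\<lambda>y. A * \<gamma> * y powr (- \<gamma> - 1) + 2 * Q x / y ^ 3"
    obtain r where r: "z < r" "r < y" "P x y - P x z = (y - z) * - ?d r"
      using MVT2[OF \<open>z < y\<close>, of "P x" "\<lambda>y. - ?d y"] P_deriv assms lo'_pos by force
    have r': "0 < r" "lo' \<le> r" "r \<le> hi'" using r assms lo'_pos by auto
    have "hi' powr (- \<gamma> - 1) \<le> r powr (- \<gamma> - 1)" "r powr (- \<gamma> - 1) \<le> lo' powr (- \<gamma> - 1)"
      using r' \<gamma> lo'_pos by (auto intro!: powr_mono2')
    then have "k1 \<le> A * \<gamma> * r powr (- \<gamma> - 1)" "A * \<gamma> * r powr (- \<gamma> - 1) \<le> A * \<gamma> * lo' powr (- \<gamma> - 1)"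
      using A \<gamma> by (auto simp: k1_def intro!: mult_left_mono)
    moreover have "0 \<le> 2 * Q x / r ^ 3" using Q(1)[of x] r' by simp
    moreover have "2 * Q x / r ^ 3 \<le> 2 * m / lo' ^ 3"
      using Q[of x] r' lo'_pos m_nonneg by (intro frac_le power_mono) auto
    ultimately have "k1 \<le> ?d r" "?d r \<le> k2" by (auto simp: k2_def)
    then have "k1 * (y - z) \<le> ?d r * (y - z)" "?d r * (y - z) \<le> k2 * (y - z)"
      using \<open>z < y\<close> by (auto intro!: mult_right_mono)
    moreover have "P x z - P x y = ?d r * (y - z)" using r(3) by (simp add: algebra_simps)
    ultimately show ?thesis by simp
  qed simp
  then show "k1 * (y - z) \<le> P x z - P x y" "P x z - P x y \<le> k2 * (y - z)" by auto
qed

lemma P_monotone: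
  assumes "y \<in> {lo'..hi'}" "z \<in> {lo'..hi'}"
  shows "k1 * (y - z)\<^sup>2 \<le> (P x z - P x y) * (y - z)" "(P x z - P x y) * (y - z) \<le> k2 * (y - z)\<^sup>2"
proof -
  have "k1 * (y - z)\<^sup>2 \<le> (P x z - P x y) * (y - z) \<and> (P x z - P x y) * (y - z) \<le> k2 * (y - z)\<^sup>2"
  proof (cases "z \<le> y")
    case True
    then have "k1 * (y - z) * (y - z) \<le> (P x z - P x y) * (y - z)" "(P x z - P x y) * (y - z) \<le> k2 * (y - z) * (y - z)"
      using P_slope[of z y x] assms by (auto intro!: mult_right_mono)
    then show ?thesis by (simp add: power2_eq_square mult.assoc)
  next
    case False
    then have "k1 * (z - y) * (z - y) \<le> (P x y - P x z) * (z - y)" "(P x y - P x z) * (z - y) \<le> k2 * (z - y) * (z - y)"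
      using P_slope[of y z x] assms by (auto intro!: mult_right_mono)
    then show ?thesis by (simp add: power2_eq_square algebra_simps)
  qed
  then show "k1 * (y - z)\<^sup>2 \<le> (P x z - P x y) * (y - z)" "(P x z - P x y) * (y - z) \<le> k2 * (y - z)\<^sup>2" by auto
qed

lemma \<Phi>_quadratic:
  assumes "y \<in> {lo'..hi'}" "z \<in> {lo'..hi'}"
  shows "k1 / 2 * (y - z)\<^sup>2 \<le> \<Phi> x y - \<Phi> x z + P x z * (y - z)"
    "\<Phi> x y - \<Phi> x z + P x z * (y - z) \<le> k2 / 2 * (y - z)\<^sup>2"
proof -
  let ?F = "\<lambda>y. \<Phi> x y - \<Phi> x z + P x z * (y - z)"
  have F: "(?F has_real_derivative P x z - P x y) (at y)" if "y \<in> {lo'..hi'}" for y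
    using that lo'_pos by (auto intro!: derivative_eq_intros \<Phi>_deriv)
  have q: "((\<lambda>y. k / 2 * (y - z)\<^sup>2) has_real_derivative k * (y - z)) (at y)" for k y
    by (auto intro!: derivative_eq_intros)
  have "(\<lambda>y. ?F y - k1 / 2 * (y - z)\<^sup>2) z \<le> (\<lambda>y. ?F y - k1 / 2 * (y - z)\<^sup>2) y"
  proof (rule minimum_by_derivative_sign[OF _ _ assms(2,1)])
    show "((\<lambda>y. ?F y - k1 / 2 * (y - z)\<^sup>2) has_real_derivative (P x z - P x y) - k1 * (y - z)) (at y)"
      if "y \<in> {lo'..hi'}" for y using DERIV_diff[OF F[OF that] q] .
    show "0 \<le> ((P x z - P x y) - k1 * (y - z)) * (y - z)" if "y \<in> {lo'..hi'}" for y
      using P_monotone(1)[OF that assms(2), of x] by (simp add: power2_eq_square algebra_simps)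
  qed
  then show "k1 / 2 * (y - z)\<^sup>2 \<le> ?F y" by simp
  have "(\<lambda>y. k2 / 2 * (y - z)\<^sup>2 - ?F y) z \<le> (\<lambda>y. k2 / 2 * (y - z)\<^sup>2 - ?F y) y"
  proof (rule minimum_by_derivative_sign[OF _ _ assms(2,1)])
    show "((\<lambda>y. k2 / 2 * (y - z)\<^sup>2 - ?F y) has_real_derivative k2 * (y - z) - (P x z - P x y)) (at y)"
      if "y \<in> {lo'..hi'}" for y using DERIV_diff[OF q F[OF that]] .
    show "0 \<le> (k2 * (y - z) - (P x z - P x y)) * (y - z)" if "y \<in> {lo'..hi'}" for y
      using P_monotone(2)[OF that assms(2), of x] by (simp add: power2_eq_square algebra_simps)
  qed
  then show "?F y \<le> k2 / 2 * (y - z)\<^sup>2" by simp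
qed

lemma \<tau>s_mem: "\<tau>s x \<in> {lo'..hi'}"
  using s(2)[of x] s(3)[of x] by (simp add: lo'_def hi'_def min_le_iff_disj le_max_iff_disj)

lemma \<tau>s_bounded: "\<bar>\<tau>s x\<bar> \<le> s2"
  using s(1) s(2)[of x] s(3)[of x] by simp

lemma \<Phi>\<tau>s_i: "integrable (ivl 1) (\<lambda>x. \<Phi> x (\<tau>s x))"
proof (rule ivl.integrable_const_bound[where B = "A / (\<gamma> - 1) * s1 powr (1 - \<gamma>) + m / s1"])
  show "AE x in ivl 1. norm (\<Phi> x (\<tau>s x)) \<le> A / (\<gamma> - 1) * s1 powr (1 - \<gamma>) + m / s1"
  proof (intro AE_I2)
    fix x
    have "0 < \<tau>s x" using s(1) s(2)[of x] by simp
    then show "norm (\<Phi> x (\<tau>s x)) \<le> A / (\<gamma> - 1) * s1 powr (1 - \<gamma>) + m / s1"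
      using \<Phi>_nonneg \<Phi>_le[OF s(1) s(2)] by simp
  qed
qed simp

end

context mhd_sol
begin

definition N :: "real \<Rightarrow> real" where "N t = (\<integral>x. (th x t - \<tau>s x)\<^sup>2 \<partial>ivl 1)"

definition L :: "real \<Rightarrow> real" where
  "L t = e t / 2 + ((\<integral>x. \<Phi> x (th x t) \<partial>ivl 1) - (\<integral>x. \<Phi> x (\<tau>s x) \<partial>ivl 1))
     - \<epsilon> * (\<integral>x. (th x t - \<tau>s x) * S x t \<partial>ivl 1)"

text \<open>The last term of \<open>L\<close> is \<open>\<epsilon> \<integral> u Y\<close> with \<open>Y\<^sub>x = th - \<tau>s\<close>, integrated by parts; it makes the dissipation control
  \<open>th - \<tau>s\<close>. \<open>D\<close> bounds the time derivative of \<open>L\<close>.\<close>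

definition D :: "real \<Rightarrow> real" where
  "D r = - (\<mu> * diss r) - \<epsilon> * (\<integral>x. v x r * S x r + (th x r - \<tau>s x) * \<sigma> x r \<partial>ivl 1)"

lemma d_s: "sq_int (ivl2 T) (\<lambda>(x, t). th x t - \<tau>s x)" "sq_int (ivl 1) (\<lambda>x. th x t - \<tau>s x)"
  by (rule bounded_diff_s[OF \<tau>s_m \<tau>s_bounded])+

lemma d_mean:
  assumes "0 \<le> t" "t < T"
  shows "(\<integral>x. th x t - \<tau>s x \<partial>ivl 1) = 0"
  using mass[OF assms] \<tau>s_mass ivl.sq_int_integrable[OF th_s(2)] ivl.sq_int_integrable[OF \<tau>s_s] by simp

lemma th_mem: "AE x in ivl 1. \<forall>t. 0 \<le> t \<and> t < T \<longrightarrow> th x t \<in> {lo'..hi'}"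
  using th_bounds by eventually_elim (auto simp: lo'_def hi'_def min_le_iff_disj le_max_iff_disj)

lemma L_0: "L 0 = L\<^sub>0"
  by (simp add: L_def L\<^sub>0_def e_0 S_def)

lemma N_nonneg: "0 \<le> N t"
  unfolding N_def by (intro integral_nonneg_AE) auto

lemma cross_term:
  assumes t: "0 \<le> t" "t < T"
  shows "\<bar>\<integral>x. (th x t - \<tau>s x) * S x t \<partial>ivl 1\<bar> \<le> (e t + N t) / 2"
proof -
  obtain h where h: "AE x in ivl 1. S x t = ival 1 (w t) 0 x + h" using S_w[OF t] by blast
  let ?W = "ival 1 (w t) 0"
  have [measurable]: "?W \<in> borel_measurable borel" by (rule W_m[OF t])
  have di: "integrable (ivl 1) (\<lambda>x. th x t - \<tau>s x)" by (rule ivl.sq_int_integrable[OF d_s(2)])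
  have i: "integrable (ivl 1) (\<lambda>x. (th x t - \<tau>s x) * ?W x)" by (rule sq_int_mult[OF d_s(2) W_s[OF t]])
  have "(\<integral>x. (th x t - \<tau>s x) * S x t \<partial>ivl 1) = (\<integral>x. (th x t - \<tau>s x) * ?W x + h * (th x t - \<tau>s x) \<partial>ivl 1)"
    using h by (intro integral_cong_AE) (auto elim!: eventually_mono simp: algebra_simps)
  also have "\<dots> = (\<integral>x. (th x t - \<tau>s x) * ?W x \<partial>ivl 1)"
    using i di d_mean[OF t] by (simp only: Bochner_Integration.integral_add integrable_mult_right integral_mult_right_zero)
  finally have eq: "(\<integral>x. (th x t - \<tau>s x) * S x t \<partial>ivl 1) = (\<integral>x. (th x t - \<tau>s x) * ?W x \<partial>ivl 1)" .
  have "\<bar>\<integral>x. (th x t - \<tau>s x) * ?W x \<partial>ivl 1\<bar> \<le> (\<integral>x. \<bar>(th x t - \<tau>s x) * ?W x\<bar> \<partial>ivl 1)"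
    using integral_norm_bound[of "ivl 1" "\<lambda>x. (th x t - \<tau>s x) * ?W x"] by simp
  also have "\<dots> \<le> (\<integral>x. (th x t - \<tau>s x)\<^sup>2 / 2 + e t / 2 \<partial>ivl 1)"
  proof (rule integral_mono)
    fix x
    have "(?W x)\<^sup>2 \<le> e t" using ival_square_le[OF w_s[OF t], of 0 x] by (simp add: e_def)
    then show "\<bar>(th x t - \<tau>s x) * ?W x\<bar> \<le> (th x t - \<tau>s x)\<^sup>2 / 2 + e t / 2"
      using young1[of "th x t - \<tau>s x" "?W x"] by linarith
  qed (use i d_s(2) in \<open>auto simp: sq_int_def\<close>)
  also have "\<dots> = (e t + N t) / 2"
    using d_s(2)[of t] measure_ivl_UNIV[of 1] by (simp add: sq_int_def N_def add_divide_distrib)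
  finally show ?thesis unfolding eq .
qed

lemma potential_bounds:
  assumes t: "0 \<le> t" "t < T"
  shows "k1 / 2 * N t \<le> (\<integral>x. \<Phi> x (th x t) \<partial>ivl 1) - (\<integral>x. \<Phi> x (\<tau>s x) \<partial>ivl 1)"
    "(\<integral>x. \<Phi> x (th x t) \<partial>ivl 1) - (\<integral>x. \<Phi> x (\<tau>s x) \<partial>ivl 1) \<le> k2 / 2 * N t"
proof -
  let ?F = "\<lambda>x. \<Phi> x (th x t) - \<Phi> x (\<tau>s x) + C0 * (th x t - \<tau>s x)"
  have di: "integrable (ivl 1) (\<lambda>x. th x t - \<tau>s x)" by (rule ivl.sq_int_integrable[OF d_s(2)])
  have d2: "integrable (ivl 1) (\<lambda>x. (th x t - \<tau>s x)\<^sup>2)" using d_s(2)[of t] by (simp add: sq_int_def)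
  have "(\<integral>x. ?F x \<partial>ivl 1) = (\<integral>x. \<Phi> x (th x t) - \<Phi> x (\<tau>s x) \<partial>ivl 1) + C0 * (\<integral>x. th x t - \<tau>s x \<partial>ivl 1)"
    using \<Phi>_i \<Phi>\<tau>s_i di by (simp only: Bochner_Integration.integral_add integrable_mult_right integral_mult_right_zero
      Bochner_Integration.integrable_diff)
  then have F: "(\<integral>x. ?F x \<partial>ivl 1) = (\<integral>x. \<Phi> x (th x t) \<partial>ivl 1) - (\<integral>x. \<Phi> x (\<tau>s x) \<partial>ivl 1)"
    using \<Phi>_i \<Phi>\<tau>s_i d_mean[OF t] by simp
  have Fi: "integrable (ivl 1) ?F"
    by (intro Bochner_Integration.integrable_add Bochner_Integration.integrable_diff[OF \<Phi>_i \<Phi>\<tau>s_i] integrable_mult_right di)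
  have b: "AE x in ivl 1. k1 / 2 * (th x t - \<tau>s x)\<^sup>2 \<le> ?F x \<and> ?F x \<le> k2 / 2 * (th x t - \<tau>s x)\<^sup>2"
    using th_mem stationary
  proof eventually_elim
    case (elim x)
    have "P x (\<tau>s x) = C0" using elim by (simp add: P_def)
    moreover have "th x t \<in> {lo'..hi'}" using elim t by blast
    ultimately show ?case using \<Phi>_quadratic[OF _ \<tau>s_mem, of "th x t" x x] by simp
  qed
  have "(\<integral>x. k1 / 2 * (th x t - \<tau>s x)\<^sup>2 \<partial>ivl 1) \<le> (\<integral>x. ?F x \<partial>ivl 1)"
    using b d2 by (intro integral_mono_AE Fi) (auto elim: eventually_mono)
  then show "k1 / 2 * N t \<le> (\<integral>x. \<Phi> x (th x t) \<partial>ivl 1) - (\<integral>x. \<Phi> x (\<tau>s x) \<partial>ivl 1)"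
    unfolding F N_def by simp
  have "(\<integral>x. ?F x \<partial>ivl 1) \<le> (\<integral>x. k2 / 2 * (th x t - \<tau>s x)\<^sup>2 \<partial>ivl 1)"
    using b d2 by (intro integral_mono_AE Fi) (auto elim: eventually_mono)
  then show "(\<integral>x. \<Phi> x (th x t) \<partial>ivl 1) - (\<integral>x. \<Phi> x (\<tau>s x) \<partial>ivl 1) \<le> k2 / 2 * N t"
    unfolding F N_def by simp
qed

lemma L_upper:
  assumes t: "0 \<le> t" "t < T"
  shows "L t \<le> (1 + \<epsilon> + k2) * (e t + N t)"
proof -
  have "\<bar>\<epsilon> * (\<integral>x. (th x t - \<tau>s x) * S x t \<partial>ivl 1)\<bar> \<le> \<epsilon> * ((e t + N t) / 2)"
    using cross_term[OF t] \<epsilon>_bounds(1) by (simp add: abs_mult mult_left_mono)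
  then have "L t \<le> e t / 2 + k2 / 2 * N t + \<epsilon> * ((e t + N t) / 2)"
    using potential_bounds(2)[OF t] unfolding L_def by linarith
  also have "\<dots> \<le> (1 + \<epsilon> + k2) * (e t + N t)"
  proof -
    have "0 \<le> \<epsilon> * e t" "0 \<le> \<epsilon> * N t" "0 \<le> k2 * e t" "0 \<le> k2 * N t"
      using \<epsilon>_bounds(1) k2_nonneg e_nonneg N_nonneg by auto
    then show ?thesis using e_nonneg[of t] N_nonneg[of t]
      unfolding distrib_left distrib_right mult_1_left add_divide_distrib times_divide_eq_right by linarith
  qed
  finally show ?thesis .
qed

lemma L_lower:
  assumes t: "0 \<le> t" "t < T"
  shows "min 1 k1 / 4 * (e t + N t) \<le> L t"
proof -
  have "\<bar>\<epsilon> * (\<integral>x. (th x t - \<tau>s x) * S x t \<partial>ivl 1)\<bar> \<le> \<epsilon> * ((e t + N t) / 2)"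
    using cross_term[OF t] \<epsilon>_bounds(1) by (simp add: abs_mult mult_left_mono)
  then have "e t / 2 + k1 / 2 * N t - \<epsilon> * ((e t + N t) / 2) \<le> L t"
    using potential_bounds(1)[OF t] unfolding L_def by linarith
  moreover have "\<epsilon> * ((e t + N t) / 2) \<le> 1 / 2 * (e t / 2) + k1 / 2 * (N t / 2)"
    using mult_right_mono[OF \<epsilon>_bounds(2), of "e t / 2"] mult_right_mono[OF \<epsilon>_bounds(3), of "N t / 2"]
      e_nonneg[of t] N_nonneg[of t] by (simp add: algebra_simps)
  moreover have "min 1 k1 / 4 * (e t + N t) \<le> 1 / 4 * e t + k1 / 4 * N t"
    using mult_right_mono[of "min 1 k1 / 4" "1 / 4" "e t"] mult_right_mono[of "min 1 k1 / 4" "k1 / 4" "N t"]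
      e_nonneg[of t] N_nonneg[of t] by (simp add: distrib_left)
  ultimately show ?thesis by linarith
qed

lemma D_i: "integrable (ivl T) D"
proof -
  have "integrable (ivl T) diss"
    unfolding diss_def[abs_def] by (rule ivl2_swap(3)[OF diss_i])
  then show ?thesis
    unfolding D_def[abs_def] using ivl2_swap(3)[OF flux_i(1)[OF \<tau>s_m \<tau>s_bounded]] by auto
qed

lemma L_D:
  assumes st: "0 \<le> s" "s \<le> t" "t < T"
  shows "L t - L s \<le> ival T D s t"
proof -
  let ?f = "\<lambda>r. \<integral>x. v x r * S x r + (th x r - \<tau>s x) * \<sigma> x r \<partial>ivl 1"
  have i: "integrable (ivl T) diss" "integrable (ivl T) ?f"
    unfolding diss_def[abs_def] by (rule ivl2_swap(3)[OF diss_i] ivl2_swap(3)[OF flux_i(1)[OF \<tau>s_m \<tau>s_bounded]])+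
  have "ival T D s t = ival T (\<lambda>r. - \<mu> * diss r + - \<epsilon> * ?f r) s t" by (simp add: D_def[abs_def])
  also have "\<dots> = - \<mu> * ival T diss s t + - \<epsilon> * ival T ?f s t"
    using i by (subst ival_add) (simp_all only: ival_mult integrable_mult_right)
  finally have D: "ival T D s t = - \<mu> * ival T diss s t + - \<epsilon> * ival T ?f s t" .
  have "ival T (\<lambda>r. \<mu> * diss r) s t = \<mu> * ival T diss s t" by (rule ival_mult)
  with energy[OF st] have "(e t / 2 + (\<integral>x. \<Phi> x (th x t) \<partial>ivl 1)) - (e s / 2 + (\<integral>x. \<Phi> x (th x s) \<partial>ivl 1))
    \<le> - \<mu> * ival T diss s t" by simp
  moreover have "\<epsilon> * (\<integral>x. (th x t - \<tau>s x) * S x t \<partial>ivl 1) - \<epsilon> * (\<integral>x. (th x s - \<tau>s x) * S x s \<partial>ivl 1)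
     = \<epsilon> * ival T ?f s t"
    using flux_identity[OF \<tau>s_m \<tau>s_bounded st] by (simp add: right_diff_distrib[symmetric])
  ultimately show ?thesis unfolding D L_def mult_minus_left by linarith
qed

lemma e_poincare: "AE r in ivl T. e r \<le> (\<integral>x. (v x r)\<^sup>2 \<partial>ivl 1)"
  using slices(1) w_v AE_ivl_mem[of T]
proof eventually_elim
  case (elim r)
  have "e r \<le> (\<integral>x. (\<integral>y. (v y r)\<^sup>2 \<partial>ivl 1) \<partial>ivl 1)"
    unfolding e_def
  proof (rule integral_mono_AE)
    show "AE x in ivl 1. (w r x)\<^sup>2 \<le> (\<integral>y. (v y r)\<^sup>2 \<partial>ivl 1)"
      using elim(2)
    proof eventually_elim
      case (elim x)
      then show ?case using ival_square_le[OF \<open>sq_int (ivl 1) (\<lambda>x. v x r)\<close>, of 0 x] by simp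
    qed
  qed (use w_s[of r] elim in \<open>auto simp: sq_int_def\<close>)
  also have "\<dots> = (\<integral>y. (v y r)\<^sup>2 \<partial>ivl 1)" using measure_ivl_UNIV[of 1] by simp
  finally show ?case .
qed

lemma dissipation_flux:
  assumes r: "0 \<le> r" "r < T" and vs: "sq_int (ivl 1) (\<lambda>x. v x r)" and \<sigma>s: "sq_int (ivl 1) (\<lambda>x. \<sigma> x r)"
  shows "- (\<integral>x. (th x r - \<tau>s x) * \<sigma> x r \<partial>ivl 1) \<le> \<kappa> * (\<integral>x. (v x r)\<^sup>2 \<partial>ivl 1) - k1 / 2 * N r"
proof -
  let ?d = "\<lambda>x. th x r - \<tau>s x"
  have i: "integrable (ivl 1) (\<lambda>x. ?d x * \<sigma> x r)" "integrable (ivl 1) ?d"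
    "integrable (ivl 1) (\<lambda>x. (?d x)\<^sup>2)" "integrable (ivl 1) (\<lambda>x. (v x r)\<^sup>2)"
    using sq_int_mult[OF d_s(2) \<sigma>s] ivl.sq_int_integrable[OF d_s(2)] d_s(2)[of r] vs by (auto simp: sq_int_def)
  have "- (\<integral>x. ?d x * \<sigma> x r \<partial>ivl 1) = (\<integral>x. - 1 * (?d x * \<sigma> x r) + - C0 * ?d x \<partial>ivl 1)"
    using i d_mean[OF r]
    by (simp only: Bochner_Integration.integral_add integrable_mult_right integral_mult_right_zero)
  also have "\<dots> \<le> (\<integral>x. \<kappa> * (v x r)\<^sup>2 + - (k1 / 2) * (?d x)\<^sup>2 \<partial>ivl 1)"
  proof (rule integral_mono_AE)
    show "AE x in ivl 1. - 1 * (?d x * \<sigma> x r) + - C0 * ?d x \<le> \<kappa> * (v x r)\<^sup>2 + - (k1 / 2) * (?d x)\<^sup>2"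
      using th_mem stationary
    proof eventually_elim
      case (elim x)
      have mem: "th x r \<in> {lo'..hi'}" using elim r by blast
      have C0: "P x (\<tau>s x) = C0" using elim by (simp add: P_def)
      have "\<bar>(\<mu> * v x r / th x r) * ?d x\<bar> \<le> (\<mu> * v x r / th x r)\<^sup>2 / (2 * k1) + k1 * (?d x)\<^sup>2 / 2"
        by (rule young[OF k1_pos])
      moreover have "(\<mu> * v x r / th x r)\<^sup>2 / (2 * k1) \<le> \<kappa> * (v x r)\<^sup>2"
      proof -
        have "(\<mu> * v x r)\<^sup>2 / (th x r)\<^sup>2 \<le> (\<mu> * v x r)\<^sup>2 / lo'\<^sup>2"
          using mem lo'_pos by (intro divide_left_mono power_mono) auto
        then have "(\<mu> * v x r / th x r)\<^sup>2 / (2 * k1) \<le> (\<mu> * v x r)\<^sup>2 / lo'\<^sup>2 / (2 * k1)"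
          using k1_pos by (subst power_divide, intro divide_right_mono) auto
        then show ?thesis by (simp add: \<kappa>_def power_mult_distrib mult.commute mult.left_commute)
      qed
      moreover have "k1 * (?d x)\<^sup>2 \<le> (C0 - P x (th x r)) * ?d x"
        using P_monotone(1)[OF mem \<tau>s_mem, of x x] C0 by simp
      moreover have "- 1 * (?d x * \<sigma> x r) + - C0 * ?d x = - ((\<mu> * v x r / th x r) * ?d x) - (C0 - P x (th x r)) * ?d x"
        unfolding \<sigma>_def by (simp only: times_divide_eq_left[symmetric]) (simp only: ring_distribs mult_minus_left mult_minus_right, simp)
      ultimately show ?case by linarith
    qed
  qed (use i in \<open>auto intro!: Bochner_Integration.integrable_add integrable_mult_right simp del: mult_minus_left mult_minus1\<close>)
  also have "\<dots> = \<kappa> * (\<integral>x. (v x r)\<^sup>2 \<partial>ivl 1) - k1 / 2 * N r"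
    using i by (simp only: Bochner_Integration.integral_add integrable_mult_right integral_mult_right_zero N_def)
  finally show ?thesis .
qed

lemma D_le: "AE r in ivl T. D r \<le> - \<delta>\<^sub>0 * (e r + N r)"
  using v_S slices e_poincare AE_ivl_mem[of T]
proof eventually_elim
  case (elim r)
  then have r: "0 \<le> r" "r < T" by auto
  define B where "B = (\<integral>x. (v x r)\<^sup>2 \<partial>ivl 1)"
  have vs: "sq_int (ivl 1) (\<lambda>x. v x r)" and \<sigma>s: "sq_int (ivl 1) (\<lambda>x. \<sigma> x r)" and Ss: "sq_int (ivl 1) (\<lambda>x. S x r)"
    using elim by auto
  have B: "e r \<le> B" using elim by (simp add: B_def)
  have v2: "integrable (ivl 1) (\<lambda>x. (v x r)\<^sup>2)" using vs by (simp add: sq_int_def)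
  have "(\<integral>x. v x r * S x r + (th x r - \<tau>s x) * \<sigma> x r \<partial>ivl 1) = - e r + (\<integral>x. (th x r - \<tau>s x) * \<sigma> x r \<partial>ivl 1)"
    using elim(1) sq_int_mult[OF vs Ss] sq_int_mult[OF d_s(2) \<sigma>s] by simp
  then have flux: "- (\<integral>x. v x r * S x r + (th x r - \<tau>s x) * \<sigma> x r \<partial>ivl 1) \<le> B + \<kappa> * B - k1 / 2 * N r"
    using dissipation_flux[OF r vs \<sigma>s] B by (simp add: B_def)
  have "B / hi' \<le> diss r"
  proof -
    have "(\<integral>x. (1 / hi') * (v x r)\<^sup>2 \<partial>ivl 1) \<le> diss r"
      unfolding diss_def
    proof (rule integral_mono_AE)
      show "integrable (ivl 1) (\<lambda>x. (v x r)\<^sup>2 / th x r)"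
      proof (rule Bochner_Integration.integrable_bound)
        show "integrable (ivl 1) (\<lambda>x. (1 / c) * (v x r)\<^sup>2)" using v2 by simp
        show "AE x in ivl 1. norm ((v x r)\<^sup>2 / th x r) \<le> norm (1 / c * (v x r)\<^sup>2)"
        proof (intro AE_I2)
          fix x show "norm ((v x r)\<^sup>2 / th x r) \<le> norm (1 / c * (v x r)\<^sup>2)"
            using mult_right_mono[OF inv_th[of x r], of "(v x r)\<^sup>2"] c(1) th_pos[of x r] by simp
        qed
      qed simp
      show "AE x in ivl 1. (1 / hi') * (v x r)\<^sup>2 \<le> (v x r)\<^sup>2 / th x r"
        using th_mem
      proof eventually_elim
        case (elim x)
        then have "th x r \<le> hi'" using r by auto
        then show ?case using th_pos[of x r] hi'_pos by (simp add: divide_left_mono)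
      qed
    qed (use v2 in simp)
    then show ?thesis by (simp add: B_def)
  qed
  then have "\<mu> * (B / hi') \<le> \<mu> * diss r" using \<mu> by (intro mult_left_mono) auto
  moreover have "\<epsilon> * - (\<integral>x. v x r * S x r + (th x r - \<tau>s x) * \<sigma> x r \<partial>ivl 1) \<le> \<epsilon> * (B + \<kappa> * B - k1 / 2 * N r)"
    using \<epsilon>_bounds(1) flux by (intro mult_left_mono) auto
  moreover have "\<epsilon> * (B + \<kappa> * B - k1 / 2 * N r) \<le> \<mu> / (2 * hi') * B - \<epsilon> * k1 / 2 * N r"
    using mult_right_mono[OF \<epsilon>_bounds(4), of B] B e_nonneg[of r] by (simp add: algebra_simps)
  moreover have "\<mu> * (B / hi') = 2 * (\<mu> / (2 * hi') * B)" by simp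
  ultimately have "D r \<le> - (\<mu> / (2 * hi') * B) - \<epsilon> * k1 / 2 * N r"
    unfolding D_def mult_minus_right by linarith
  moreover have "\<delta>\<^sub>0 * e r \<le> \<mu> / (2 * hi') * B"
    using \<delta>\<^sub>0_pos e_nonneg[of r] B by (intro mult_mono) (auto simp: \<delta>\<^sub>0_def)
  moreover have "\<delta>\<^sub>0 * N r \<le> \<epsilon> * k1 / 2 * N r"
    using N_nonneg[of r] by (intro mult_right_mono) (auto simp: \<delta>\<^sub>0_def)
  ultimately show ?case unfolding distrib_left mult_minus_left by linarith
qed

lemma L_antimono:
  assumes st: "0 \<le> s" "s \<le> t" "t < T"
  shows "L t \<le> L s"
proof -
  have "ival T D s t \<le> ival T (\<lambda>_. 0) s t"
  proof (rule ival_mono_AE[OF D_i])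
    show "AE r in ivl T. s < r \<and> r \<le> t \<longrightarrow> D r \<le> 0"
      using D_le
    proof eventually_elim
      case (elim r)
      have "0 \<le> \<delta>\<^sub>0 * (e r + N r)" using \<delta>\<^sub>0_pos e_nonneg N_nonneg by simp
      then show ?case using elim by simp
    qed
  qed simp
  then show ?thesis using L_D[OF st] by (simp add: ival_def)
qed

lemma L_step:
  assumes st: "0 \<le> s" "s \<le> t" "t < T"
  shows "L t - L s \<le> - \<delta> * (t - s) * L t"
proof -
  have "ival T D s t \<le> ival T (\<lambda>_. - \<delta> * L t) s t"
  proof (rule ival_mono_AE[OF D_i])
    show "AE r in ivl T. s < r \<and> r \<le> t \<longrightarrow> D r \<le> - \<delta> * L t"
      using D_le
    proof eventually_elim
      case (elim r)
      show ?case
      proof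
        assume r: "s < r \<and> r \<le> t"
        have k: "0 < 1 + \<epsilon> + k2" using \<epsilon>_bounds(1) k2_nonneg by simp
        have "L t \<le> L r" using L_antimono[of r t] r st by simp
        also have "\<dots> \<le> (1 + \<epsilon> + k2) * (e r + N r)" using L_upper[of r] r st by simp
        finally have "\<delta> * L t \<le> \<delta> * ((1 + \<epsilon> + k2) * (e r + N r))"
          using \<delta>_pos by (intro mult_left_mono) auto
        also have "\<dots> = \<delta>\<^sub>0 * (e r + N r)" using k by (simp add: \<delta>_def)
        finally show "D r \<le> - \<delta> * L t" using elim by simp
      qed
    qed
  qed simp
  then show ?thesis using L_D[OF st] ival_const[of s t T "- \<delta> * L t"] st by (simp add: mult.commute mult.left_commute)
qed

lemma decay:
  assumes t: "0 \<le> t" "t < T"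
  shows "e t + N t \<le> 4 * L\<^sub>0 / min 1 k1 * exp (- \<delta> * t)"
proof -
  have "min 1 k1 / 4 * (e t + N t) \<le> exp (- \<delta> * t) * L\<^sub>0"
    using L_lower[OF t] exponential_decay[OF L_step \<delta>_pos t] by (simp add: L_0)
  moreover have "0 < min 1 k1" using k1_pos by simp
  ultimately show ?thesis by (simp add: field_simps)
qed

end

section \<open>From Lebesgue to Borel measurable representatives\<close>

lemma AE_lebesgue_on_borel:
  assumes "S \<in> sets borel"
  shows "(AE x in lebesgue_on S. R x) \<longleftrightarrow> (AE x in lborel. x \<in> S \<longrightarrow> R x)"
  using assms by (subst AE_restrict_space_iff) (auto simp: AE_completion_iff)

lemma AE_dens:
  assumes "S \<in> sets borel"
  shows "(AE x in density lborel (indicator S). R x) \<longleftrightarrow> (AE x in lborel. x \<in> S \<longrightarrow> R x)"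
  using assms by (subst AE_density) (auto simp: indicator_def)

lemma ivl2_dens: "ivl2 T = density lborel (indicator ({0<..<1} \<times> {0<..<T}))"
proof -
  have "ivl2 T = density (lborel \<Otimes>\<^sub>M lborel) (\<lambda>(x, y). indicator {0<..<1} x * indicator {0<..<T} y)"
    unfolding ivl_def
    by (rule pair_measure_density)
      (auto simp: ivl_def[symmetric] lborel.sigma_finite_measure_axioms ivl.sigma_finite_measure_axioms)
  also have "(\<lambda>(x, y). indicator {0<..<1} x * indicator {0<..<T} y) = (indicator ({0<..<1} \<times> {0<..<T}) :: _ \<Rightarrow> ennreal)"
    by (auto simp: indicator_def fun_eq_iff)
  finally show ?thesis by (simp add: lborel_prod)
qed

lemma sets_ivl2: "sets (ivl2 T) = sets (borel \<Otimes>\<^sub>M borel)"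
  by (rule sets_pair_measure_cong) simp_all

lemma leb_transfer:
  fixes f g :: "'a::euclidean_space \<Rightarrow> real"
  assumes S: "S \<in> sets borel" and [measurable]: "g \<in> borel_measurable borel"
    and fg: "AE x in density lborel (indicator S). f x = g x"
  shows "f \<in> borel_measurable (lebesgue_on S)"
    "integrable (lebesgue_on S) f \<longleftrightarrow> integrable (density lborel (indicator S)) g"
    "(\<integral>x. f x \<partial>lebesgue_on S) = (\<integral>x. g x \<partial>density lborel (indicator S))"
proof -
  note [measurable] = S
  have ae: "AE x in lebesgue. indicator S x * g x = indicator S x * f x"
    using fg by (auto simp: AE_completion_iff AE_dens[OF S] elim!: eventually_mono)
  have gm: "(\<lambda>x. indicator S x * g x) \<in> borel_measurable lebesgue"
    by (intro measurable_completion) measurable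
  have fm: "(\<lambda>x. indicator S x * f x) \<in> borel_measurable lebesgue"
    by (rule borel_measurable_AE[OF gm ae])
  have "(\<lambda>x. indicator S x * f x) = (\<lambda>x. if x \<in> S then f x else 0)" by auto
  with fm have "(\<lambda>x. if x \<in> S then f x else 0) \<in> borel_measurable lebesgue" by simp
  then show "f \<in> borel_measurable (lebesgue_on S)" by (rule borel_measurable_if_D)
  have eq: "integrable lebesgue (\<lambda>x. indicator S x * f x) \<longleftrightarrow> integrable lebesgue (\<lambda>x. indicator S x * g x)"
    "(\<integral>x. indicator S x * f x \<partial>lebesgue) = (\<integral>x. indicator S x * g x \<partial>lebesgue)"
    using integrable_cong_AE[OF gm fm ae] integral_cong_AE[OF gm fm ae] by simp_all
  have d: "density lborel (indicator S) = density lborel (\<lambda>x. ennreal (indicator S x))"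
    by (simp add: ennreal_indicator)
  show "integrable (lebesgue_on S) f \<longleftrightarrow> integrable (density lborel (indicator S)) g"
    using S eq(1) unfolding d by (simp add: integrable_restrict_space integrable_completion integrable_density)
  show "(\<integral>x. f x \<partial>lebesgue_on S) = (\<integral>x. g x \<partial>density lborel (indicator S))"
    using S eq(2) unfolding d by (simp add: integral_restrict_space integral_completion integral_density)
qed

lemma borel_representative:
  fixes f :: "'a::euclidean_space \<Rightarrow> real"
  assumes S: "S \<in> sets borel" and f: "f \<in> borel_measurable (lebesgue_on S)"
  obtains g where "g \<in> borel_measurable borel" "AE x in density lborel (indicator S). f x = g x"
proof -
  have "(\<lambda>x. if x \<in> S then f x else 0) \<in> borel_measurable lebesgue"
    using f S by (subst borel_measurable_if) auto
  then obtain g where "g \<in> borel_measurable lborel" "AE x in lborel. (if x \<in> S then f x else 0) = g x"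
    using completion_ex_borel_measurable_real by blast
  then show thesis
    using S by (intro that[of g]) (auto simp: AE_dens elim!: eventually_mono split: if_splits)
qed

lemma in_L2_representative:
  fixes f :: "'a::euclidean_space \<Rightarrow> real"
  assumes S: "S \<in> sets borel" and f: "in_L2 S f"
  obtains g where "sq_int (density lborel (indicator S)) g" "AE x in density lborel (indicator S). f x = g x"
proof -
  have "f \<in> borel_measurable (lebesgue_on S)" using f by (simp add: in_L2_def)
  from borel_representative[OF S this] obtain g
    where g: "g \<in> borel_measurable borel" "AE x in density lborel (indicator S). f x = g x" by blast
  from g(2) have "AE x in density lborel (indicator S). (f x)\<^sup>2 = (g x)\<^sup>2" by eventually_elim simp
  then have "integrable (density lborel (indicator S)) (\<lambda>x. (g x)\<^sup>2)"
    using leb_transfer(2)[OF S, of "\<lambda>x. (g x)\<^sup>2" "\<lambda>x. (f x)\<^sup>2"] f g(1) by (simp add: in_L2_def)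
  then show thesis using g by (intro that[of g]) (auto simp: sq_int_def)
qed

lemma L2_norm_representative:
  fixes f :: "real \<Rightarrow> real"
  assumes "sq_int (ivl T) g" "AE x in ivl T. f x = g x"
  shows "L2_norm {0<..<T} f = sqrt (\<integral>x. (g x)\<^sup>2 \<partial>ivl T)" "in_L2 {0<..<T} f"
proof -
  have [measurable]: "g \<in> borel_measurable borel" using assms by (auto simp: sq_int_def)
  have ae: "AE x in ivl T. (f x)\<^sup>2 = (g x)\<^sup>2" using assms(2) by eventually_elim simp
  have S: "{0<..<T} \<in> sets borel" by simp
  show "L2_norm {0<..<T} f = sqrt (\<integral>x. (g x)\<^sup>2 \<partial>ivl T)"
    unfolding L2_norm_def ivl_def
    by (subst leb_transfer(3)[OF S _ ae[unfolded ivl_def]]) auto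
  show "in_L2 {0<..<T} f"
    unfolding in_L2_def
    using leb_transfer(1)[OF S _ assms(2)[unfolded ivl_def]] leb_transfer(2)[OF S _ ae[unfolded ivl_def]] assms(1)
    by (simp add: ivl_def sq_int_def)
qed

lemma AE_lebesgue_on_ivl: "(AE x in lebesgue_on {0<..<T}. R x) \<longleftrightarrow> (AE x in ivl T. R x)"
  unfolding ivl_def by (simp add: AE_lebesgue_on_borel AE_dens)

lemma AE_lebesgue_on_ivl2: "(AE p in lebesgue_on ({0<..<1} \<times> {0<..<T}). R p) \<longleftrightarrow> (AE p in ivl2 T. R p)"
proof -
  have "{0<..<1::real} \<times> {0<..<T} \<in> sets borel" by (intro borel_open open_Times open_greaterThanLessThan)
  then show ?thesis unfolding ivl2_dens by (simp add: AE_lebesgue_on_borel AE_dens)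
qed

lemma ivl2_L2_representative:
  assumes "in_L2 ({0<..<1} \<times> {0<..<T}) f"
  obtains g :: "real \<Rightarrow> real \<Rightarrow> real"
  where "case_prod g \<in> borel_measurable (borel \<Otimes>\<^sub>M borel)" "sq_int (ivl2 T) (case_prod g)"
    "AE p in ivl2 T. f p = case_prod g p"
proof -
  have S: "{0<..<1::real} \<times> {0<..<T} \<in> sets borel" by (intro borel_open open_Times open_greaterThanLessThan)
  obtain g where g: "sq_int (ivl2 T) g" "AE p in ivl2 T. f p = g p"
    using in_L2_representative[OF S assms] unfolding ivl2_dens by blast
  then have "g \<in> borel_measurable (borel \<Otimes>\<^sub>M borel)"
    using measurable_cong_sets[OF sets_ivl2 refl] by (auto simp: sq_int_def)
  then show thesis using g by (intro that[of "curry g"]) auto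
qed

lemma AE_ivl2_slices:
  assumes "AE p in ivl2 T. R p"
  shows "AE x in ivl 1. AE t in ivl T. R (x, t)" "AE t in ivl T. AE x in ivl 1. R (x, t)"
proof -
  show "AE x in ivl 1. AE t in ivl T. R (x, t)" by (rule ivl2.AE_pair[OF assms])
  obtain N where N: "{p \<in> space (ivl2 T). \<not> R p} \<subseteq> N" "N \<in> sets (ivl2 T)" "emeasure (ivl2 T) N = 0"
    using assms by (elim AE_E) auto
  have "AE p in ivl2 T. p \<notin> N" using N by (intro AE_not_in) auto
  then have "AE x in ivl 1. AE t in ivl T. (x, t) \<notin> N" by (rule ivl2.AE_pair)
  moreover have "{p \<in> space (ivl2 T). (fst p, snd p) \<notin> N} \<in> sets (ivl2 T)"
  proof -
    have "{p \<in> space (ivl2 T). (fst p, snd p) \<notin> N} = space (ivl2 T) - N" by auto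
    then show ?thesis using sets.compl_sets[OF N(2)] by simp
  qed
  ultimately have "AE t in ivl T. AE x in ivl 1. (x, t) \<notin> N"
    using ivl2.AE_commute[of 1 T "\<lambda>x t. (x, t) \<notin> N"] by simp
  then show "AE t in ivl T. AE x in ivl 1. R (x, t)"
    using N(1) by (elim eventually_mono) (auto simp: space_pair_measure)
qed

lemma AE_ivl2_I:
  fixes f g :: "real \<Rightarrow> real \<Rightarrow> real"
  assumes "case_prod f \<in> borel_measurable (borel \<Otimes>\<^sub>M borel)" "case_prod g \<in> borel_measurable (borel \<Otimes>\<^sub>M borel)"
    and ae: "AE t in ivl T. AE x in ivl 1. f x t = g x t"
  shows "AE p in ivl2 T. case_prod f p = case_prod g p"
proof -
  have "(\<lambda>p. f (fst p) (snd p)) \<in> borel_measurable (ivl2 T)" "(\<lambda>p. g (fst p) (snd p)) \<in> borel_measurable (ivl2 T)"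
    using assms(1,2) measurable_cong_sets[OF sets_ivl2 refl] by (auto simp: case_prod_unfold)
  then have s: "{p \<in> space (ivl2 T). f (fst p) (snd p) = g (fst p) (snd p)} \<in> sets (ivl2 T)"
    by (rule borel_measurable_eq)
  have "AE x in ivl 1. AE t in ivl T. f x t = g x t"
    using ae ivl2.AE_commute[OF s] by simp
  then show ?thesis
    using ivl2.AE_pair_iff[OF s] by (simp add: case_prod_unfold)
qed

lemma Cauchy_Schwarz_square:
  assumes f: "sq_int M f" and g: "sq_int M g"
  shows "(\<integral>x. f x * g x \<partial>M)\<^sup>2 \<le> (\<integral>x. (f x)\<^sup>2 \<partial>M) * (\<integral>x. (g x)\<^sup>2 \<partial>M)"
proof -
  define F where "F = (\<integral>x. (f x)\<^sup>2 \<partial>M)"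
  define G where "G = (\<integral>x. (g x)\<^sup>2 \<partial>M)"
  define I where "I = (\<integral>x. f x * g x \<partial>M)"
  have G: "0 \<le> G" unfolding G_def by (intro integral_nonneg_AE) auto
  show ?thesis
  proof (cases "G = 0")
    case True
    then have "AE x in M. g x = 0"
      using g unfolding G_def by (subst (asm) integral_nonneg_eq_0_iff_AE) (auto simp: sq_int_def)
    then have "I = 0" unfolding I_def by (intro integral_eq_zero_AE) (auto elim: eventually_mono)
    then show ?thesis using True by (simp add: I_def G_def)
  next
    case False
    have "0 \<le> (\<integral>x. (f x - (I / G) * g x)\<^sup>2 \<partial>M)" by (intro integral_nonneg_AE) auto
    also have "\<dots> = (\<integral>x. (f x)\<^sup>2 + (I / G)\<^sup>2 * (g x)\<^sup>2 - 2 * (I / G) * (f x * g x) \<partial>M)"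
      by (intro Bochner_Integration.integral_cong) (auto simp: power2_eq_square algebra_simps)
    also have "\<dots> = F + (I / G)\<^sup>2 * G - 2 * (I / G) * I"
      using f g sq_int_mult[OF f g] by (simp add: sq_int_def F_def G_def I_def)
    also have "\<dots> = F - I\<^sup>2 / G" using False by (simp add: field_simps power2_eq_square)
    finally show ?thesis
      using G False unfolding F_def[symmetric] G_def[symmetric] I_def[symmetric] by (simp add: field_simps)
  qed
qed

definition nrm :: "'a measure \<Rightarrow> ('a \<Rightarrow> real) \<Rightarrow> real" where
  "nrm M f = sqrt (\<integral>x. (f x)\<^sup>2 \<partial>M)"

lemma nrm_nonneg: "0 \<le> nrm M f"
  unfolding nrm_def by (intro real_sqrt_ge_zero integral_nonneg_AE) auto

lemma nrm_square: "(nrm M f)\<^sup>2 = (\<integral>x. (f x)\<^sup>2 \<partial>M)"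
  unfolding nrm_def by (intro real_sqrt_pow2 integral_nonneg_AE) auto

lemma Cauchy_Schwarz: "\<lbrakk>sq_int M f; sq_int M g\<rbrakk> \<Longrightarrow> \<bar>\<integral>x. f x * g x \<partial>M\<bar> \<le> nrm M f * nrm M g"
  using Cauchy_Schwarz_square[of M f g] nrm_nonneg[of M f] nrm_nonneg[of M g]
  by (auto intro!: power2_le_imp_le[of "\<bar>_\<bar>" "_ * _"] simp: power_mult_distrib nrm_square)

lemma nrm_triangle:
  assumes f: "sq_int M f" and g: "sq_int M g"
  shows "nrm M (\<lambda>x. f x + g x) \<le> nrm M f + nrm M g"
proof (rule power2_le_imp_le)
  have "(nrm M (\<lambda>x. f x + g x))\<^sup>2 = (\<integral>x. (f x)\<^sup>2 + (g x)\<^sup>2 + 2 * (f x * g x) \<partial>M)"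
    unfolding nrm_square by (intro Bochner_Integration.integral_cong) (auto simp: power2_eq_square algebra_simps)
  also have "\<dots> = (nrm M f)\<^sup>2 + (nrm M g)\<^sup>2 + 2 * (\<integral>x. f x * g x \<partial>M)"
    using f g sq_int_mult[OF f g] by (simp add: sq_int_def nrm_square)
  also have "\<dots> \<le> (nrm M f + nrm M g)\<^sup>2"
    using Cauchy_Schwarz[OF f g] by (simp add: power2_eq_square algebra_simps)
  finally show "(nrm M (\<lambda>x. f x + g x))\<^sup>2 \<le> (nrm M f + nrm M g)\<^sup>2" .
qed (use nrm_nonneg in \<open>auto intro: add_nonneg_nonneg\<close>)

lemma nrm_cong: "\<lbrakk>AE x in M. f x = g x; f \<in> borel_measurable M; g \<in> borel_measurable M\<rbrakk> \<Longrightarrow> nrm M f = nrm M g"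
  unfolding nrm_def by (intro arg_cong[of _ _ sqrt] integral_cong_AE) (auto elim: eventually_mono)

lemma nrm_diff_commute: "nrm M (\<lambda>x. f x - g x) = nrm M (\<lambda>x. g x - f x)"
  by (simp add: nrm_def power2_commute)

lemma nrm_diff:
  assumes f: "sq_int M f" and g: "sq_int M g"
  shows "\<bar>nrm M f - nrm M g\<bar> \<le> nrm M (\<lambda>x. f x - g x)"
  using nrm_triangle[OF g sq_int_diff[OF f g]] nrm_triangle[OF f sq_int_diff[OF g f]]
    nrm_diff_commute[of M f g] by simp

lemma nrm_eq_0: "\<lbrakk>sq_int M f; nrm M f = 0\<rbrakk> \<Longrightarrow> AE x in M. f x = 0"
  unfolding nrm_def by (simp, subst (asm) integral_nonneg_eq_0_iff_AE) (auto simp: sq_int_def)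

lemma nrm_primitive_le:
  assumes "sq_int (ivl 1) f"
  shows "\<bar>ival 1 f a b\<bar> \<le> nrm (ivl 1) f"
proof -
  have "(ival 1 f a b)\<^sup>2 \<le> (nrm (ivl 1) f)\<^sup>2"
    using ival_square_le[OF assms, of a b] by (simp add: nrm_square)
  then show ?thesis using nrm_nonneg[of "ivl 1" f] abs_le_square_iff[of "ival 1 f a b" "nrm (ivl 1) f"] by simp
qed

lemma nrm_le_const:
  assumes [measurable]: "f \<in> borel_measurable borel" and f: "AE x in ivl 1. \<bar>f x\<bar> \<le> B" and "0 \<le> B"
  shows "nrm (ivl 1) f \<le> B"
proof -
  have "sq_int (ivl 1) f" by (rule ivl.sq_int_bounded[OF _ f]) simp
  then have "(\<integral>x. (f x)\<^sup>2 \<partial>ivl 1) \<le> (\<integral>x. B\<^sup>2 \<partial>ivl 1)"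
    using f \<open>0 \<le> B\<close>
    by (intro integral_mono_AE) (auto simp: sq_int_def abs_le_square_iff[symmetric] elim: eventually_mono)
  then show ?thesis unfolding nrm_def using \<open>0 \<le> B\<close> measure_ivl_UNIV[of 1] by (simp add: real_le_lsqrt)
qed

lemma L2_norm_nrm:
  assumes "sq_int (ivl 1) g" "AE x in ivl 1. f x = g x"
  shows "L2_norm \<Omega> f = nrm (ivl 1) g"
  using L2_norm_representative(1)[OF assms] by (simp add: nrm_def)

lemma test_function_sq_int:
  assumes "test_function U \<phi>"
  shows "sq_int (ivl T) \<phi>" "sq_int (ivl T) (deriv \<phi>)"
proof -
  have "continuous_on UNIV \<phi>" "continuous_on UNIV (deriv \<phi>)"
    using test_function_continuous[OF assms] test_function_continuous[OF test_function_deriv_test[OF assms]] .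
  then show "sq_int (ivl T) \<phi>" "sq_int (ivl T) (deriv \<phi>)"
    by (auto intro!: integrable_continuous_interval borel_measurable_continuous_onI intro: continuous_on_subset)
qed

lemma H1_0_primitive:
  assumes H: "H1_0 f g" and gB: "sq_int (ivl 1) gB" "AE x in ivl 1. g x = gB x"
  shows "(\<integral>x. gB x \<partial>ivl 1) = 0" "AE x in ivl 1. f x = ival 1 gB 0 x"
proof -
  have gi: "integrable (ivl 1) gB" by (rule ivl.sq_int_integrable[OF gB(1)])
  have [measurable]: "gB \<in> borel_measurable borel" using gi by auto
  have "in_L2 \<Omega> f" using H by (auto simp: H1_0_def weak_deriv_def)
  then obtain fB where fB: "sq_int (ivl 1) fB" "AE x in ivl 1. f x = fB x"
    using in_L2_representative[of \<Omega> f] unfolding ivl_def by auto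
  obtain \<phi> where \<phi>: "\<And>n::nat. test_function \<Omega> (\<phi> n)"
    and lim: "(\<lambda>n. L2_norm \<Omega> (\<lambda>x. \<phi> n x - f x)) \<longlonglongrightarrow> 0" "(\<lambda>n. L2_norm \<Omega> (\<lambda>x. deriv (\<phi> n) x - g x)) \<longlonglongrightarrow> 0"
    using H by (auto simp: H1_0_def)
  note s = test_function_sq_int[OF \<phi>, where T = 1]
  have di: "integrable (ivl 1) (deriv (\<phi> n))" for n by (rule ivl.sq_int_integrable[OF s(2)])
  have L: "L2_norm \<Omega> (\<lambda>x. \<phi> n x - f x) = nrm (ivl 1) (\<lambda>x. \<phi> n x - fB x)"
    "L2_norm \<Omega> (\<lambda>x. deriv (\<phi> n) x - g x) = nrm (ivl 1) (\<lambda>x. deriv (\<phi> n) x - gB x)" for n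
    using fB gB by (auto intro!: L2_norm_nrm sq_int_diff s elim: eventually_mono)
  have prim: "\<bar>\<phi> n x - ival 1 gB 0 x\<bar> \<le> nrm (ivl 1) (\<lambda>x. deriv (\<phi> n) x - gB x)" if "0 \<le> x" "x \<le> 1" for n x
  proof -
    have "\<phi> n x - ival 1 gB 0 x = ival 1 (\<lambda>x. deriv (\<phi> n) x - gB x) 0 x"
      using test_function_ivl(3)[OF \<phi> _ that] di gi by (simp add: ival_diff)
    then show ?thesis using nrm_primitive_le[OF sq_int_diff[OF s(2) gB(1)]] by simp
  qed
  have lim': "(\<lambda>n. nrm (ivl 1) (\<lambda>x. \<phi> n x - fB x)) \<longlonglongrightarrow> 0" "(\<lambda>n. nrm (ivl 1) (\<lambda>x. deriv (\<phi> n) x - gB x)) \<longlonglongrightarrow> 0"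
    using lim by (simp_all add: L)
  have "\<bar>ival 1 gB 0 1\<bar> \<le> 0"
  proof (rule LIMSEQ_le_const[OF lim'(2)])
    have "\<phi> n 1 = 0" for n using test_function_outside[OF \<phi>, of 1 n] by simp
    then show "\<exists>N. \<forall>n\<ge>N. \<bar>ival 1 gB 0 1\<bar> \<le> nrm (ivl 1) (\<lambda>x. deriv (\<phi> n) x - gB x)"
      using prim[of 1] by simp
  qed
  then show "(\<integral>x. gB x \<partial>ivl 1) = 0" by (simp add: ival_all)
  have Pm [measurable]: "ival 1 gB 0 \<in> borel_measurable borel"
    using ival_continuous[OF gi, of UNIV 0] by (rule borel_measurable_continuous_onI)
  have Ps: "sq_int (ivl 1) (ival 1 gB 0)"
    by (intro integrable_continuous_interval ival_continuous[OF gi] Pm)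
  have "nrm (ivl 1) (\<lambda>x. fB x - ival 1 gB 0 x) \<le> 0 + 0"
  proof (rule LIMSEQ_le_const[OF tendsto_add[OF lim']], intro exI allI impI)
    fix n :: nat
    have "nrm (ivl 1) (\<lambda>x. fB x - ival 1 gB 0 x) \<le> nrm (ivl 1) (\<lambda>x. fB x - \<phi> n x) + nrm (ivl 1) (\<lambda>x. \<phi> n x - ival 1 gB 0 x)"
      using nrm_triangle[OF sq_int_diff[OF fB(1) s(1)] sq_int_diff[OF s(1) Ps], of n n] by simp
    also have "nrm (ivl 1) (\<lambda>x. \<phi> n x - ival 1 gB 0 x) \<le> nrm (ivl 1) (\<lambda>x. deriv (\<phi> n) x - gB x)"
      using prim[of _ n] s(1)[of n] by (intro nrm_le_const nrm_nonneg eventually_mono[OF AE_ivl_mem]) (auto simp: sq_int_def)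
    finally show "nrm (ivl 1) (\<lambda>x. fB x - ival 1 gB 0 x) \<le> nrm (ivl 1) (\<lambda>x. \<phi> n x - fB x) + nrm (ivl 1) (\<lambda>x. deriv (\<phi> n) x - gB x)"
      by (simp add: nrm_diff_commute[of _ fB])
  qed
  then have "nrm (ivl 1) (\<lambda>x. fB x - ival 1 gB 0 x) = 0" using nrm_nonneg[of "ivl 1"] by (intro antisym) auto
  from nrm_eq_0[OF sq_int_diff[OF fB(1) Ps] this] fB(2)
  show "AE x in ivl 1. f x = ival 1 gB 0 x" by eventually_elim simp
qed

lemma test_function_tensor:
  fixes \<phi> \<theta> :: "real \<Rightarrow> real"
  assumes \<phi>: "test_function U \<phi>" and \<theta>: "test_function W \<theta>"
  shows "test_function (U \<times> W) (\<lambda>p. \<phi> (fst p) * \<theta> (snd p))"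
proof (rule test_functionI)
  show "C_k k (\<lambda>p. \<phi> (fst p) * \<theta> (snd p))" for k
    using C_k_compose_linear[OF bounded_linear_fst, of k \<phi> 0] C_k_compose_linear[OF bounded_linear_snd, of k \<theta> 0] \<phi> \<theta>
    by (intro C_k_mult) (auto simp: test_function_def)
  let ?K = "closure {x. \<phi> x \<noteq> 0} \<times> closure {x. \<theta> x \<noteq> 0}"
  show "compact ?K" "?K \<subseteq> U \<times> W"
    using \<phi> \<theta> unfolding test_function_def by (auto intro!: compact_Times)
  show "\<phi> (fst p) * \<theta> (snd p) = 0" if "p \<notin> ?K" for p
    using that closure_subset[of "{x. \<phi> x \<noteq> 0}"] closure_subset[of "{x. \<theta> x \<noteq> 0}"] by (cases p) auto
qed

lemma test_function_mono: "test_function U \<phi> \<Longrightarrow> U \<subseteq> W \<Longrightarrow> test_function W \<phi>"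
  by (auto simp: test_function_def)

lemma initial_cutoff:
  assumes "0 < T"
  obtains \<theta> :: "real \<Rightarrow> real" where "test_function {..<T} \<theta>" "\<theta> 0 = 1"
proof -
  define n where "n = max 1 (2 / T)"
  have n: "0 < n" "1 \<le> n" "1 / n < T"
    using assms by (auto simp: n_def max_def field_simps)
  show thesis
  proof (rule that)
    show "test_function {..<T} (\<lambda>r. ramp (n * (r - (- 1))) - ramp (n * (r - 0)))"
      using n by (intro ramp_test_function) auto
    show "ramp (n * (0 - (- 1))) - ramp (n * (0 - 0)) = 1" using n ramp(1)[of 0] ramp(2)[of n] by simp
  qed
qed

section \<open>From weak solutions to integrated equations\<close>

definition rep :: "(real \<Rightarrow> real) \<Rightarrow> real \<Rightarrow> real" where
  "rep f = (SOME g. sq_int (ivl 1) g \<and> (AE x in ivl 1. f x = g x))"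

lemma rep:
  assumes "in_L2 \<Omega> f"
  shows "sq_int (ivl 1) (rep f)" "AE x in ivl 1. f x = rep f x"
proof -
  have "\<exists>g. sq_int (ivl 1) g \<and> (AE x in ivl 1. f x = g x)"
    using in_L2_representative[of \<Omega> f] assms unfolding ivl_def by auto
  from someI_ex[OF this] show "sq_int (ivl 1) (rep f)" "AE x in ivl 1. f x = rep f x"
    by (simp_all add: rep_def)
qed

lemma L2_rep_norm:
  assumes V: "L2_continuous_rep J v V" and st: "s \<in> J" "t \<in> J"
  shows "L2_norm \<Omega> (\<lambda>x. V s x - V t x) = nrm (ivl 1) (\<lambda>x. rep (V s) x - rep (V t) x)"
proof (rule L2_norm_nrm)
  have V': "in_L2 \<Omega> (V s)" "in_L2 \<Omega> (V t)" using V st by (auto simp: L2_continuous_rep_def)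
  show "sq_int (ivl 1) (\<lambda>x. rep (V s) x - rep (V t) x)" by (intro sq_int_diff rep V')
  show "AE x in ivl 1. V s x - V t x = rep (V s) x - rep (V t) x"
    using rep(2)[OF V'(1)] rep(2)[OF V'(2)] by eventually_elim simp
qed

lemma L2_rep_tendsto:
  assumes V: "L2_continuous_rep J v V" and t: "t \<in> J"
  shows "((\<lambda>s. nrm (ivl 1) (\<lambda>x. rep (V s) x - rep (V t) x)) \<longlongrightarrow> 0) (at t within J)"
proof -
  have "((\<lambda>s. L2_norm \<Omega> (\<lambda>x. V s x - V t x)) \<longlongrightarrow> 0) (at t within J)"
    using V t by (auto simp: L2_continuous_rep_def)
  then show ?thesis
    by (rule Lim_transform_eventually) (use L2_rep_norm[OF V _ t] in \<open>auto simp: eventually_at_filter\<close>)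
qed

lemma L2_rep_sq_int: "\<lbrakk>L2_continuous_rep J v V; t \<in> J\<rbrakk> \<Longrightarrow> sq_int (ivl 1) (rep (V t))"
  by (intro rep) (auto simp: L2_continuous_rep_def)

lemma L2_rep_continuous_nrm:
  assumes V: "L2_continuous_rep J v V" and f: "sq_int (ivl 1) f"
  shows "continuous_on J (\<lambda>t. nrm (ivl 1) (\<lambda>x. rep (V t) x - f x))"
  unfolding continuous_on_def
proof
  fix t assume t: "t \<in> J"
  have "((\<lambda>s. nrm (ivl 1) (\<lambda>x. rep (V s) x - f x) - nrm (ivl 1) (\<lambda>x. rep (V t) x - f x)) \<longlongrightarrow> 0) (at t within J)"
  proof (rule Lim_null_comparison[OF _ L2_rep_tendsto[OF V t]])
    have "norm (nrm (ivl 1) (\<lambda>x. rep (V s) x - f x) - nrm (ivl 1) (\<lambda>x. rep (V t) x - f x))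
       \<le> nrm (ivl 1) (\<lambda>x. rep (V s) x - rep (V t) x)" if "s \<in> J" for s
      using nrm_diff[OF sq_int_diff[OF L2_rep_sq_int[OF V that] f] sq_int_diff[OF L2_rep_sq_int[OF V t] f]] by simp
    then show "\<forall>\<^sub>F s in at t within J. norm (nrm (ivl 1) (\<lambda>x. rep (V s) x - f x) - nrm (ivl 1) (\<lambda>x. rep (V t) x - f x))
       \<le> nrm (ivl 1) (\<lambda>x. rep (V s) x - rep (V t) x)"
      by (auto simp: eventually_at_filter)
  qed
  then show "((\<lambda>s. nrm (ivl 1) (\<lambda>x. rep (V s) x - f x)) \<longlongrightarrow> nrm (ivl 1) (\<lambda>x. rep (V t) x - f x)) (at t within J)"
    by (rule LIM_zero_cancel)
qed

lemma L2_rep_continuous_integral: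
  assumes V: "L2_continuous_rep J v V" and f: "sq_int (ivl 1) f"
  shows "continuous_on J (\<lambda>t. \<integral>x. rep (V t) x * f x \<partial>ivl 1)"
  unfolding continuous_on_def
proof
  fix t assume t: "t \<in> J"
  have "((\<lambda>s. (\<integral>x. rep (V s) x * f x \<partial>ivl 1) - (\<integral>x. rep (V t) x * f x \<partial>ivl 1)) \<longlongrightarrow> 0) (at t within J)"
  proof (rule Lim_null_comparison)
    show "((\<lambda>s. nrm (ivl 1) (\<lambda>x. rep (V s) x - rep (V t) x) * nrm (ivl 1) f) \<longlongrightarrow> 0) (at t within J)"
      by (rule tendsto_mult_left_zero[OF L2_rep_tendsto[OF V t]])
    have "norm ((\<integral>x. rep (V s) x * f x \<partial>ivl 1) - (\<integral>x. rep (V t) x * f x \<partial>ivl 1))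
       \<le> nrm (ivl 1) (\<lambda>x. rep (V s) x - rep (V t) x) * nrm (ivl 1) f" if s: "s \<in> J" for s
    proof -
      note r = L2_rep_sq_int[OF V s] L2_rep_sq_int[OF V t]
      have "(\<integral>x. rep (V s) x * f x \<partial>ivl 1) - (\<integral>x. rep (V t) x * f x \<partial>ivl 1) = (\<integral>x. (rep (V s) x - rep (V t) x) * f x \<partial>ivl 1)"
        using sq_int_mult[OF r(1) f] sq_int_mult[OF r(2) f] by (simp add: left_diff_distrib)
      then show ?thesis using Cauchy_Schwarz[OF sq_int_diff[OF r] f] by simp
    qed
    then show "\<forall>\<^sub>F s in at t within J. norm ((\<integral>x. rep (V s) x * f x \<partial>ivl 1) - (\<integral>x. rep (V t) x * f x \<partial>ivl 1))
       \<le> nrm (ivl 1) (\<lambda>x. rep (V s) x - rep (V t) x) * nrm (ivl 1) f"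
      by (auto simp: eventually_at_filter)
  qed
  then show "((\<lambda>s. \<integral>x. rep (V s) x * f x \<partial>ivl 1) \<longlongrightarrow> (\<integral>x. rep (V t) x * f x \<partial>ivl 1)) (at t within J)"
    by (rule LIM_zero_cancel)
qed

lemma L2_rep_AE:
  assumes V: "L2_continuous_rep J v V" and J: "J \<in> sets borel" "{0<..<T} \<subseteq> J"
  shows "AE t in ivl T. t \<in> J \<and> (AE x in ivl 1. v (x, t) = V t x)"
proof -
  have "AE t in lborel. t \<in> J \<longrightarrow> (AE x in ivl 1. v (x, t) = V t x)"
    using V J(1) unfolding L2_continuous_rep_def by (simp add: AE_lebesgue_on_borel[OF J(1)] AE_lebesgue_on_ivl)
  then show ?thesis unfolding AE_ivl using J(2) by (elim eventually_mono) auto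
qed

lemma tensor_integrable:
  assumes f: "sq_int (ivl2 T) (case_prod f)" and [measurable]: "g \<in> borel_measurable borel" "h \<in> borel_measurable borel"
    and b: "\<And>x. \<bar>g x\<bar> \<le> B" "\<And>t. \<bar>h t\<bar> \<le> B'"
  shows "integrable (ivl2 T) (\<lambda>(x, t). f x t * (g x * h t))"
proof -
  have "sq_int (ivl2 T) (\<lambda>(x, t). g x * h t)"
  proof (rule ivl2f.sq_int_bounded[where C = "B * B'"])
    show "AE p in ivl2 T. \<bar>case p of (x, t) \<Rightarrow> g x * h t\<bar> \<le> B * B'"
      using b order_trans[OF abs_ge_zero b(1)] by (auto intro!: AE_I2 mult_mono simp: abs_mult)
  qed measurable
  from sq_int_mult[OF f this] show ?thesis by (simp add: case_prod_unfold)
qed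

lemma tensor_integral:
  assumes "sq_int (ivl2 T) (case_prod f)" "g \<in> borel_measurable borel" "h \<in> borel_measurable borel"
    and "\<And>x. \<bar>g x\<bar> \<le> B" "\<And>t. \<bar>h t\<bar> \<le> B'"
  shows "(\<integral>p. (case p of (x, t) \<Rightarrow> f x t * (g x * h t)) \<partial>ivl2 T) = (\<integral>t. (\<integral>x. f x t * g x \<partial>ivl 1) * h t \<partial>ivl T)"
    and "(\<integral>x. (\<integral>t. f x t * h t \<partial>ivl T) * g x \<partial>ivl 1) = (\<integral>t. (\<integral>x. f x t * g x \<partial>ivl 1) * h t \<partial>ivl T)"
proof -
  have i: "integrable (ivl2 T) (\<lambda>(x, t). f x t * (g x * h t))" by (rule tensor_integrable[OF assms])
  have a: "(\<integral>t. (\<integral>x. f x t * (g x * h t) \<partial>ivl 1) \<partial>ivl T) = (\<integral>t. (\<integral>x. f x t * g x \<partial>ivl 1) * h t \<partial>ivl T)"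
    by (simp only: mult.assoc[symmetric] integral_mult_left_zero)
  show "(\<integral>p. (case p of (x, t) \<Rightarrow> f x t * (g x * h t)) \<partial>ivl2 T) = (\<integral>t. (\<integral>x. f x t * g x \<partial>ivl 1) * h t \<partial>ivl T)"
    unfolding a[symmetric] by (rule ivl2.integral_snd[OF i, symmetric])
  have "(\<integral>x. (\<integral>t. f x t * h t \<partial>ivl T) * g x \<partial>ivl 1) = (\<integral>x. (\<integral>t. f x t * (g x * h t) \<partial>ivl T) \<partial>ivl 1)"
    by (simp only: mult.commute[of "g _"] mult.assoc[symmetric] integral_mult_left_zero)
  then show "(\<integral>x. (\<integral>t. f x t * h t \<partial>ivl T) * g x \<partial>ivl 1) = (\<integral>t. (\<integral>x. f x t * g x \<partial>ivl 1) * h t \<partial>ivl T)"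
    using ivl2.Fubini_integral[OF i] a by simp
qed

lemma W12_primitive:
  fixes v \<tau>B :: "real \<Rightarrow> real \<Rightarrow> real"
  assumes T: "0 < T" and W: "W12_L2 T \<tau> \<tau>\<^sub>t" and V: "L2_continuous_rep {0..T} \<tau> V"
    and v: "sq_int (ivl2 T) (case_prod v)" "case_prod v \<in> borel_measurable (borel \<Otimes>\<^sub>M borel)"
      "AE p in ivl2 T. \<tau>\<^sub>t p = case_prod v p"
    and \<tau>B: "sq_int (ivl2 T) (case_prod \<tau>B)" "case_prod \<tau>B \<in> borel_measurable (borel \<Otimes>\<^sub>M borel)"
      "AE p in ivl2 T. \<tau> p = case_prod \<tau>B p"
    and t: "0 \<le> t" "t \<le> T"
  shows "AE x in ivl 1. rep (V t) x = rep (V 0) x + ival T (v x) 0 t"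
proof -
  note [measurable (raw)] = measurable_compose[OF measurable_Pair v(2), simplified]
    measurable_compose[OF measurable_Pair \<tau>B(2), simplified]
  have t0: "t \<in> {0..T}" "0 \<in> {0..T}" using t T by auto
  note Vt = L2_rep_sq_int[OF V t0(1)] L2_rep_sq_int[OF V t0(2)]
  have vi: "integrable (ivl2 T) (case_prod v)" by (rule ivl2f.sq_int_integrable[OF v(1)])
  have main: "(\<integral>x. rep (V t) x * g x \<partial>ivl 1) - (\<integral>x. rep (V 0) x * g x \<partial>ivl 1) = (\<integral>x. ival T (v x) 0 t * g x \<partial>ivl 1)"
    and gi: "integrable (ivl 1) (\<lambda>x. ival T (v x) 0 t * g x)"
    if gm [measurable]: "g \<in> borel_measurable borel" and g: "\<And>x. \<bar>g x\<bar> \<le> B" for g B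
  proof -
    have gs: "sq_int (ivl 1) g" using g by (intro ivl.sq_int_bounded[of _ _ B]) auto
    define F where "F r = (\<integral>x. rep (V (max 0 (min r T))) x * g x \<partial>ivl 1)" for r
    have Fc: "continuous_on UNIV F"
      unfolding F_def by (rule continuous_on_compose2[OF L2_rep_continuous_integral[OF V gs]])
        (use T in \<open>auto intro!: continuous_intros\<close>)
    define G where "G r = (\<integral>x. v x r * g x \<partial>ivl 1)" for r
    have vg: "integrable (ivl2 T) (\<lambda>(x, r). v x r * g x)"
      using tensor_integrable[OF v(1) gm, of "\<lambda>_. 1" B 1] g by simp
    have V_AE: "AE t in ivl T. t \<in> {0..T} \<and> (AE x in ivl 1. \<tau> (x, t) = V t x)"
      by (rule L2_rep_AE[OF V]) auto
    have FT: "AE r in ivl T. F r = (\<integral>x. \<tau>B x r * g x \<partial>ivl 1)"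
      using V_AE
        AE_ivl2_slices(2)[OF \<tau>B(3)] AE_ivl_mem[of T]
    proof eventually_elim
      case (elim r)
      then have r: "r \<in> {0..T}" "max 0 (min r T) = r" by auto
      have "AE x in ivl 1. V r x = rep (V r) x" using V r by (intro rep) (auto simp: L2_continuous_rep_def)
      then have "AE x in ivl 1. rep (V r) x = \<tau>B x r"
        using elim by (auto elim!: eventually_elim2)
      then show ?case
        unfolding F_def r using L2_rep_sq_int[OF V r(1)]
        by (intro integral_cong_AE) (auto simp: sq_int_def elim: eventually_mono)
    qed
    have "F t - F 0 = ival T G 0 t"
    proof (rule weak_derivative_primitive)
      show "continuous_on {0..T} F" "F \<in> borel_measurable borel"
        using Fc by (auto intro: continuous_on_subset borel_measurable_continuous_onI)
      show "integrable (ivl T) G" unfolding G_def by (rule ivl2_swap(3)[OF vg])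
      fix \<phi> assume \<phi>: "test_function {0<..<T} \<phi>"
      have \<phi>c: "continuous_on UNIV \<phi>" "continuous_on UNIV (deriv \<phi>)"
        using test_function_continuous[OF \<phi>] test_function_continuous[OF test_function_deriv_test[OF \<phi>]] .
      note [measurable] = \<phi>c[THEN borel_measurable_continuous_onI] Fc[THEN borel_measurable_continuous_onI]
      obtain B1 where B1: "\<And>r. \<bar>\<phi> r\<bar> \<le> B1" using test_function_bounded[OF \<phi>] by blast
      obtain B2 where B2: "\<And>r. \<bar>deriv \<phi> r\<bar> \<le> B2"
        using test_function_bounded[OF test_function_deriv_test[OF \<phi>]] by blast
      have wk: "AE x in ivl 1. (\<integral>r. \<tau>B x r * deriv \<phi> r \<partial>ivl T) = - (\<integral>r. v x r * \<phi> r \<partial>ivl T)"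
      proof -
        have "AE x in ivl 1. (\<integral>r. \<tau> (x, r) * deriv \<phi> r \<partial>lebesgue_on {0<..<T})
             = - (\<integral>r. \<tau>\<^sub>t (x, r) * \<phi> r \<partial>lebesgue_on {0<..<T})"
          using W \<phi> by (simp add: W12_L2_def AE_lebesgue_on_ivl)
        then show ?thesis
          using AE_ivl2_slices(1)[OF \<tau>B(3)] AE_ivl2_slices(1)[OF v(3)]
        proof eventually_elim
          case (elim x)
          have S: "{0<..<T} \<in> sets borel" by simp
          have ae: "AE r in ivl T. \<tau> (x, r) * deriv \<phi> r = \<tau>B x r * deriv \<phi> r"
            "AE r in ivl T. \<tau>\<^sub>t (x, r) * \<phi> r = v x r * \<phi> r"
            using elim(2,3) by (auto elim: eventually_mono)
          have "(\<integral>r. \<tau> (x, r) * deriv \<phi> r \<partial>lebesgue_on {0<..<T}) = (\<integral>r. \<tau>B x r * deriv \<phi> r \<partial>ivl T)"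
            unfolding ivl_def by (rule leb_transfer(3)[OF S _ ae(1)[unfolded ivl_def]]) simp
          moreover have "(\<integral>r. \<tau>\<^sub>t (x, r) * \<phi> r \<partial>lebesgue_on {0<..<T}) = (\<integral>r. v x r * \<phi> r \<partial>ivl T)"
            unfolding ivl_def by (rule leb_transfer(3)[OF S _ ae(2)[unfolded ivl_def]]) simp
          ultimately show ?case using elim(1) by simp
        qed
      qed
      have "(\<integral>r. F r * deriv \<phi> r \<partial>ivl T) = (\<integral>r. (\<integral>x. \<tau>B x r * g x \<partial>ivl 1) * deriv \<phi> r \<partial>ivl T)"
        using FT by (intro integral_cong_AE) (auto elim: eventually_mono)
      also have "\<dots> = (\<integral>x. (\<integral>r. \<tau>B x r * deriv \<phi> r \<partial>ivl T) * g x \<partial>ivl 1)"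
        by (rule tensor_integral(2)[OF \<tau>B(1) gm _ g B2, symmetric]) simp
      also have "\<dots> = (\<integral>x. - ((\<integral>r. v x r * \<phi> r \<partial>ivl T) * g x) \<partial>ivl 1)"
        using wk by (intro integral_cong_AE) (auto elim: eventually_mono)
      also have "\<dots> = - (\<integral>r. G r * \<phi> r \<partial>ivl T)"
        using tensor_integral(2)[OF v(1) gm _ g B1] by (simp add: G_def)
      finally show "(\<integral>r. F r * deriv \<phi> r \<partial>ivl T) = - (\<integral>r. G r * \<phi> r \<partial>ivl T)" .
    qed (use t in auto)
    moreover have "F t = (\<integral>x. rep (V t) x * g x \<partial>ivl 1)" "F 0 = (\<integral>x. rep (V 0) x * g x \<partial>ivl 1)"
      using t T by (auto simp: F_def)
    moreover have sw: "ival T (\<lambda>r. v x r * g x) 0 t = ival T (v x) 0 t * g x" for x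
      using ival_mult[of T "g x" "v x" 0 t] by (simp add: mult.commute)
    ultimately show "(\<integral>x. rep (V t) x * g x \<partial>ivl 1) - (\<integral>x. rep (V 0) x * g x \<partial>ivl 1) = (\<integral>x. ival T (v x) 0 t * g x \<partial>ivl 1)"
      using ivl2_swap(2)[OF vg, of 0 t] by (simp add: G_def[abs_def])
    show "integrable (ivl 1) (\<lambda>x. ival T (v x) 0 t * g x)"
      using ivl2_swap(1)[OF vg, of 0 t] sw by simp
  qed
  define d where "d x = rep (V t) x - rep (V 0) x - ival T (v x) 0 t" for x
  have [measurable]: "rep (V t) \<in> borel_measurable borel" "rep (V 0) \<in> borel_measurable borel"
    using Vt by (auto simp: sq_int_def)
  have dm [measurable]: "d \<in> borel_measurable borel" unfolding d_def[abs_def] by measurable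
  have di: "integrable (ivl 1) d"
    unfolding d_def[abs_def] using Vt[THEN ivl.sq_int_integrable] ivl2_swap(1)[OF vi, of 0 t] by auto
  define g where "g x = sgn (d x)" for x
  have g: "g \<in> borel_measurable borel" "\<And>x. \<bar>g x\<bar> \<le> 1"
    unfolding g_def[abs_def] by (auto simp: sgn_if)
  have gs: "sq_int (ivl 1) g" using g by (intro ivl.sq_int_bounded[of _ _ 1]) auto
  have "(\<integral>x. \<bar>d x\<bar> \<partial>ivl 1) = (\<integral>x. rep (V t) x * g x - rep (V 0) x * g x - ival T (v x) 0 t * g x \<partial>ivl 1)"
    by (intro Bochner_Integration.integral_cong) (auto simp: g_def d_def abs_sgn[of "d _"] left_diff_distrib[symmetric] abs_sgn)
  also have "\<dots> = 0"
    using main[OF g] gi[OF g] sq_int_mult[OF Vt(1) gs] sq_int_mult[OF Vt(2) gs] by simp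
  finally have "AE x in ivl 1. \<bar>d x\<bar> = 0"
    using di by (subst (asm) integral_nonneg_eq_0_iff_AE) auto
  then show ?thesis by eventually_elim (simp add: d_def)
qed

lemma momentum_primitive:
  fixes \<sigma> uB :: "real \<Rightarrow> real \<Rightarrow> real"
  assumes T: "0 < T" and U: "L2_continuous_rep {0..} u U"
    and \<sigma>: "sq_int (ivl2 T) (case_prod \<sigma>)" "\<And>x. sq_int (ivl T) (\<sigma> x)" "case_prod \<sigma> \<in> borel_measurable (borel \<Otimes>\<^sub>M borel)"
    and uB: "sq_int (ivl2 T) (case_prod uB)" "case_prod uB \<in> borel_measurable (borel \<Otimes>\<^sub>M borel)"
      "AE p in ivl2 T. u p = case_prod uB p"
    and u0: "sq_int (ivl 1) u0"
    and weak: "\<And>\<phi> \<theta>. \<lbrakk>test_function \<Omega> \<phi>; test_function {..<T} \<theta>\<rbrakk> \<Longrightarrow>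
      (\<integral>t. (\<integral>x. uB x t * \<phi> x \<partial>ivl 1) * deriv \<theta> t \<partial>ivl T) - (\<integral>t. (\<integral>x. \<sigma> x t * deriv \<phi> x \<partial>ivl 1) * \<theta> t \<partial>ivl T)
       + (\<integral>x. u0 x * \<phi> x \<partial>ivl 1) * \<theta> 0 = 0"
  shows "\<And>t. \<lbrakk>0 \<le> t; t < T\<rbrakk> \<Longrightarrow> \<exists>h. AE x in ivl 1. ival T (\<sigma> x) 0 t = ival 1 (\<lambda>x. rep (U t) x - u0 x) 0 x + h"
    and "AE x in ivl 1. rep (U 0) x = u0 x"
proof -
  note [measurable (raw)] = measurable_compose[OF measurable_Pair \<sigma>(3), simplified]
    measurable_compose[OF measurable_Pair uB(2), simplified]
  have key: "(\<integral>x. rep (U t) x * \<phi> x \<partial>ivl 1) = (\<integral>x. u0 x * \<phi> x \<partial>ivl 1) - (\<integral>x. ival T (\<sigma> x) 0 t * deriv \<phi> x \<partial>ivl 1)"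
    if \<phi>: "test_function \<Omega> \<phi>" and t: "0 \<le> t" "t < T" for \<phi> t
  proof -
    have \<phi>c: "continuous_on UNIV \<phi>" "continuous_on UNIV (deriv \<phi>)"
      using test_function_continuous[OF \<phi>] test_function_continuous[OF test_function_deriv_test[OF \<phi>]] .
    note [measurable] = \<phi>c[THEN borel_measurable_continuous_onI]
    obtain B1 where B1: "\<And>r. \<bar>\<phi> r\<bar> \<le> B1" using test_function_bounded[OF \<phi>] by blast
    obtain B2 where B2: "\<And>r. \<bar>deriv \<phi> r\<bar> \<le> B2"
      using test_function_bounded[OF test_function_deriv_test[OF \<phi>]] by blast
    note \<phi>s = test_function_sq_int[OF \<phi>, where T = 1]
    define F where "F r = (\<integral>x. rep (U (max 0 (min r T))) x * \<phi> x \<partial>ivl 1)" for r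
    have Fc: "continuous_on UNIV F"
      unfolding F_def by (rule continuous_on_compose2[OF L2_rep_continuous_integral[OF U \<phi>s(1)]])
        (use T in \<open>auto intro!: continuous_intros\<close>)
    note [measurable] = Fc[THEN borel_measurable_continuous_onI]
    have U_AE: "AE t in ivl T. t \<in> {0..} \<and> (AE x in ivl 1. u (x, t) = U t x)"
      by (rule L2_rep_AE[OF U]) auto
    have FT: "AE r in ivl T. F r = (\<integral>x. uB x r * \<phi> x \<partial>ivl 1)"
      using U_AE AE_ivl2_slices(2)[OF uB(3)] AE_ivl_mem[of T]
    proof eventually_elim
      case (elim r)
      then have r: "r \<in> {0..}" "max 0 (min r T) = r" by auto
      have "AE x in ivl 1. U r x = rep (U r) x" using U r by (intro rep) (auto simp: L2_continuous_rep_def)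
      then have "AE x in ivl 1. rep (U r) x = uB x r"
        using elim by (auto elim!: eventually_elim2)
      then show ?case
        unfolding F_def r using L2_rep_sq_int[OF U r(1)]
        by (intro integral_cong_AE) (auto simp: sq_int_def elim: eventually_mono)
    qed
    define G where "G r = - (\<integral>x. \<sigma> x r * deriv \<phi> x \<partial>ivl 1)" for r
    have \<sigma>\<phi>: "integrable (ivl2 T) (\<lambda>(x, r). \<sigma> x r * deriv \<phi> x)"
      using tensor_integrable[OF \<sigma>(1), of "deriv \<phi>" "\<lambda>_. 1" B2 1] B2 by simp
    have Gi: "integrable (ivl T) G"
      unfolding G_def using ivl2_swap(3)[OF \<sigma>\<phi>] by simp
    have wk: "(\<integral>r. F r * deriv \<theta> r \<partial>ivl T) + (\<integral>r. G r * \<theta> r \<partial>ivl T) + (\<integral>x. u0 x * \<phi> x \<partial>ivl 1) * \<theta> 0 = 0"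
      if \<theta>: "test_function {..<T} \<theta>" for \<theta>
    proof -
      have [measurable]: "deriv \<theta> \<in> borel_measurable borel"
        using test_function_continuous[OF test_function_deriv_test[OF \<theta>]] by (rule borel_measurable_continuous_onI)
      have "(\<integral>r. F r * deriv \<theta> r \<partial>ivl T) = (\<integral>r. (\<integral>x. uB x r * \<phi> x \<partial>ivl 1) * deriv \<theta> r \<partial>ivl T)"
        using FT by (intro integral_cong_AE) (auto elim: eventually_mono)
      then show ?thesis using weak[OF \<phi> \<theta>] by (simp add: G_def)
    qed
    have FG: "F t - F s = ival T G s t" if "0 \<le> s" "s \<le> t" "t \<le> T" for s t
    proof (rule weak_derivative_primitive[OF continuous_on_subset[OF Fc] _ Gi])
      fix \<theta> :: "real \<Rightarrow> real" assume \<theta>: "test_function {0<..<T} \<theta>"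
      have "\<theta> 0 = 0" using test_function_outside[OF \<theta>] by simp
      moreover have "test_function {..<T} \<theta>" by (rule test_function_mono[OF \<theta>]) auto
      ultimately show "(\<integral>r. F r * deriv \<theta> r \<partial>ivl T) = - (\<integral>r. G r * \<theta> r \<partial>ivl T)"
        using wk[of \<theta>] by simp
    qed (use that in auto)
    obtain \<theta> :: "real \<Rightarrow> real" where \<theta>: "test_function {..<T} \<theta>" "\<theta> 0 = 1" using initial_cutoff[OF T] .
    have \<theta>c: "continuous_on UNIV \<theta>" "continuous_on UNIV (deriv \<theta>)"
      using test_function_continuous[OF \<theta>(1)] test_function_continuous[OF test_function_deriv_test[OF \<theta>(1)]] .
    note [measurable] = \<theta>c[THEN borel_measurable_continuous_onI]
    obtain B3 where B3: "\<And>r. \<bar>\<theta> r\<bar> \<le> B3" using test_function_bounded[OF \<theta>(1)] by blast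
    have "F T * \<theta> T - F 0 * \<theta> 0 = ival T (\<lambda>r. \<theta> r * G r + F r * deriv \<theta> r) 0 T"
    proof (rule ac_product[OF Gi bounded_continuous_integrable_ivl[OF \<theta>c(2)]])
      show "\<theta> b - \<theta> a = ival T (deriv \<theta>) a b" if "0 \<le> a" "a \<le> b" "b \<le> T" for a b
        using FTC_ivl[OF test_function_deriv(1)[OF \<theta>(1)] \<theta>c(2) that] by simp
    qed (use T FG in auto)
    also have "\<dots> = (\<integral>r. \<theta> r * G r + F r * deriv \<theta> r \<partial>ivl T)"
      using Gi T by (intro ival_all) auto
    also have "\<dots> = (\<integral>r. \<theta> r * G r \<partial>ivl T) + (\<integral>r. F r * deriv \<theta> r \<partial>ivl T)"
    proof (rule Bochner_Integration.integral_add)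
      show "integrable (ivl T) (\<lambda>r. F r * deriv \<theta> r)"
        by (intro bounded_continuous_integrable_ivl continuous_intros Fc \<theta>c)
      show "integrable (ivl T) (\<lambda>r. \<theta> r * G r)"
      proof (rule Bochner_Integration.integrable_bound)
        show "integrable (ivl T) (\<lambda>r. B3 * \<bar>G r\<bar>)" using Gi by auto
        show "AE r in ivl T. norm (\<theta> r * G r) \<le> norm (B3 * \<bar>G r\<bar>)"
          using B3 order_trans[OF abs_ge_zero B3] by (auto intro!: AE_I2 mult_right_mono simp: abs_mult)
      qed (use Gi in auto)
    qed
    also have "\<dots> = - (\<integral>x. u0 x * \<phi> x \<partial>ivl 1)"
      using wk[OF \<theta>(1)] \<theta>(2) by (simp add: mult.commute)
    finally have F0: "F 0 = (\<integral>x. u0 x * \<phi> x \<partial>ivl 1)"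
      using \<theta>(2) test_function_outside[OF \<theta>(1), of T] by simp
    have "ival T G 0 t = - ival T (\<lambda>r. \<integral>x. \<sigma> x r * deriv \<phi> x \<partial>ivl 1) 0 t"
      using ival_mult[of T "- 1" "\<lambda>r. \<integral>x. \<sigma> x r * deriv \<phi> x \<partial>ivl 1"] by (simp add: G_def[abs_def])
    also have "\<dots> = - (\<integral>x. ival T (\<lambda>r. \<sigma> x r * deriv \<phi> x) 0 t \<partial>ivl 1)"
      using ivl2_swap(2)[OF \<sigma>\<phi>] by simp
    also have "\<dots> = - (\<integral>x. ival T (\<sigma> x) 0 t * deriv \<phi> x \<partial>ivl 1)"
      using ival_mult[of T "deriv \<phi> _" "\<sigma> _" 0 t] by (simp add: mult.commute)
    finally show ?thesis using FG[of 0 t] F0 t by (simp add: F_def)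
  qed
  have us: "sq_int (ivl 1) (rep (U t))" if "0 \<le> t" for t using L2_rep_sq_int[OF U] that by simp
  show "\<exists>h. AE x in ivl 1. ival T (\<sigma> x) 0 t = ival 1 (\<lambda>x. rep (U t) x - u0 x) 0 x + h" if t: "0 \<le> t" "t < T" for t
  proof (rule du_Bois_Reymond)
    show D: "sq_int (ivl 1) (\<lambda>x. rep (U t) x - u0 x)" by (intro sq_int_diff us t u0)
    show "sq_int (ivl 1) (\<lambda>x. ival T (\<sigma> x) 0 t)"
      using T by (intro sq_int_ival_slice \<sigma>) simp
    fix \<phi> :: "real \<Rightarrow> real" assume \<phi>: "test_function {0<..<1} \<phi>"
    note \<phi>s = test_function_sq_int[OF \<phi>, where T = 1]
    show "(\<integral>x. ival T (\<sigma> x) 0 t * deriv \<phi> x \<partial>ivl 1) = - (\<integral>x. (rep (U t) x - u0 x) * \<phi> x \<partial>ivl 1)"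
      using key[OF \<phi> t] sq_int_mult[OF us[OF t(1)] \<phi>s(1)] sq_int_mult[OF u0 \<phi>s(1)] by (simp add: left_diff_distrib)
  qed
  define d where "d x = rep (U 0) x - u0 x" for x
  have d: "sq_int (ivl 1) d" unfolding d_def[abs_def] by (intro sq_int_diff us u0) simp
  have d\<phi>: "(\<integral>x. d x * \<phi> x \<partial>ivl 1) = 0" if \<phi>: "test_function \<Omega> \<phi>" for \<phi>
    using key[OF \<phi>, of 0] T sq_int_mult[OF us[of 0] test_function_sq_int(1)[OF \<phi>]] sq_int_mult[OF u0 test_function_sq_int(1)[OF \<phi>]]
    by (simp add: d_def left_diff_distrib)
  have "\<exists>h. AE x in ivl 1. d x = ival 1 (\<lambda>_. 0) 0 x + h"
    using d\<phi>[OF test_function_deriv_test] by (intro du_Bois_Reymond d ivl.sq_int_const) auto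
  then obtain h where h: "AE x in ivl 1. d x = h" by (auto simp: ival_def)
  obtain e0 :: "real \<Rightarrow> real" where e0: "test_function {1/4..3/4} e0" "(\<integral>x. e0 x \<partial>ivl 1) = 1" by (rule unit_bump)
  have e0': "test_function \<Omega> e0" by (rule test_function_mono[OF e0(1)]) auto
  have "(\<integral>x. d x * e0 x \<partial>ivl 1) = (\<integral>x. h * e0 x \<partial>ivl 1)"
  proof (rule integral_cong_AE)
    have [measurable]: "d \<in> borel_measurable borel" "e0 \<in> borel_measurable borel"
      using d test_function_sq_int(1)[OF e0', of 1] by (auto simp: sq_int_def)
    show "(\<lambda>x. d x * e0 x) \<in> borel_measurable (ivl 1)" "(\<lambda>x. h * e0 x) \<in> borel_measurable (ivl 1)" by measurable
    show "AE x in ivl 1. d x * e0 x = h * e0 x" using h by eventually_elim simp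
  qed
  then have "h = 0" using d\<phi>[OF e0'] e0(2) by simp
  then show "AE x in ivl 1. rep (U 0) x = u0 x" using h by (auto simp: d_def elim: eventually_mono)
qed

lemma AE_ivl_ex:
  assumes ae: "AE t in ivl T. R t" and ab: "0 \<le> a" "a < b" "b \<le> T"
  obtains t where "a < t" "t < b" "R t"
proof -
  have "\<exists>t. a < t \<and> t < b \<and> R t"
  proof (rule ccontr)
    assume no: "\<not> ?thesis"
    have "AE t in lborel. t \<notin> {a<..<b}"
      using ae unfolding AE_ivl by (elim eventually_mono) (use no ab in auto)
    then have "{a<..<b} \<in> null_sets lborel" by (subst AE_iff_null_sets) auto
    then show False using ab by (simp add: null_sets_def)
  qed
  then show thesis using that by blast
qed

lemma AE_closed_imp_all:
  fixes f :: "real \<Rightarrow> real"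
  assumes f: "continuous_on UNIV f" and ae: "AE t in ivl T. f t \<in> {l..u}" and t: "0 \<le> t" "t \<le> T" "0 < T"
  shows "f t \<in> {l..u}"
proof (rule ccontr)
  assume no: "f t \<notin> {l..u}"
  have "open (f -` (- {l..u}))"
    using f by (intro open_vimage) auto
  moreover have "t \<in> f -` (- {l..u})" using no by simp
  ultimately obtain d where d: "0 < d" "ball t d \<subseteq> f -` (- {l..u})" by (rule openE)
  have "max 0 (t - d) < min T (t + d)" using t d(1) by auto
  then obtain s where "max 0 (t - d) < s" "s < min T (t + d)" "f s \<in> {l..u}"
    using AE_ivl_ex[OF ae, of "max 0 (t - d)" "min T (t + d)"] by auto
  moreover from this have "s \<in> ball t d" by (auto simp: dist_real_def)
  ultimately show False using d(2) by blast
qed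

lemma (in mhd_data) weak_solution_mhd_sol:
  assumes T: "0 < T" and ws: "weak_solution A \<gamma> \<mu> t0 u00 b0 T \<tau> u b"
    and U: "L2_continuous_rep {0..} u U"
    and t0: "AE x in ivl 1. t0 x = \<tau>0 x" and Qb: "AE x in ivl 1. (b0 x * t0 x)\<^sup>2 / 2 = Q x"
    and u00: "AE x in ivl 1. u00 x = u0 x"
  obtains v c C where "mhd_sol A \<gamma> \<mu> \<tau>0 u0 Q \<tau>s a a' m s1 s2 C0 T v c C (\<lambda>t. rep (U t))"
    "AE t in ivl T. AE x in ivl 1. \<tau> (x, t) = \<tau>0 x + ival T (v x) 0 t"
    "AE p in ivl2 T. b p = b0 (fst p) * t0 (fst p) / \<tau> p"
proof -
  obtain \<tau>\<^sub>t u\<^sub>x b\<^sub>t V where W: "W12_L2 T \<tau> \<tau>\<^sub>t" and H: "L2_H1_0 T u u\<^sub>x"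
    and inf: "ess_inf_pos (\<Omega>\<^sub>T T) \<tau>" and sup: "in_Linf (\<Omega>\<^sub>T T) \<tau>"
    and tu: "AE p in ivl2 T. \<tau>\<^sub>t p = u\<^sub>x p" and b: "AE p in ivl2 T. b p = b0 (fst p) * t0 (fst p) / \<tau> p"
    and V: "L2_continuous_rep {0..T} \<tau> V" and V0: "AE x in ivl 1. V 0 x = t0 x"
    and weak: "\<And>\<psi>. test_function (\<Omega> \<times> {..<T}) \<psi> \<Longrightarrow>
           (\<integral>(x, t). u (x, t) * deriv (\<lambda>s. \<psi> (x, s)) t
              - (\<mu> * u\<^sub>x (x, t) / \<tau> (x, t) - A * \<tau> (x, t) powr (- \<gamma>) - (b (x, t))\<^sup>2 / 2)
                * deriv (\<lambda>y. \<psi> (y, t)) x \<partial>lebesgue_on (\<Omega>\<^sub>T T))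
           + (\<integral>x. u00 x * \<psi> (x, 0) \<partial>lebesgue_on \<Omega>) = 0"
    using ws unfolding weak_solution_def AE_lebesgue_on_ivl2 AE_lebesgue_on_ivl by blast
  obtain v0 where v0: "case_prod v0 \<in> borel_measurable (borel \<Otimes>\<^sub>M borel)" "sq_int (ivl2 T) (case_prod v0)"
    "AE p in ivl2 T. u\<^sub>x p = case_prod v0 p"
    using ivl2_L2_representative[of T u\<^sub>x] H by (auto simp: L2_H1_0_def)
  obtain uB where uB: "case_prod uB \<in> borel_measurable (borel \<Otimes>\<^sub>M borel)" "sq_int (ivl2 T) (case_prod uB)"
    "AE p in ivl2 T. u p = case_prod uB p"
    using ivl2_L2_representative[of T u] H by (auto simp: L2_H1_0_def)
  obtain \<tau>B where \<tau>B: "case_prod \<tau>B \<in> borel_measurable (borel \<Otimes>\<^sub>M borel)" "sq_int (ivl2 T) (case_prod \<tau>B)"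
    "AE p in ivl2 T. \<tau> p = case_prod \<tau>B p"
    using ivl2_L2_representative[of T \<tau>] W by (auto simp: W12_L2_def)
  note [measurable (raw)] = measurable_compose[OF measurable_Pair v0(1), simplified]
    measurable_compose[OF measurable_Pair uB(1), simplified]
  have tv: "AE p in ivl2 T. \<tau>\<^sub>t p = case_prod v0 p" using tu v0(3) by eventually_elim simp
  define th0 where "th0 x t = \<tau>0 x + ival T (v0 x) 0 t" for x t
  have th0m: "case_prod th0 \<in> borel_measurable (borel \<Otimes>\<^sub>M borel)" unfolding th0_def by measurable
  have repV0: "AE x in ivl 1. rep (V 0) x = \<tau>0 x"
    using rep(2)[of "V 0"] V T V0 t0 by (auto simp: L2_continuous_rep_def elim!: eventually_elim2)
  have V_AE: "AE t in ivl T. t \<in> {0..T} \<and> (AE x in ivl 1. \<tau> (x, t) = V t x)"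
    by (rule L2_rep_AE[OF V]) auto
  have \<tau>th: "AE t in ivl T. AE x in ivl 1. \<tau> (x, t) = th0 x t"
    using V_AE
  proof eventually_elim
    case (elim t)
    then have t: "0 \<le> t" "t \<le> T" by auto
    have "AE x in ivl 1. V t x = rep (V t) x" using V t by (intro rep) (auto simp: L2_continuous_rep_def)
    moreover have "AE x in ivl 1. \<tau> (x, t) = V t x" using elim by simp
    ultimately show ?case
      using W12_primitive[OF T W V v0(2,1) tv \<tau>B(2,1,3) t] repV0
      by eventually_elim (simp add: th0_def)
  qed
  have "AE t in ivl T. AE x in ivl 1. \<tau>B x t = th0 x t"
    using \<tau>th AE_ivl2_slices(2)[OF \<tau>B(3)] by eventually_elim (auto elim!: eventually_elim2)
  then have "AE p in ivl2 T. case_prod \<tau>B p = case_prod th0 p"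
    by (rule AE_ivl2_I[OF \<tau>B(1) th0m])
  with \<tau>B(3) have \<tau>th2: "AE p in ivl2 T. \<tau> p = case_prod th0 p" by eventually_elim simp
  obtain c0 where c0: "0 < c0" "AE p in ivl2 T. c0 \<le> \<tau> p"
    using inf unfolding ess_inf_pos_def AE_lebesgue_on_ivl2 by blast
  obtain C1 where C1: "AE p in ivl2 T. \<bar>\<tau> p\<bar> \<le> C1"
    using sup unfolding in_Linf_def AE_lebesgue_on_ivl2 by blast
  have "AE p in ivl2 T. case_prod th0 p \<in> {c0..C1}"
    using \<tau>th2 c0(2) C1 by eventually_elim auto
  from AE_ivl2_slices(1)[OF this] have "AE x in ivl 1. AE t in ivl T. th0 x t \<in> {c0..C1}" by simp
  moreover have "AE x in ivl 1. sq_int (ivl T) (v0 x)"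
  proof -
    have "AE x in ivl 1. integrable (ivl T) (\<lambda>t. (v0 x t)\<^sup>2)"
      using v0(2) by (intro ivl2.AE_integrable_fst) (simp add: sq_int_def case_prod_unfold)
    moreover have "v0 x \<in> borel_measurable borel" for x by measurable
    ultimately show ?thesis by (auto simp: sq_int_def)
  qed
  ultimately have good: "AE x in ivl 1. sq_int (ivl T) (v0 x) \<and> (\<forall>t. 0 \<le> t \<and> t \<le> T \<longrightarrow> th0 x t \<in> {c0..C1})"
  proof eventually_elim
    case (elim x)
    have "continuous_on UNIV (th0 x)"
      unfolding th0_def[abs_def] by (intro continuous_intros ival_continuous ivl.sq_int_integrable elim)
    then show ?case using AE_closed_imp_all[where f = "th0 x" and T = T and l = c0 and u = C1] elim T by blast
  qed
  then obtain N where N: "{x \<in> space (ivl 1). \<not> (sq_int (ivl T) (v0 x) \<and> (\<forall>t. 0 \<le> t \<and> t \<le> T \<longrightarrow> th0 x t \<in> {c0..C1}))} \<subseteq> N"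
    "N \<in> sets (ivl 1)" "emeasure (ivl 1) N = 0" by (elim AE_E) auto
  have N_AE: "AE x in ivl 1. x \<notin> N" using N by (intro AE_not_in) auto
  have Nm [measurable]: "N \<in> sets borel" using N by simp
  define v where "v x t = indicator (- N) x * v0 x t" for x t
  have vm: "case_prod v \<in> borel_measurable (borel \<Otimes>\<^sub>M borel)" unfolding v_def by measurable
  have v_notin: "v x = v0 x" if "x \<notin> N" for x using that by (simp add: v_def[abs_def])
  have v_in: "v x = (\<lambda>_. 0)" if "x \<in> N" for x using that by (simp add: v_def[abs_def])
  have vs: "sq_int (ivl2 T) (case_prod v)"
  proof -
    have "sq_int (ivl2 T) (\<lambda>p. indicator (- N) (fst p) * case_prod v0 p)"
      by (rule sq_int_bounded_mult[OF v0(2), where C = 1]) (auto simp: indicator_def)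
    then show ?thesis by (simp add: v_def case_prod_unfold)
  qed
  have a': "a \<le> a'" using a(2)[of 0] a(3)[of 0] by linarith
  interpret F: mhd_flow A \<gamma> \<mu> \<tau>0 u0 Q \<tau>s a a' m s1 s2 C0 T v "min c0 a" "max C1 a'"
  proof
    show "sq_int (ivl T) (v x)" for x
      using N(1) v_in[of x] v_notin[of x] by (cases "x \<in> N") (auto intro: ivl.sq_int_const)
    fix x t :: real assume t: "0 \<le> t" "t \<le> T"
    have "min c0 a \<le> \<tau>0 x + ival T (v x) 0 t \<and> \<tau>0 x + ival T (v x) 0 t \<le> max C1 a'"
    proof (cases "x \<in> N")
      case True
      then show ?thesis using a(2,3)[of x] by (simp add: v_in ival_def min_le_iff_disj le_max_iff_disj)
    next
      case False
      then have "th0 x t \<in> {c0..C1}" using N(1) t by auto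
      then show ?thesis using False by (simp add: v_notin th0_def min_le_iff_disj le_max_iff_disj)
    qed
    then show "min c0 a \<le> \<tau>0 x + ival T (v x) 0 t" "\<tau>0 x + ival T (v x) 0 t \<le> max C1 a'" by auto
  qed (use T vm vs c0(1) a(1) in auto)
  have th_eq: "F.th x t = th0 x t" if "x \<notin> N" for x t using that by (simp add: F.th_def th0_def v_notin)
  have \<tau>_th: "AE t in ivl T. AE x in ivl 1. \<tau> (x, t) = \<tau>0 x + ival T (v x) 0 t"
    using \<tau>th
  proof eventually_elim
    case (elim t)
    from elim N_AE show ?case by eventually_elim (simp add: th0_def v_notin)
  qed
  have N2: "AE p in ivl2 T. fst p \<notin> N" by (rule AE_ivl2_fst[OF N_AE])
  have \<sigma>eq: "AE p in ivl2 T. \<mu> * u\<^sub>x p / \<tau> p - A * \<tau> p powr (- \<gamma>) - (b p)\<^sup>2 / 2 = case_prod F.\<sigma> p"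
    using v0(3) \<tau>th2 N2 b AE_ivl2_fst[OF Qb]
  proof eventually_elim
    case (elim p)
    obtain x t where p: "p = (x, t)" by (cases p)
    have "(b p)\<^sup>2 / 2 = ((b0 x * t0 x)\<^sup>2 / 2) / (\<tau> p)\<^sup>2" using elim(4) by (simp add: p power_divide)
    also have "\<dots> = Q x / (\<tau> p)\<^sup>2" using elim(5) by (simp add: p)
    finally show ?case
      using elim by (simp add: p F.\<sigma>_def P_def th_eq v_notin)
  qed
  have wk: "(\<integral>t. (\<integral>x. uB x t * \<phi> x \<partial>ivl 1) * deriv \<theta> t \<partial>ivl T) - (\<integral>t. (\<integral>x. F.\<sigma> x t * deriv \<phi> x \<partial>ivl 1) * \<theta> t \<partial>ivl T)
       + (\<integral>x. u0 x * \<phi> x \<partial>ivl 1) * \<theta> 0 = 0"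
    if \<phi>: "test_function \<Omega> \<phi>" and \<theta>: "test_function {..<T} \<theta>" for \<phi> \<theta>
  proof -
    note c = test_function_continuous[OF \<phi>] test_function_continuous[OF test_function_deriv_test[OF \<phi>]]
      test_function_continuous[OF \<theta>] test_function_continuous[OF test_function_deriv_test[OF \<theta>]]
    note [measurable] = c[THEN borel_measurable_continuous_onI]
    obtain B1 B2 B3 B4 where B: "\<And>r. \<bar>\<phi> r\<bar> \<le> B1" "\<And>r. \<bar>deriv \<phi> r\<bar> \<le> B2" "\<And>r. \<bar>\<theta> r\<bar> \<le> B3" "\<And>r. \<bar>deriv \<theta> r\<bar> \<le> B4"
      using test_function_bounded[OF \<phi>] test_function_bounded[OF test_function_deriv_test[OF \<phi>]]
        test_function_bounded[OF \<theta>] test_function_bounded[OF test_function_deriv_test[OF \<theta>]] by metis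
    define \<psi> where "\<psi> p = \<phi> (fst p) * \<theta> (snd p)" for p :: "real \<times> real"
    have d1: "deriv (\<lambda>s. \<psi> (x, s)) t = \<phi> x * deriv \<theta> t" for x t
      unfolding \<psi>_def using DERIV_cmult[OF test_function_deriv(1)[OF \<theta>], of "\<phi> x" t] by (simp add: DERIV_imp_deriv)
    have d2: "deriv (\<lambda>y. \<psi> (y, t)) x = deriv \<phi> x * \<theta> t" for x t
      unfolding \<psi>_def using DERIV_cmult_right[OF test_function_deriv(1)[OF \<phi>], of "\<theta> t" x] by (simp add: DERIV_imp_deriv)
    have S2: "{0<..<1::real} \<times> {0<..<T} \<in> sets borel" by (intro borel_open open_Times open_greaterThanLessThan)
    let ?g = "\<lambda>p. (case p of (x, t) \<Rightarrow> uB x t * (\<phi> x * deriv \<theta> t)) - (case p of (x, t) \<Rightarrow> F.\<sigma> x t * (deriv \<phi> x * \<theta> t))"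
    have gm: "?g \<in> borel_measurable borel"
      unfolding borel_prod[symmetric] by measurable
    have ae: "AE p in ivl2 T. (case p of (x, t) \<Rightarrow> u (x, t) * deriv (\<lambda>s. \<psi> (x, s)) t
              - (\<mu> * u\<^sub>x (x, t) / \<tau> (x, t) - A * \<tau> (x, t) powr (- \<gamma>) - (b (x, t))\<^sup>2 / 2)
                * deriv (\<lambda>y. \<psi> (y, t)) x) = ?g p"
      using uB(3) \<sigma>eq
    proof eventually_elim
      case (elim p)
      then show ?case by (cases p) (simp add: d1 d2)
    qed
    have "(\<integral>(x, t). u (x, t) * deriv (\<lambda>s. \<psi> (x, s)) t
              - (\<mu> * u\<^sub>x (x, t) / \<tau> (x, t) - A * \<tau> (x, t) powr (- \<gamma>) - (b (x, t))\<^sup>2 / 2)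
                * deriv (\<lambda>y. \<psi> (y, t)) x \<partial>lebesgue_on (\<Omega>\<^sub>T T)) = (\<integral>p. ?g p \<partial>ivl2 T)"
      unfolding ivl2_dens by (rule leb_transfer(3)[OF S2 gm ae[unfolded ivl2_dens]])
    also have "\<dots> = (\<integral>p. (case p of (x, t) \<Rightarrow> uB x t * (\<phi> x * deriv \<theta> t)) \<partial>ivl2 T)
        - (\<integral>p. (case p of (x, t) \<Rightarrow> F.\<sigma> x t * (deriv \<phi> x * \<theta> t)) \<partial>ivl2 T)"
      by (intro Bochner_Integration.integral_diff tensor_integrable[OF uB(2) _ _ B(1,4)]
          tensor_integrable[OF F.\<sigma>_s(1) _ _ B(2,3)]) measurable
    also have "\<dots> = (\<integral>t. (\<integral>x. uB x t * \<phi> x \<partial>ivl 1) * deriv \<theta> t \<partial>ivl T) - (\<integral>t. (\<integral>x. F.\<sigma> x t * deriv \<phi> x \<partial>ivl 1) * \<theta> t \<partial>ivl T)"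
      by (subst tensor_integral(1)[OF uB(2) _ _ B(1,4)] tensor_integral(1)[OF F.\<sigma>_s(1) _ _ B(2,3)]; simp?)+
    finally have 1: "(\<integral>(x, t). u (x, t) * deriv (\<lambda>s. \<psi> (x, s)) t
              - (\<mu> * u\<^sub>x (x, t) / \<tau> (x, t) - A * \<tau> (x, t) powr (- \<gamma>) - (b (x, t))\<^sup>2 / 2)
                * deriv (\<lambda>y. \<psi> (y, t)) x \<partial>lebesgue_on (\<Omega>\<^sub>T T))
       = (\<integral>t. (\<integral>x. uB x t * \<phi> x \<partial>ivl 1) * deriv \<theta> t \<partial>ivl T) - (\<integral>t. (\<integral>x. F.\<sigma> x t * deriv \<phi> x \<partial>ivl 1) * \<theta> t \<partial>ivl T)" .
    have u0m [measurable]: "u0 \<in> borel_measurable borel" using u0 by (auto simp: sq_int_def)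
    have ae0: "AE x in ivl 1. u00 x * \<psi> (x, 0) = u0 x * \<phi> x * \<theta> 0"
      using u00 by eventually_elim (simp add: \<psi>_def)
    have S1: "\<Omega> \<in> sets borel" by simp
    have "(\<integral>x. u00 x * \<psi> (x, 0) \<partial>lebesgue_on \<Omega>) = (\<integral>x. u0 x * \<phi> x * \<theta> 0 \<partial>ivl 1)"
      unfolding ivl_def by (rule leb_transfer(3)[OF S1 _ ae0[unfolded ivl_def]]) measurable
    also have "\<dots> = (\<integral>x. u0 x * \<phi> x \<partial>ivl 1) * \<theta> 0" by (rule integral_mult_left_zero)
    finally have 2: "(\<integral>x. u00 x * \<psi> (x, 0) \<partial>lebesgue_on \<Omega>) = (\<integral>x. u0 x * \<phi> x \<partial>ivl 1) * \<theta> 0" .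
    have "test_function (\<Omega> \<times> {..<T}) \<psi>"
      unfolding \<psi>_def[abs_def] by (rule test_function_tensor[OF \<phi> \<theta>])
    from weak[OF this] show ?thesis unfolding 1 2 .
  qed
  note mp = momentum_primitive[OF T U F.\<sigma>_s(1) F.\<sigma>_s(2) F.\<sigma>_meas uB(2,1,3) u0]
  have mp1: "\<exists>h. AE x in ivl 1. ival T (F.\<sigma> x) 0 t = ival 1 (\<lambda>x. rep (U t) x - u0 x) 0 x + h"
    if "0 \<le> t" "t < T" for t
    by (rule mp(1)[OF _ that]) (rule wk)
  have mp2: "AE x in ivl 1. rep (U 0) x = u0 x" by (rule mp(2)) (rule wk)
  have U_AE: "AE t in ivl T. t \<in> {0..} \<and> (AE x in ivl 1. u (x, t) = U t x)"
    by (rule L2_rep_AE[OF U]) auto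
  have Us: "sq_int (ivl 1) (rep (U t))" if "0 \<le> t" for t using L2_rep_sq_int[OF U] that by simp
  have H1: "AE t in ivl T. H1_0 (\<lambda>x. u (x, t)) (\<lambda>x. u\<^sub>x (x, t))"
    using H by (simp add: L2_H1_0_def AE_lebesgue_on_ivl)
  have v_mean_w: "AE t in ivl T. (\<integral>x. v x t \<partial>ivl 1) = 0 \<and> (AE x in ivl 1. rep (U t) x = ival 1 (\<lambda>y. v y t) 0 x)"
    using H1 F.slices(1) AE_ivl2_slices(2)[OF v0(3)] U_AE
  proof eventually_elim
    case (elim t)
    have e: "AE x in ivl 1. u\<^sub>x (x, t) = v x t"
      using elim(3) N_AE by eventually_elim (simp add: v_notin)
    have "AE x in ivl 1. U t x = rep (U t) x" using U elim by (intro rep) (auto simp: L2_continuous_rep_def)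
    moreover have "AE x in ivl 1. u (x, t) = U t x" using elim by simp
    ultimately have "AE x in ivl 1. rep (U t) x = ival 1 (\<lambda>y. v y t) 0 x"
      using H1_0_primitive(2)[OF elim(1,2) e] by eventually_elim simp
    then show ?case using H1_0_primitive(1)[OF elim(1,2) e] by simp
  qed
  have "mhd_sol A \<gamma> \<mu> \<tau>0 u0 Q \<tau>s a a' m s1 s2 C0 T v (min c0 a) (max C1 a') (\<lambda>t. rep (U t))"
  proof
    show "AE t in ivl T. (\<integral>x. v x t \<partial>ivl 1) = 0" "AE t in ivl T. AE x in ivl 1. rep (U t) x = ival 1 (\<lambda>y. v y t) 0 x"
      using v_mean_w by (auto elim: eventually_mono)
    show "continuous_on {0..<T} (\<lambda>t. \<integral>x. (rep (U t) x)\<^sup>2 \<partial>ivl 1)"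
    proof -
      have "continuous_on {0..} (\<lambda>t. (nrm (ivl 1) (\<lambda>x. rep (U t) x - 0))\<^sup>2)"
        by (intro continuous_intros L2_rep_continuous_nrm[OF U] ivl.sq_int_const)
      then have "continuous_on {0..} (\<lambda>t. \<integral>x. (rep (U t) x)\<^sup>2 \<partial>ivl 1)" by (simp add: nrm_square)
      then show ?thesis by (rule continuous_on_subset) auto
    qed
    show "AE x in ivl 1. rep (U 0) x = u0 x" by (rule mp2)
    fix t assume t: "0 \<le> t" "t < T"
    show "sq_int (ivl 1) (rep (U t))" by (rule Us[OF t(1)])
    obtain h where "AE x in ivl 1. ival T (F.\<sigma> x) 0 t = ival 1 (\<lambda>x. rep (U t) x - u0 x) 0 x + h"
      using mp1[OF t] by blast
    then have "AE x in ivl 1. F.S x t = ival 1 (rep (U t)) 0 x + h"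
      using ivl.sq_int_integrable[OF Us[OF t(1)]] u0_i by (auto simp: F.S_def U0_def ival_diff elim!: eventually_mono)
    then show "\<exists>h. AE x in ivl 1. F.S x t = ival 1 (rep (U t)) 0 x + h" by blast
  qed
  then show thesis using that \<tau>_th b by blast
qed

lemma nrm_mono:
  assumes f: "f \<in> borel_measurable M" and g: "sq_int M g" and "0 \<le> k" and le: "AE x in M. \<bar>f x\<bar> \<le> k * \<bar>g x\<bar>"
  shows "nrm M f \<le> k * nrm M g"
proof (rule power2_le_imp_le)
  have sq: "AE x in M. (f x)\<^sup>2 \<le> k\<^sup>2 * (g x)\<^sup>2"
    using le
  proof eventually_elim
    case (elim x)
    then have "\<bar>f x\<bar> \<le> \<bar>k * g x\<bar>" using \<open>0 \<le> k\<close> by (simp add: abs_mult)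
    then show ?case by (simp add: abs_le_square_iff power_mult_distrib)
  qed
  have gi: "integrable M (\<lambda>x. k\<^sup>2 * (g x)\<^sup>2)" using g by (simp add: sq_int_def)
  then have fi: "integrable M (\<lambda>x. (f x)\<^sup>2)"
    by (rule Bochner_Integration.integrable_bound) (use f sq in auto)
  show "(nrm M f)\<^sup>2 \<le> (k * nrm M g)\<^sup>2"
    using integral_mono_AE[OF fi gi sq] by (simp add: nrm_square power_mult_distrib)
qed (use \<open>0 \<le> k\<close> nrm_nonneg in \<open>auto intro: mult_nonneg_nonneg\<close>)

lemma stationary_bounds:
  fixes A \<gamma> y q m C :: real
  assumes "0 < A" "1 < \<gamma>" "0 < y" "0 \<le> q" "q \<le> m" and eq: "A * y powr (- \<gamma>) + q / y\<^sup>2 = C"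
  shows "0 < C" "min 1 (A / C) \<le> y" "y \<le> max 1 ((A + m) / C)"
proof -
  have pos: "0 < A * y powr (- \<gamma>)" "0 \<le> q / y\<^sup>2" using assms by auto
  then show C: "0 < C" using eq by linarith
  show "min 1 (A / C) \<le> y"
  proof (cases "y \<le> 1")
    case True
    have "A / y = A * y powr (- 1)" using assms by (simp add: powr_minus divide_inverse)
    also have "\<dots> \<le> A * y powr (- \<gamma>)" using assms True by (intro mult_left_mono powr_mono') auto
    also have "\<dots> \<le> C" using eq pos by linarith
    finally have "A / C \<le> y" using C assms by (simp add: field_simps)
    then show ?thesis by simp
  qed simp
  show "y \<le> max 1 ((A + m) / C)"
  proof (cases "1 \<le> y")
    case True
    have "A * y powr (- \<gamma>) \<le> A * y powr (- 1)" using assms True by (intro mult_left_mono powr_mono) auto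
    also have "\<dots> = A / y" using assms by (simp add: powr_minus divide_inverse)
    finally have 1: "A * y powr (- \<gamma>) \<le> A / y" .
    have "q / y\<^sup>2 \<le> m / y\<^sup>2" using assms by (intro divide_right_mono) auto
    also have "\<dots> \<le> m / y" using True assms by (intro divide_left_mono) (auto simp: power2_eq_square)
    finally have "C \<le> (A + m) / y" using 1 eq by (simp add: add_divide_distrib)
    then have "y \<le> (A + m) / C" using C assms by (simp add: field_simps)
    then show ?thesis by simp
  qed simp
qed

lemma clamp_representative:
  fixes f :: "real \<Rightarrow> real"
  assumes f: "f \<in> borel_measurable (lebesgue_on \<Omega>)" and b: "AE x in ivl 1. l \<le> f x \<and> f x \<le> h" and "l \<le> h"
  obtains g where "g \<in> borel_measurable borel" "AE x in ivl 1. f x = g x" "\<And>x. l \<le> g x" "\<And>x. g x \<le> h"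
proof -
  have "\<Omega> \<in> sets borel" by simp
  from borel_representative[OF this f] obtain g
    where [measurable]: "g \<in> borel_measurable borel" and g: "AE x in ivl 1. f x = g x"
    unfolding ivl_def by blast
  show thesis
  proof (rule that)
    show "(\<lambda>x. max l (min h (g x))) \<in> borel_measurable borel" by measurable
    show "AE x in ivl 1. f x = max l (min h (g x))" using g b by eventually_elim auto
  qed (use \<open>l \<le> h\<close> in auto)
qed

theorem theorem1p3:
  fixes A \<gamma> \<mu> :: real and \<tau>\<^sub>0 u\<^sub>0 b\<^sub>0 \<tau>\<^sub>s b\<^sub>s :: "real \<Rightarrow> real"
  assumes "A > 0" and "\<gamma> > 1" and "\<mu> > 0"
    and "ess_inf_pos \<Omega> \<tau>\<^sub>0" and "in_Linf \<Omega> \<tau>\<^sub>0"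
    and "in_L2 \<Omega> u\<^sub>0" and "in_Linf \<Omega> b\<^sub>0"
    and "(\<integral>x. \<tau>\<^sub>0 x \<partial>lebesgue_on \<Omega>) = 1"
    and "stationary_solution A \<gamma> \<tau>\<^sub>0 b\<^sub>0 \<tau>\<^sub>s b\<^sub>s"
  shows "\<exists>C\<^sub>1>0. \<exists>C\<^sub>2>0. \<forall>\<tau> u b \<tau>' u' b'.
    global_weak_solution A \<gamma> \<mu> \<tau>\<^sub>0 u\<^sub>0 b\<^sub>0 \<tau> u b \<longrightarrow>
    L2_continuous_rep {0..} \<tau> \<tau>' \<longrightarrow> L2_continuous_rep {0..} u u' \<longrightarrow>
    L2_continuous_rep {0..} b b' \<longrightarrow>
    (\<forall>t\<ge>0. L2_norm \<Omega> (\<lambda>x. \<tau>' t x - \<tau>\<^sub>s x) + L2_norm \<Omega> (u' t) + L2_norm \<Omega> (\<lambda>x. b' t x - b\<^sub>s x)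
             \<le> C\<^sub>1 * exp (- C\<^sub>2 * t))"
proof -
  have S1: "\<Omega> \<in> sets borel" by simp
  obtain a where a: "0 < a" "AE x in ivl 1. a \<le> \<tau>\<^sub>0 x"
    using assms(4) by (auto simp: ess_inf_pos_def AE_lebesgue_on_ivl)
  obtain a1 where a1: "AE x in ivl 1. \<bar>\<tau>\<^sub>0 x\<bar> \<le> a1" and \<tau>\<^sub>0m: "\<tau>\<^sub>0 \<in> borel_measurable (lebesgue_on \<Omega>)"
    using assms(5) by (auto simp: in_Linf_def AE_lebesgue_on_ivl)
  define a' where "a' = max a a1"
  have "AE x in ivl 1. a \<le> \<tau>\<^sub>0 x \<and> \<tau>\<^sub>0 x \<le> a'" using a(2) a1 by eventually_elim (auto simp: a'_def)
  from clamp_representative[OF \<tau>\<^sub>0m this] obtain t0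
    where t0m [measurable]: "t0 \<in> borel_measurable borel" and t0: "AE x in ivl 1. \<tau>\<^sub>0 x = t0 x" "\<And>x. a \<le> t0 x" "\<And>x. t0 x \<le> a'"
    by (auto simp: a'_def)
  obtain \<beta>1 where \<beta>1: "AE x in ivl 1. \<bar>b\<^sub>0 x\<bar> \<le> \<beta>1" and b\<^sub>0m: "b\<^sub>0 \<in> borel_measurable (lebesgue_on \<Omega>)"
    using assms(7) by (auto simp: in_Linf_def AE_lebesgue_on_ivl)
  define \<beta> where "\<beta> = max 0 \<beta>1"
  have "AE x in ivl 1. - \<beta> \<le> b\<^sub>0 x \<and> b\<^sub>0 x \<le> \<beta>" using \<beta>1 by eventually_elim (auto simp: \<beta>_def)
  from clamp_representative[OF b\<^sub>0m this] obtain bB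
    where bBm [measurable]: "bB \<in> borel_measurable borel" and bB: "AE x in ivl 1. b\<^sub>0 x = bB x" "\<And>x. - \<beta> \<le> bB x" "\<And>x. bB x \<le> \<beta>"
    by (auto simp: \<beta>_def)
  obtain u0 where u0: "sq_int (ivl 1) u0" "AE x in ivl 1. u\<^sub>0 x = u0 x"
    using in_L2_representative[OF S1 assms(6)] unfolding ivl_def by blast
  define M where "M x = bB x * t0 x" for x
  have Mm [measurable]: "M \<in> borel_measurable borel" unfolding M_def[abs_def] by measurable
  have a'0: "0 < a'" using a(1) by (simp add: a'_def)
  have M_le: "\<bar>M x\<bar> \<le> \<beta> * a'" for x
  proof -
    have "\<bar>bB x\<bar> \<le> \<beta>" using bB(2,3)[of x] by auto
    moreover have "\<bar>t0 x\<bar> \<le> a'" using t0(2,3)[of x] a(1) by auto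
    ultimately show ?thesis unfolding M_def abs_mult using a'0 by (intro mult_mono) auto
  qed
  define Q where "Q x = (M x)\<^sup>2 / 2" for x
  define m where "m = (\<beta> * a')\<^sup>2 / 2"
  have Q: "0 \<le> Q x" "Q x \<le> m" for x
  proof -
    have "(M x)\<^sup>2 \<le> (\<beta> * a')\<^sup>2" using power_mono[OF M_le[of x], of 2] by simp
    then show "0 \<le> Q x" "Q x \<le> m" by (simp_all add: Q_def m_def)
  qed
  have \<tau>\<^sub>si: "integrable (lebesgue_on \<Omega>) \<tau>\<^sub>s" and \<tau>\<^sub>s1: "(\<integral>x. \<tau>\<^sub>s x \<partial>lebesgue_on \<Omega>) = 1"
    and \<tau>\<^sub>s_pos: "AE x in ivl 1. 0 < \<tau>\<^sub>s x" and b\<^sub>s: "AE x in ivl 1. b\<^sub>s x = b\<^sub>0 x * \<tau>\<^sub>0 x / \<tau>\<^sub>s x"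
    using assms(8,9) unfolding stationary_solution_def AE_lebesgue_on_ivl by auto
  obtain C0 where C0: "AE x in ivl 1. A * \<tau>\<^sub>s x powr (- \<gamma>) + (b\<^sub>s x)\<^sup>2 / 2 = C0"
    using assms(9) unfolding stationary_solution_def AE_lebesgue_on_ivl by auto
  have st: "AE x in ivl 1. A * \<tau>\<^sub>s x powr (- \<gamma>) + Q x / (\<tau>\<^sub>s x)\<^sup>2 = C0"
    using C0 b\<^sub>s t0(1) bB(1) by eventually_elim (simp add: Q_def M_def power_divide)
  have st_b: "AE x in ivl 1. 0 < C0 \<and> min 1 (A / C0) \<le> \<tau>\<^sub>s x \<and> \<tau>\<^sub>s x \<le> max 1 ((A + m) / C0)"
    using st \<tau>\<^sub>s_pos
  proof eventually_elim
    case (elim x)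
    show ?case using stationary_bounds[OF assms(1,2) elim(2) Q elim(1)] by simp
  qed
  have C0_pos: "0 < C0" using AE_ivl_ex[OF st_b, of 0 1] by auto
  define s1 where "s1 = min 1 (A / C0)"
  define s2 where "s2 = max 1 ((A + m) / C0)"
  have s1: "0 < s1" "s1 \<le> s2" using C0_pos assms(1) by (auto simp: s1_def s2_def)
  have "AE x in ivl 1. s1 \<le> \<tau>\<^sub>s x \<and> \<tau>\<^sub>s x \<le> s2" using st_b by eventually_elim (simp add: s1_def s2_def)
  from clamp_representative[OF borel_measurable_integrable[OF \<tau>\<^sub>si] this s1(2)] obtain ts
    where tsm [measurable]: "ts \<in> borel_measurable borel" and ts: "AE x in ivl 1. \<tau>\<^sub>s x = ts x" "\<And>x. s1 \<le> ts x" "\<And>x. ts x \<le> s2"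
    by blast
  interpret D: mhd_data A \<gamma> \<mu> t0 u0 Q ts a a' m s1 s2 C0
  proof
    show "Q \<in> borel_measurable borel" unfolding Q_def[abs_def] by measurable
    show "(\<integral>x. t0 x \<partial>ivl 1) = 1"
      using leb_transfer(3)[OF S1 t0m t0(1)[unfolded ivl_def]] assms(8) by (simp add: ivl_def)
    show "(\<integral>x. ts x \<partial>ivl 1) = 1"
      using leb_transfer(3)[OF S1 tsm ts(1)[unfolded ivl_def]] \<tau>\<^sub>s1 by (simp add: ivl_def)
    show "AE x in ivl 1. A * ts x powr - \<gamma> + Q x / (ts x)\<^sup>2 = C0"
      using st ts(1) by eventually_elim simp
  qed (use assms(1-3) a(1) t0(2,3) Q u0(1) s1(1) ts(2,3) in auto)
  define bs where "bs x = M x / ts x" for x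
  have bsm [measurable]: "bs \<in> borel_measurable borel" unfolding bs_def[abs_def] by measurable
  have bs: "AE x in ivl 1. b\<^sub>s x = bs x"
    using b\<^sub>s t0(1) bB(1) ts(1) by eventually_elim (simp add: bs_def M_def)
  have bs_s: "sq_int (ivl 1) bs"
  proof (rule ivl.sq_int_bounded[of _ _ "\<beta> * a' / s1"])
    show "AE x in ivl 1. \<bar>bs x\<bar> \<le> \<beta> * a' / s1"
    proof (intro AE_I2)
      fix x show "\<bar>bs x\<bar> \<le> \<beta> * a' / s1"
        unfolding bs_def abs_divide using M_le[of x] ts(2)[of x] s1(1) by (intro frac_le) auto
    qed
  qed simp
  define B where "B = \<beta> * a' / D.lo'\<^sup>2"
  have B: "0 \<le> B" using a'0 by (simp add: B_def \<beta>_def)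
  define M0 where "M0 = max 0 (4 * D.L\<^sub>0 / min 1 D.k1)"
  define C1 where "C1 = (2 + B) * sqrt M0 + 1"
  have "0 < C1" using B by (simp add: C1_def M0_def add_nonneg_pos)
  moreover have "0 < D.\<delta> / 2" using D.\<delta>_pos by simp
  moreover have "L2_norm \<Omega> (\<lambda>x. \<tau>' t x - \<tau>\<^sub>s x) + L2_norm \<Omega> (u' t) + L2_norm \<Omega> (\<lambda>x. b' t x - b\<^sub>s x)
             \<le> C1 * exp (- (D.\<delta> / 2) * t)"
    if gw: "global_weak_solution A \<gamma> \<mu> \<tau>\<^sub>0 u\<^sub>0 b\<^sub>0 \<tau> u b"
      and \<tau>': "L2_continuous_rep {0..} \<tau> \<tau>'" and u': "L2_continuous_rep {0..} u u'" and b': "L2_continuous_rep {0..} b b'"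
      and t: "0 \<le> t" for \<tau> u b \<tau>' u' b' t
  proof -
    have in2: "in_L2 \<Omega> (\<tau>' r)" "in_L2 \<Omega> (u' r)" "in_L2 \<Omega> (b' r)" if "0 \<le> r" for r
      using \<tau>' u' b' that by (auto simp: L2_continuous_rep_def)
    define f where "f r = nrm (ivl 1) (\<lambda>x. rep (\<tau>' r) x - ts x) + nrm (ivl 1) (\<lambda>x. rep (u' r) x - 0)
      + nrm (ivl 1) (\<lambda>x. rep (b' r) x - bs x)" for r
    have f_eq: "L2_norm \<Omega> (\<lambda>x. \<tau>' r x - \<tau>\<^sub>s x) + L2_norm \<Omega> (u' r) + L2_norm \<Omega> (\<lambda>x. b' r x - b\<^sub>s x) = f r"
      if r: "0 \<le> r" for r
    proof -
      have "L2_norm \<Omega> (\<lambda>x. \<tau>' r x - \<tau>\<^sub>s x) = nrm (ivl 1) (\<lambda>x. rep (\<tau>' r) x - ts x)"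
      proof (rule L2_norm_nrm)
        show "AE x in ivl 1. \<tau>' r x - \<tau>\<^sub>s x = rep (\<tau>' r) x - ts x"
          using rep(2)[OF in2(1)[OF r]] ts(1) by eventually_elim simp
      qed (intro sq_int_diff rep in2 r D.\<tau>s_s)
      moreover have "L2_norm \<Omega> (u' r) = nrm (ivl 1) (\<lambda>x. rep (u' r) x - 0)"
        using rep[OF in2(2)[OF r]] by (intro L2_norm_nrm) auto
      moreover have "L2_norm \<Omega> (\<lambda>x. b' r x - b\<^sub>s x) = nrm (ivl 1) (\<lambda>x. rep (b' r) x - bs x)"
      proof (rule L2_norm_nrm)
        show "AE x in ivl 1. b' r x - b\<^sub>s x = rep (b' r) x - bs x"
          using rep(2)[OF in2(3)[OF r]] bs by eventually_elim simp
      qed (intro sq_int_diff rep in2 r bs_s)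
      ultimately show ?thesis by (simp add: f_def)
    qed
    define T where "T = t + 1"
    have T: "0 < T" "t < T" using t by (auto simp: T_def)
    have ws: "weak_solution A \<gamma> \<mu> \<tau>\<^sub>0 u\<^sub>0 b\<^sub>0 T \<tau> u b" using gw T by (auto simp: global_weak_solution_def)
    have Qb: "AE x in ivl 1. (b\<^sub>0 x * \<tau>\<^sub>0 x)\<^sup>2 / 2 = Q x"
      using t0(1) bB(1) by eventually_elim (simp add: Q_def M_def)
    obtain v c C where sol: "mhd_sol A \<gamma> \<mu> t0 u0 Q ts a a' m s1 s2 C0 T v c C (\<lambda>t. rep (u' t))"
      and \<tau>th: "AE t in ivl T. AE x in ivl 1. \<tau> (x, t) = t0 x + ival T (v x) 0 t"
      and bt: "AE p in ivl2 T. b p = b\<^sub>0 (fst p) * \<tau>\<^sub>0 (fst p) / \<tau> p"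
      using D.weak_solution_mhd_sol[OF T(1) ws u' t0(1) Qb u0(2)] by blast
    interpret S: mhd_sol A \<gamma> \<mu> t0 u0 Q ts a a' m s1 s2 C0 T v c C "\<lambda>t. rep (u' t)" by (rule sol)
    have AEs: "AE r in ivl T. r \<in> {0..} \<and> (AE x in ivl 1. \<tau> (x, r) = \<tau>' r x)"
      "AE r in ivl T. r \<in> {0..} \<and> (AE x in ivl 1. b (x, r) = b' r x)"
      by (rule L2_rep_AE[OF \<tau>'] L2_rep_AE[OF b']; auto)+
    have est: "AE r in ivl T. f r \<le> C1 * exp (- (D.\<delta> / 2) * r)"
      using AEs AE_ivl2_slices(2)[OF bt] \<tau>th AE_ivl_mem[of T]
    proof eventually_elim
      case (elim r)
      then have r: "0 \<le> r" "r < T" by auto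
      have [measurable]: "rep (\<tau>' r) \<in> borel_measurable borel" "rep (b' r) \<in> borel_measurable borel"
        using rep(1)[OF in2(1)[OF r(1)]] rep(1)[OF in2(3)[OF r(1)]] by (auto simp: sq_int_def)
      have th: "AE x in ivl 1. rep (\<tau>' r) x = S.th x r"
      proof -
        have "AE x in ivl 1. \<tau> (x, r) = \<tau>' r x" using elim by simp
        with rep(2)[OF in2(1)[OF r(1)]] elim(4) show ?thesis by eventually_elim (simp add: S.th_def)
      qed
      define E where "E = M0 * exp (- D.\<delta> * r)"
      have "S.e r + S.N r \<le> E"
        using S.decay[OF r] mult_right_mono[of "4 * D.L\<^sub>0 / min 1 D.k1" M0 "exp (- D.\<delta> * r)"]
        by (simp add: E_def M0_def)
      then have EE: "S.e r \<le> E" "S.N r \<le> E" using S.e_nonneg[of r] S.N_nonneg[of r] by linarith+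
      have sE: "sqrt E = sqrt M0 * exp (- (D.\<delta> / 2) * r)"
      proof (rule real_sqrt_unique)
        have "exp (- (D.\<delta> / 2) * r) * exp (- (D.\<delta> / 2) * r) = exp (- D.\<delta> * r)"
          by (simp add: exp_add[symmetric])
        then show "(sqrt M0 * exp (- (D.\<delta> / 2) * r))\<^sup>2 = E"
          unfolding E_def power_mult_distrib by (simp add: M0_def power2_eq_square)
      qed (simp add: M0_def)
      have 1: "nrm (ivl 1) (\<lambda>x. rep (\<tau>' r) x - ts x) \<le> sqrt E"
      proof -
        have "nrm (ivl 1) (\<lambda>x. rep (\<tau>' r) x - ts x) = nrm (ivl 1) (\<lambda>x. S.th x r - ts x)"
          using th by (intro nrm_cong) (auto elim: eventually_mono)
        also have "\<dots> = sqrt (S.N r)" by (simp add: nrm_def S.N_def)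
        finally show ?thesis using EE by simp
      qed
      have 2: "nrm (ivl 1) (\<lambda>x. rep (u' r) x - 0) \<le> sqrt E"
        using EE by (simp add: nrm_def S.e_def)
      have 3: "nrm (ivl 1) (\<lambda>x. rep (b' r) x - bs x) \<le> B * sqrt E"
      proof -
        have "nrm (ivl 1) (\<lambda>x. rep (b' r) x - bs x) \<le> B * nrm (ivl 1) (\<lambda>x. S.th x r - ts x)"
        proof (rule nrm_mono[OF _ S.d_s(2) B])
          have bb: "AE x in ivl 1. b (x, r) = b' r x" using elim by simp
          show "AE x in ivl 1. \<bar>rep (b' r) x - bs x\<bar> \<le> B * \<bar>S.th x r - ts x\<bar>"
            using rep(2)[OF in2(3)[OF r(1)]] bb elim(3,4) t0(1) bB(1) S.th_mem
          proof eventually_elim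
            case (elim x)
            have lo: "D.lo' \<le> S.th x r" "D.lo' \<le> ts x" using elim(7) r D.\<tau>s_mem[of x] by auto
            have pos: "0 < S.th x r" "0 < ts x" using lo D.lo'_pos by auto
            have "rep (b' r) x - bs x = M x / S.th x r - M x / ts x"
              using elim by (simp add: bs_def M_def S.th_def)
            also have "\<dots> = (M x / (S.th x r * ts x)) * (ts x - S.th x r)"
              using pos by (simp add: field_simps)
            finally have "\<bar>rep (b' r) x - bs x\<bar> = (\<bar>M x\<bar> / (S.th x r * ts x)) * \<bar>S.th x r - ts x\<bar>"
              using pos by (simp add: abs_mult abs_minus_commute)
            also have "\<dots> \<le> B * \<bar>S.th x r - ts x\<bar>"
              unfolding B_def power2_eq_square using M_le[of x] lo D.lo'_pos
              by (intro mult_right_mono frac_le mult_mono) auto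
            finally show ?case .
          qed
        qed simp
        also have "\<dots> = B * sqrt (S.N r)" by (simp add: nrm_def S.N_def)
        also have "\<dots> \<le> B * sqrt E" using EE B by (intro mult_left_mono) auto
        finally show ?thesis .
      qed
      have "f r \<le> (2 + B) * sqrt E" using 1 2 3 unfolding f_def distrib_right by linarith
      also have "\<dots> \<le> C1 * exp (- (D.\<delta> / 2) * r)" unfolding sE C1_def by (simp add: distrib_right mult.assoc)
      finally show ?case .
    qed
    define F where "F r = max 0 (f (max 0 r) - C1 * exp (- (D.\<delta> / 2) * max 0 r))" for r
    have fc: "continuous_on {0..} f"
      unfolding f_def by (intro continuous_intros L2_rep_continuous_nrm[OF \<tau>'] L2_rep_continuous_nrm[OF u']
        L2_rep_continuous_nrm[OF b'] D.\<tau>s_s bs_s ivl.sq_int_const)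
    have "continuous_on UNIV F"
      unfolding F_def by (intro continuous_intros continuous_on_compose2[OF fc]) auto
    moreover have "AE r in ivl T. F r \<in> {0..0}"
      using est AE_ivl_mem[of T] by eventually_elim (auto simp: F_def)
    ultimately have "F t \<in> {0..0}" using t T by (intro AE_closed_imp_all) auto
    then have "f t \<le> C1 * exp (- (D.\<delta> / 2) * t)" using t by (auto simp: F_def max_def split: if_splits)
    then show ?thesis using f_eq[OF t] by simp
  qed
  ultimately show ?thesis by blast
qed

end
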